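(* Let $d,d',s$ be fixed, let $K$ be a homogeneous $s$-dimensional Calderón–Zygmund kernel with Hölder parameter $\alpha$, and let $\Lambda>0$. For each $\varepsilon\in(0,\tfrac12)$ there exist $M'=M'(\varepsilon)>0$ and $\tau'=\tau'(\varepsilon)>0$, depending only on $\varepsilon,d,s,\alpha,\|K\|_*,\Lambda$, such that for every non-trivial $\Lambda$-nice reflectionless measure $\mu$ and every $x\in\mathbb R^d$ at which $\overline T_\mu(1)(x)$ is defined: if $|\overline T_\mu(1)(x)|>\varepsilon$ and $\mathrm{dist}(x,\mathrm{supp}(\mu))=r$, then $\mu(B(x,M'r))\ge\tau' r^s$.
   Context: Fix integers $d\ge2$, $d'\ge1$ and $s\in(0,d)$. $B(x,r)$ is the open ball in $\mathbb R^d$; a measure is a non-negative locally finite Borel measure on $\mathbb R^d$; $\mathrm{supp}(\mu)$ is its closed support. $\mathrm{Lip}_0(\mathbb R^d)$ is the set of compactly supported (complex-valued) Lipschitz functions, $\mathrm{Lip}_B(\mathbb R^d)$ the set of bounded Lipschitz functions. Kernel. A homogeneous $s$-dimensional Calderón–Zygmund kernel is $K:\mathbb R^d\setminus\{0\}\to\mathbb C^{d'}$ with (i) $|K(x)|\le|x|^{-s}$; (ii) $K(-x)=-K(x)$; (iii) for some $\alpha\in(0,1]$ the $\alpha$-Hölder seminorm on $\mathbb R^d$, denoted $\|K\|_*$, of $x\mapsto K(x)|x|^{s+\alpha}$ (set to $0$ at $0$) is finite; (iv) $K(\lambda x)=\lambda^{-s}K(x)$ for $\lambda>0$, $x\ne0$.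 For $\delta>0$ let $K_\delta(x)=K(x)\big(\tfrac{|x|}{\max(\delta,|x|)}\big)^{s+\alpha}$, $K_\delta(0)=0$, and $K^\delta=K-K_\delta$ on $\mathbb R^d\setminus\{0\}$ (supported in $\overline{B(0,\delta)}$). Measures. $\mu$ is diffuse if $(x,y)\mapsto|x-y|^{1-s}$ is locally integrable with respect to $\mu\times\mu$; $\mu$ has restricted growth at infinity if $\int_{|x|\ge1}|x|^{-s-\alpha}d\mu(x)<\infty$; $\mu$ is $\Lambda$-nice if $\mu(B(x,r))\le\Lambda r^s$ for all $x\in\mathbb R^d$, $r>0$ (nice measures are diffuse with restricted growth). Forms. Let $H_{f,\varphi}(x,y)=\tfrac12[f(y)\varphi(x)-f(x)\varphi(y)]$. For $\mu$ diffuse and $f,\varphi\in\mathrm{Lip}_0(\mathbb R^d)$, $\langle T(f\mu),\varphi\rangle_\mu=\iint K(x-y)H_{f,\varphi}(x,y)\,d\mu(x)d\mu(y)$ (integrand read as $0$ on the diagonal). For $f\in\mathrm{Lip}_0$, $\varphi\in\mathrm{Lip}_B$, $\langle T^\delta(f\mu),\varphi\rangle_\mu=\iint K^\delta(x-y)H_{f,\varphi}(x,y)\,d\mu(x)d\mu(y)$. If $\mu$ also has restricted growth, $f\in\mathrm{Lip}_0$, $\int f\,d\mu=0$ and $\varphi\in\mathrm{Lip}_B$, then $\langle T(f\mu),\varphi\rangle_\mu=\langle T(f\mu),\psi\varphi\rangle_\mu+\int T(f\mu)(x)[1-\psi(x)]\varphi(x)d\mu(x)$, where $\psi\in\mathrm{Lip}_0$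 equals $1$ on a neighbourhood of $\mathrm{supp} f$ and $T(f\mu)(x)=\int K(x-y)f(y)d\mu(y)$; this does not depend on $\psi$. Reflectionless. A diffuse measure $\mu$ with restricted growth at infinity is reflectionless if $\langle T(f\mu),1\rangle_\mu=0$ for all $f\in\mathrm{Lip}_0(\mathbb R^d)$ with $\int f\,d\mu=0$. Potentials. For non-trivial diffuse $\mu$ with restricted growth, fix $\eta\in\mathrm{Lip}_0(\mathbb R^d)$, $\eta\ge0$, $\int\eta\,d\mu=1$. For $\varphi\in\mathrm{Lip}_B$ and $x\in\mathbb R^d$ with $\int_{B(x,1)}|x-y|^{-s}d\mu(y)<\infty$ (true for $m_d$-a.e. $x$, where $m_d$ is Lebesgue measure, and for every $x\notin\mathrm{supp}(\mu)$), $\overline T_\mu(\varphi)(x)$ is defined as $$\overline T_\mu(\varphi)(x)=\lim_{k\to\infty}\Big[\int K(y-x)\psi_k(y)\varphi(y)d\mu(y)-\langle T(\eta\mu),\psi_k\varphi\rangle_\mu\Big],$$ for any $\psi_k\in\mathrm{Lip}_0$, $0\le\psi_k\le1$, $\psi_k\equiv1$ on $B(0,k)$. Equivalently, for any $\delta>0$, $\overline T_\mu(\varphi)(x)=\overline T_{\mu,\delta}(\varphi)(x)+\int K^\delta(y-x)\varphi(y)d\mu(y)$, where $\overline T_{\mu,\delta}(\varphi)(x)=\iint[K_\delta(y-x)-K_\delta(y-z)]\varphi(y)\eta(z)\,d\mu(y)d\mu(z)-\langle T^\delta(\eta\mu),\varphi\rangle_\mu$. For reflectionless $\mu$ and $\varphi\equiv1$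 these values do not depend on $\eta$. *)

theory Defs
  imports "HOL-Analysis.Analysis"
begin

section \<open>Kernels\<close>

text \<open>
  An element of \<open>\<complex>\<^sup>d\<^sup>'\<close> is a function \<open>nat \<Rightarrow> complex\<close> of which only the values at
  \<open>i < d'\<close> matter, so that \<open>d'\<close> can be quantified inside a formula (in particular after constants
  that must not depend on it). A kernel \<open>K\<close> with values in \<open>\<complex>\<^sup>d\<^sup>'\<close> is a family of scalar kernels
  \<open>K i\<close>, \<open>i < d'\<close>; its value at \<open>0\<close> is irrelevant.
\<close>

definition cnorm :: "nat \<Rightarrow> (nat \<Rightarrow> complex) \<Rightarrow> real" where
  "cnorm d' v = L2_set (\<lambda>i. cmod (v i)) {..<d'}"

text \<open>The function \<open>K(x) \<bar>x\<bar>\<^sup>s\<^sup>+\<^sup>\<alpha>\<close>; it is \<open>0\<close> at \<open>0\<close> because \<open>0 powr a = 0\<close>.\<close>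

definition weighted_kernel ::
    "real \<Rightarrow> real \<Rightarrow> (nat \<Rightarrow> real^'n \<Rightarrow> complex) \<Rightarrow> real^'n \<Rightarrow> nat \<Rightarrow> complex" where
  "weighted_kernel s \<alpha> K x = (\<lambda>i. (norm x powr (s + \<alpha>)) *\<^sub>R K i x)"

definition kernel_holder_quotients ::
    "nat \<Rightarrow> real \<Rightarrow> real \<Rightarrow> (nat \<Rightarrow> real^'n \<Rightarrow> complex) \<Rightarrow> real set" where
  "kernel_holder_quotients d' s \<alpha> K =
     {cnorm d' (\<lambda>i. weighted_kernel s \<alpha> K x i - weighted_kernel s \<alpha> K y i) / dist x y powr \<alpha>
      | x y. x \<noteq> y}"

text \<open>The seminorm \<open>\<parallel>K\<parallel>\<^sub>*\<close>; meaningful when the set of quotients is bounded above.\<close>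

definition kernel_seminorm ::
    "nat \<Rightarrow> real \<Rightarrow> real \<Rightarrow> (nat \<Rightarrow> real^'n \<Rightarrow> complex) \<Rightarrow> real" where
  "kernel_seminorm d' s \<alpha> K = Sup (kernel_holder_quotients d' s \<alpha> K)"

definition cz_kernel ::
    "nat \<Rightarrow> real \<Rightarrow> real \<Rightarrow> (nat \<Rightarrow> real^'n \<Rightarrow> complex) \<Rightarrow> bool" where
  "cz_kernel d' s \<alpha> K \<longleftrightarrow>
     (\<forall>x. x \<noteq> 0 \<longrightarrow> cnorm d' (\<lambda>i. K i x) \<le> norm x powr (- s)) \<and>
     (\<forall>i<d'. \<forall>x. x \<noteq> 0 \<longrightarrow> K i (- x) = - K i x) \<and>
     bdd_above (kernel_holder_quotients d' s \<alpha> K) \<and>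
     (\<forall>i<d'. \<forall>x. \<forall>l>0. x \<noteq> 0 \<longrightarrow> K i (l *\<^sub>R x) = (l powr (- s)) *\<^sub>R K i x)"

section \<open>Measures\<close>

definition locally_finite_borel :: "(real^'n) measure \<Rightarrow> bool" where
  "locally_finite_borel \<mu> \<longleftrightarrow>
     sets \<mu> = sets borel \<and> (\<forall>x. \<exists>U. open U \<and> x \<in> U \<and> emeasure \<mu> U < \<infinity>)"

definition measure_support :: "(real^'n) measure \<Rightarrow> (real^'n) set" where
  "measure_support \<mu> = {x. \<forall>r>0. emeasure \<mu> (ball x r) > 0}"

definition nontrivial_measure :: "(real^'n) measure \<Rightarrow> bool" where
  "nontrivial_measure \<mu> \<longleftrightarrow> emeasure \<mu> UNIV \<noteq> 0"

text \<open>
  The function \<open>\<bar>x - y\<bar>\<^sup>1\<^sup>-\<^sup>s\<close> has the value \<open>\<infinity>\<close> on the diagonal when \<open>s > 1\<close>, whereas \<open>powr\<close> would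
  give \<open>0\<close> there; for \<open>s \<le> 1\<close> its value on the diagonal does not affect local integrability.
\<close>

definition diffuse :: "real \<Rightarrow> (real^'n) measure \<Rightarrow> bool" where
  "diffuse s \<mu> \<longleftrightarrow>
     (\<forall>C. compact C \<longrightarrow>
        (\<integral>\<^sup>+(x, y)\<in>C. (if x = y \<and> s > 1 then \<infinity> else ennreal (norm (x - y) powr (1 - s)))
           \<partial>(\<mu> \<Otimes>\<^sub>M \<mu>)) < \<infinity>)"

definition restricted_growth :: "real \<Rightarrow> real \<Rightarrow> (real^'n) measure \<Rightarrow> bool" where
  "restricted_growth s \<alpha> \<mu> \<longleftrightarrow>
     (\<integral>\<^sup>+x\<in>{x. norm x \<ge> 1}. ennreal (norm x powr (- s - \<alpha>)) \<partial>\<mu>) < \<infinity>"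

definition nice :: "real \<Rightarrow> real \<Rightarrow> (real^'n) measure \<Rightarrow> bool" where
  "nice s \<Lambda> \<mu> \<longleftrightarrow> (\<forall>x. \<forall>r>0. emeasure \<mu> (ball x r) \<le> ennreal (\<Lambda> * r powr s))"

section \<open>Bilinear forms\<close>

definition closed_support :: "(real^'n \<Rightarrow> 'b::real_normed_vector) \<Rightarrow> (real^'n) set" where
  "closed_support f = closure {x. f x \<noteq> 0}"

definition Lip0 :: "(real^'n \<Rightarrow> 'b::real_normed_vector) set" where
  "Lip0 = {f. (\<exists>L. L-lipschitz_on UNIV f) \<and> compact (closed_support f)}"

definition H_form ::
    "(real^'n \<Rightarrow> complex) \<Rightarrow> (real^'n \<Rightarrow> complex) \<Rightarrow> real^'n \<Rightarrow> real^'n \<Rightarrow> complex" where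
  "H_form f \<phi> x y = (1/2) * (f y * \<phi> x - f x * \<phi> y)"

text \<open>
  All forms and potentials are linear in the kernel, hence act coordinatewise; they are defined for
  a scalar kernel \<open>k\<close>, to be taken as the coordinates \<open>K i\<close> of \<open>K\<close>.

  \<open>T_form k \<mu> f \<phi>\<close> is \<open>\<langle>T(f\<mu>), \<phi>\<rangle>\<^sub>\<mu>\<close> for \<open>f, \<phi>\<close> in \<open>Lip0\<close>. The integrand vanishes on the diagonal since
  \<open>H_form f \<phi> x x = 0\<close>.
\<close>

definition T_form ::
    "(real^'n \<Rightarrow> complex) \<Rightarrow> (real^'n) measure \<Rightarrow> (real^'n \<Rightarrow> complex) \<Rightarrow> (real^'n \<Rightarrow> complex)
       \<Rightarrow> complex" where
  "T_form k \<mu> f \<phi> = (\<integral>(x, y). k (x - y) * H_form f \<phi> x y \<partial>(\<mu> \<Otimes>\<^sub>M \<mu>))"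

text \<open>\<open>T(f\<mu>)(x)\<close>, used only off the support of \<open>f\<close>.\<close>

definition T_fun ::
    "(real^'n \<Rightarrow> complex) \<Rightarrow> (real^'n) measure \<Rightarrow> (real^'n \<Rightarrow> complex) \<Rightarrow> real^'n \<Rightarrow> complex" where
  "T_fun k \<mu> f x = (\<integral>y. k (x - y) * f y \<partial>\<mu>)"

text \<open>
  \<open>\<langle>T(f\<mu>), \<phi>\<rangle>\<^sub>\<mu>\<close> for \<open>f\<close> in \<open>Lip0\<close> with \<open>\<integral>f d\<mu> = 0\<close> and \<open>\<phi>\<close> bounded Lipschitz: the common value
  of the right-hand side over all admissible \<open>\<psi>\<close>.
\<close>

definition T_form_mean_zero ::
    "(real^'n \<Rightarrow> complex) \<Rightarrow> (real^'n) measure \<Rightarrow> (real^'n \<Rightarrow> complex) \<Rightarrow> (real^'n \<Rightarrow> complex)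
       \<Rightarrow> complex" where
  "T_form_mean_zero k \<mu> f \<phi> =
     (THE v. \<forall>\<psi>\<in>Lip0. (\<exists>U. open U \<and> closed_support f \<subseteq> U \<and> (\<forall>x\<in>U. \<psi> x = 1)) \<longrightarrow>
        v = T_form k \<mu> f (\<lambda>x. \<psi> x * \<phi> x) + (\<integral>x. T_fun k \<mu> f x * (1 - \<psi> x) * \<phi> x \<partial>\<mu>))"

definition reflectionless ::
    "nat \<Rightarrow> real \<Rightarrow> real \<Rightarrow> (nat \<Rightarrow> real^'n \<Rightarrow> complex) \<Rightarrow> (real^'n) measure \<Rightarrow> bool" where
  "reflectionless d' s \<alpha> K \<mu> \<longleftrightarrow>
     diffuse s \<mu> \<and> restricted_growth s \<alpha> \<mu> \<and>
     (\<forall>f\<in>Lip0. (\<integral>x. f x \<partial>\<mu>) = 0 \<longrightarrow> (\<forall>i<d'. T_form_mean_zero (K i) \<mu> f (\<lambda>_. 1) = 0))"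

section \<open>Potentials\<close>

definition normalizer :: "(real^'n) measure \<Rightarrow> (real^'n \<Rightarrow> real) \<Rightarrow> bool" where
  "normalizer \<mu> \<eta> \<longleftrightarrow> \<eta> \<in> Lip0 \<and> (\<forall>x. 0 \<le> \<eta> x) \<and> (\<integral>x. \<eta> x \<partial>\<mu>) = 1"

definition cutoff_sequence :: "(nat \<Rightarrow> real^'n \<Rightarrow> real) \<Rightarrow> bool" where
  "cutoff_sequence \<psi> \<longleftrightarrow>
     (\<forall>k. \<psi> k \<in> Lip0 \<and> (\<forall>x. 0 \<le> \<psi> k x \<and> \<psi> k x \<le> 1) \<and> (\<forall>x\<in>ball 0 (real k). \<psi> k x = 1))"

text \<open>
  Where the potential is defined. In \<^typ>\<open>ennreal\<close> the integrand is \<open>\<infinity>\<close> at \<open>y = x\<close>, so \<open>x\<close> cannot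
  be an atom.
\<close>

definition potential_defined :: "real \<Rightarrow> (real^'n) measure \<Rightarrow> real^'n \<Rightarrow> bool" where
  "potential_defined s \<mu> x \<longleftrightarrow>
     (\<integral>\<^sup>+y\<in>ball x 1. inverse (ennreal (norm (x - y) powr s)) \<partial>\<mu>) < \<infinity>"

text \<open>The common limit over all cutoff sequences.\<close>

definition potential ::
    "(real^'n \<Rightarrow> complex) \<Rightarrow> (real^'n) measure \<Rightarrow> (real^'n \<Rightarrow> real) \<Rightarrow> (real^'n \<Rightarrow> complex)
       \<Rightarrow> real^'n \<Rightarrow> complex" where
  "potential k \<mu> \<eta> \<phi> x =
     (THE v. \<forall>\<psi>. cutoff_sequence \<psi> \<longrightarrow>
        (\<lambda>j. (\<integral>y. k (y - x) * of_real (\<psi> j y) * \<phi> y \<partial>\<mu>)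
              - T_form k \<mu> (\<lambda>y. of_real (\<eta> y)) (\<lambda>y. of_real (\<psi> j y) * \<phi> y))
        \<longlonglongrightarrow> v)"

end

(*
  Let r = dist(x, supp mu) > 0 and suppose that mu (B(x, M r)) is smaller than tau r^s. If eta is
  replaced by another normalizer g, the potential of a reflectionless mu does not change, so it
  suffices to find a g for which the approximations of the potential are small.

  Near the point of supp mu closest to x there is a point p and a scale 4 R <= r such that
  mu (B(p, 4 R)) <= 4^(d+1) mu (B(p, R)), for otherwise mu (B(p, 4^-j r)) would decay faster than
  4^(-d j) uniformly in p, and averaging over p with respect to Lebesgue measure would make mu vanish
  near supp mu. At the first such scale the density of mu at p has only decreased on the way down, so
  that mu (B(p, 4 R)) <= tau (4 R)^s as well. For a normalized bump g at p of radius R: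
    - the interactions within B(p, 4 R) are controlled by antisymmetry and doubling, with a factor that
      is small because the density at scale R is small;
    - the shells between B(p, 4 R) and B(x, M r) contribute a geometric series of size tau;
    - outside B(x, M r) the difference K(y - x) - K(y - z) is of size M^-alpha after integration.
  The vector-valued kernel is reduced to scalar kernels by pairing it with unit vectors.
*)
theory Submission
  imports Defs
begin

section \<open>Nice measures\<close>

text \<open>The obstacle: the bound on \<open>measure \<mu> (ball x (M * r))\<close> says nothing
  small about tiny balls inside \<open>B(p, 4 R)\<close>; there only niceness is available, with a
  constant \<open>\<Lambda>\<close> that is not small. Hence interactions at distance below
  \<open>\<theta> * R\<close> are made small by \<open>\<theta>\<close>, the remaining ones by
  \<open>\<tau>\<close> at the price \<open>\<theta> powr (- s)\<close>, and \<open>\<theta>\<close>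
  must be fixed before \<open>\<tau>\<close>. Normalizing the bump divides by its mass, for which no
  lower bound is known; only its ratio to the mass of \<open>B(p, 4 R)\<close> is controlled, and
  this is what doubling provides.

  The constant \<open>4 ^ (d + 1)\<close> works twice: \<open>4 ^ d\<close> pays for the Lebesgue
  averaging and the last factor \<open>4\<close> yields the contradiction; and since
  \<open>s < d\<close> it exceeds \<open>4 powr s\<close> by a factor of at least \<open>4\<close>,
  which makes the shells summable.

  Potential and mean-zero form are definite descriptions, so the limits must first be shown to exist
  and not to depend on the cutoffs. Separately, the kernel and \<open>T(g\<mu>)\<close> are only of
  order \<open>- s\<close> at infinity, which need not be integrable for growth \<open>s\<close>;
  their difference is of order \<open>- s - \<alpha>\<close>.\<close>

lemma norm_integral_le_nn:
  fixes h :: "'a \<Rightarrow> 'b::{banach, second_countable_topology}"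
  assumes "(\<integral>\<^sup>+x. ennreal (norm (h x)) \<partial>M) \<le> ennreal C" "0 \<le> C"
  shows "norm (integral\<^sup>L M h) \<le> C"
proof (cases "integrable M h")
  case True
  then show ?thesis
    using integral_norm_bound_ennreal[OF True] assms
    by (meson ennreal_le_iff order_trans)
next
  \<comment> \<open>The Bochner integral takes its default value \<open>0\<close> here, so the
    pieces of the potential can be bounded through nonnegative integrals alone.\<close>
  case False
  then show ?thesis using assms by (simp add: not_integrable_integral_eq)
qed

text \<open>Mean value theorem; the intermediate point stays between \<open>a / 2\<close> and
  \<open>2 * a\<close>. It serves to strip the weight off the kernel in
  \<open>k_diff\<close>.\<close>

lemma powr_diff_le:
  fixes a b p :: real
  assumes "0 < a" "a / 2 \<le> b" "b \<le> 2 * a" "0 < p"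
  shows "\<bar>b powr p - a powr p\<bar> \<le> p * 2 powr (p + 1) * a powr (p - 1) * \<bar>b - a\<bar>"
proof -
  have deriv: "\<exists>z. min a b \<le> z \<and> z \<le> max a b \<and>
      \<bar>b powr p - a powr p\<bar> = \<bar>b - a\<bar> * (p * z powr (p - 1))"
  proof -
    have *: "\<exists>z. c < z \<and> z < e \<and> e powr p - c powr p = (e - c) * (p * z powr (p - 1))"
      if "0 < c" "c < e" for c e :: real
      using that by (intro MVT2) (auto intro!: derivative_eq_intros)
    consider "a < b" | "b < a" | "a = b" by linarith
    then show ?thesis
    proof cases
      case 1
      then obtain z where z: "a < z" "z < b" "b powr p - a powr p = (b - a) * (p * z powr (p - 1))"
        using *[of a b] assms by auto
      then show ?thesis using 1 assms
        by (intro exI[of _ z]) (auto simp: abs_mult)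
    next
      case 2
      then obtain z where z: "b < z" "z < a" "a powr p - b powr p = (a - b) * (p * z powr (p - 1))"
        using *[of b a] assms by auto
      have "\<bar>b powr p - a powr p\<bar> = \<bar>a powr p - b powr p\<bar>" by simp
      also have "\<dots> = \<bar>b - a\<bar> * (p * z powr (p - 1))"
        unfolding z(3) using 2 assms by (simp add: abs_mult)
      finally show ?thesis using 2 z by (intro exI[of _ z]) auto
    qed auto
  qed
  then obtain z where z: "min a b \<le> z" "z \<le> max a b"
    "\<bar>b powr p - a powr p\<bar> = \<bar>b - a\<bar> * (p * z powr (p - 1))" by blast
  have z0: "a / 2 \<le> z" "z \<le> 2 * a" using z(1,2) assms by auto
  have zpos: "0 < z" using z0 assms by linarith
  \<comment> \<open>The sign of \<open>p - 1\<close> is unknown; in the quotient, numerator and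
    denominator can be estimated separately.\<close>
  have "z powr (p - 1) = z powr p / z" using zpos by (simp add: powr_diff)
  also have "\<dots> \<le> (2 * a) powr p / (a / 2)"
    using z0 assms zpos by (intro frac_le powr_mono2) auto
  also have "\<dots> = 2 powr (p + 1) * a powr (p - 1)"
    using assms by (simp add: powr_mult powr_add powr_diff)
  finally have "z powr (p - 1) \<le> 2 powr (p + 1) * a powr (p - 1)" .
  then have "\<bar>b - a\<bar> * (p * z powr (p - 1)) \<le> \<bar>b - a\<bar> * (p * (2 powr (p + 1) * a powr (p - 1)))"
    using assms by (intro mult_left_mono) auto
  then show ?thesis using z(3) by (simp add: mult_ac)
qed

section \<open>Scales, and annular sums for measures of growth \<open>s\<close>\<close>

lemma dyadic_scale_below:
  assumes "0 < (a::real)" "a < t"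
  shows "\<exists>i::nat. t * (1/2) ^ Suc i \<le> a \<and> a < t * (1/2) ^ i"
proof -
  have "\<exists>i::nat. t * (1/2) ^ i \<le> a"
  proof -
    obtain i where "(1/2) ^ i < a / t"
      using real_arch_pow_inv[of "a / t" "1/2"] assms by auto
    then show ?thesis using assms by (intro exI[of _ i]) (auto simp: field_simps)
  qed
  then obtain i where i: "t * (1/2) ^ i \<le> a" "\<And>j. j < i \<Longrightarrow> \<not> t * (1/2) ^ j \<le> a"
    using exists_least_iff[of "\<lambda>i. t * (1/2) ^ i \<le> a"] by blast
  then obtain j where "i = Suc j" using assms by (cases i) auto
  then show ?thesis using i by (intro exI[of _ j]) force
qed

lemma dyadic_scale_above:
  assumes "0 < N" "N \<le> (a::real)"
  shows "\<exists>i::nat. N * 2 ^ i \<le> a \<and> a < N * 2 ^ Suc i"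
proof -
  have "\<exists>i::nat. a < N * 2 ^ i"
    using real_arch_pow[of 2 "a / N"] assms by (auto simp: field_simps)
  then obtain i where i: "a < N * 2 ^ i" "\<And>j. j < i \<Longrightarrow> \<not> a < N * 2 ^ j"
    using exists_least_iff[of "\<lambda>i. a < N * 2 ^ i"] by blast
  then obtain j where "i = Suc j" using assms by (cases i) auto
  then show ?thesis using i by (intro exI[of _ j]) force
qed

locale nice_measure =
  fixes s \<Lambda> :: real and \<mu> :: "(real^'n) measure"
  assumes s_pos: "0 < s" and Lambda_pos: "0 < \<Lambda>"
    and sets_mu: "sets \<mu> = sets borel"
    and nice_mu: "nice s \<Lambda> \<mu>"
begin

lemma space_mu [simp]: "space \<mu> = UNIV"
  using sets_eq_imp_space_eq[OF sets_mu] by simp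

lemma borel_sets_mu [measurable_cong]: "sets \<mu> = sets borel"
  by (fact sets_mu)

lemma emeasure_ball_le: "0 < r \<Longrightarrow> emeasure \<mu> (ball x r) \<le> ennreal (\<Lambda> * r powr s)"
  using nice_mu unfolding nice_def by blast

lemma emeasure_ball_finite: "emeasure \<mu> (ball x r) < \<infinity>"
proof (cases "0 < r")
  case True
  then show ?thesis using emeasure_ball_le[OF True, of x]
    by (metis ennreal_less_top infinity_ennreal_def order_le_less_trans)
qed (simp add: ball_empty)

sublocale sigma_finite_measure \<mu>
proof
  show "\<exists>A. countable A \<and> A \<subseteq> sets \<mu> \<and> \<Union>A = space \<mu> \<and> (\<forall>a\<in>A. emeasure \<mu> a \<noteq> \<infinity>)"
  proof (intro exI[of _ "range (\<lambda>n::nat. ball (0::real^'n) (real n))"] conjI)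
    show "\<Union> (range (\<lambda>n. ball (0::real^'n) (real n))) = space \<mu>"
      by (auto simp: reals_Archimedean2)
    show "\<forall>a\<in>range (\<lambda>n. ball 0 (real n)). emeasure \<mu> a \<noteq> \<infinity>"
      using emeasure_ball_finite by (auto simp: less_top)
  qed (auto simp: sets_mu)
qed

lemma pair_mu: "pair_sigma_finite \<mu> \<mu>" ..

text \<open>Common engine for annuli shrinking to a point, annuli growing to infinity, and the
  shells around the doubling ball. Each point is charged to one ball containing it, so
  \<open>F\<close> is dominated by a series of weighted indicators; the overlap of the balls is
  harmless in an upper bound.\<close>

lemma nn_integral_le_geometric:
  assumes A: "A \<in> sets borel"
    and pw: "\<And>v. v \<in> A \<Longrightarrow> \<exists>i. v \<in> ball x (\<rho> i) \<and> F v \<le> ennreal (c i)"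
    and cb: "\<And>i::nat. ennreal (c i) * emeasure \<mu> (ball x (\<rho> i)) \<le> ennreal (C * q ^ i)"
    and q: "0 \<le> q" "q < 1" and C: "0 \<le> C"
  shows "(\<integral>\<^sup>+v\<in>A. F v \<partial>\<mu>) \<le> ennreal (C / (1 - q))"
proof -
  have [measurable]: "ball x (\<rho> i) \<in> sets \<mu>" for i
    by (simp add: sets_mu)
  have "(\<integral>\<^sup>+v\<in>A. F v \<partial>\<mu>) \<le> (\<integral>\<^sup>+v. (\<Sum>i. ennreal (c i) * indicator (ball x (\<rho> i)) v) \<partial>\<mu>)"
  proof (intro nn_integral_mono)
    fix v
    show "F v * indicator A v \<le> (\<Sum>i. ennreal (c i) * indicator (ball x (\<rho> i)) v)"
    proof (cases "v \<in> A")
      case True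
      then obtain i where i: "v \<in> ball x (\<rho> i)" "F v \<le> ennreal (c i)" using pw by blast
      have "F v * indicator A v \<le> (\<Sum>j\<in>{i}. ennreal (c j) * indicator (ball x (\<rho> j)) v)"
        using i True by simp
      also have "\<dots> \<le> (\<Sum>j. ennreal (c j) * indicator (ball x (\<rho> j)) v)"
        by (intro sum_le_suminf) auto
      finally show ?thesis .
    qed simp
  qed
  also have "\<dots> = (\<Sum>i. \<integral>\<^sup>+v. ennreal (c i) * indicator (ball x (\<rho> i)) v \<partial>\<mu>)"
    by (intro nn_integral_suminf) measurable
  also have "\<dots> = (\<Sum>i. ennreal (c i) * emeasure \<mu> (ball x (\<rho> i)))"
    by (subst nn_integral_cmult_indicator) (auto simp: sets_mu)
  also have "\<dots> \<le> (\<Sum>i. ennreal (C * q ^ i))"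
    by (intro suminf_le cb) auto
  also have "\<dots> = ennreal (\<Sum>i. C * q ^ i)"
    using q C by (intro suminf_ennreal2 summable_mult summable_geometric) auto
  also have "(\<Sum>i. C * q ^ i) = C / (1 - q)"
    using q by (subst suminf_mult) (auto simp: suminf_geometric summable_geometric)
  finally show ?thesis .
qed

text \<open>An annulus of radius \<open>a\<close> contributes a multiple of
  \<open>a powr (1 - s)\<close> times \<open>\<Lambda> * a powr s\<close>, that is of
  \<open>\<Lambda> * a\<close>, and the radii halve.\<close>

lemma nn_integral_kernel_near:
  assumes "0 < t"
  shows "(\<integral>\<^sup>+v\<in>ball u t. ennreal (norm (u - v) powr (1 - s)) \<partial>\<mu>) \<le> ennreal (2 powr (s + 1) * \<Lambda> * t)"
proof -
  define c where "c i = 2 powr s * (t * (1/2) ^ i) powr (1 - s)" for i :: nat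
  have "(\<integral>\<^sup>+v\<in>ball u t. ennreal (norm (u - v) powr (1 - s)) \<partial>\<mu>)
      \<le> ennreal ((2 powr s * \<Lambda> * t) / (1 - 1/2))"
  proof (rule nn_integral_le_geometric[where \<rho> = "\<lambda>i. t * (1/2) ^ i" and c = c])
    fix v assume v: "v \<in> ball u t"
    show "\<exists>i. v \<in> ball u (t * (1/2) ^ i) \<and> ennreal (norm (u - v) powr (1 - s)) \<le> ennreal (c i)"
    proof (cases "u = v")
      \<comment> \<open>\<open>0 powr (1 - s)\<close> is \<open>0\<close> even for
        \<open>s > 1\<close>, so the diagonal fits into the largest ball. Nothing is lost later,
        because \<open>H_form\<close> vanishes there.\<close>
      case True
      then show ?thesis using v by (intro exI[of _ 0]) auto
    next
      case False
      then obtain i where i: "t * (1/2) ^ Suc i \<le> norm (u - v)" "norm (u - v) < t * (1/2) ^ i"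
        using dyadic_scale_below[of "norm (u - v)" t] v by (auto simp: dist_norm)
      define a where "a = t * (1/2) ^ i"
      have a: "0 < a" "a / 2 \<le> norm (u - v)" "norm (u - v) < a"
        using i assms by (auto simp: a_def)
      \<comment> \<open>Splitting off one factor gives two monotone factors, whatever the sign of
        \<open>1 - s\<close>.\<close>
      have "norm (u - v) powr (1 - s) = norm (u - v) * norm (u - v) powr (- s)"
        using False by (simp add: powr_diff powr_minus divide_inverse)
      also have "\<dots> \<le> a * (a / 2) powr (- s)"
        using a s_pos by (intro mult_mono powr_mono2') auto
      also have "\<dots> = c i"
        using a unfolding c_def a_def[symmetric]
        by (simp add: powr_divide powr_minus powr_diff field_simps)
      finally show ?thesis using i by (intro exI[of _ i]) (auto simp: dist_norm intro!: ennreal_leI)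
    qed
  next
    fix i :: nat
    define a where "a = t * (1/2) ^ i"
    have a: "0 < a" using assms by (simp add: a_def)
    have "ennreal (c i) * emeasure \<mu> (ball u a) \<le> ennreal (c i) * ennreal (\<Lambda> * a powr s)"
      by (intro mult_left_mono emeasure_ball_le a) auto
    also have "\<dots> = ennreal (c i * (\<Lambda> * a powr s))"
      using Lambda_pos by (intro ennreal_mult[symmetric]) (auto simp: c_def)
    also have "c i * (\<Lambda> * a powr s) = 2 powr s * \<Lambda> * a"
      using a by (simp add: c_def a_def[symmetric] powr_diff)
    finally show "ennreal (c i) * emeasure \<mu> (ball u (t * (1/2) ^ i)) \<le> ennreal (2 powr s * \<Lambda> * t * (1/2) ^ i)"
      by (simp add: a_def mult_ac)
  qed (use assms Lambda_pos in auto)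
  also have "(2 powr s * \<Lambda> * t) / (1 - 1/2) = 2 powr (s + 1) * \<Lambda> * t"
    by (simp add: powr_add)
  finally show ?thesis .
qed

text \<open>Growth \<open>s\<close> against decay \<open>s + \<alpha>\<close>: a shell contributes a
  multiple of its radius to the power \<open>- \<alpha>\<close>. The factor
  \<open>N powr (- \<alpha>)\<close> is the source of the smallness far from
  \<open>x\<close>.\<close>

lemma nn_integral_tail:
  assumes "0 < N" "0 < \<alpha>"
  shows "(\<integral>\<^sup>+u\<in>- ball x N. ennreal (norm (u - x) powr (- s - \<alpha>)) \<partial>\<mu>)
     \<le> ennreal (\<Lambda> * 2 powr s * N powr (- \<alpha>) / (1 - 2 powr (- \<alpha>)))"
proof (rule nn_integral_le_geometric[where \<rho> = "\<lambda>i. N * 2 ^ Suc i"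
      and c = "\<lambda>i. (N * 2 ^ i) powr (- s - \<alpha>)"])
  fix u assume "u \<in> - ball x N"
  then have "N \<le> norm (u - x)" by (auto simp: dist_norm norm_minus_commute)
  then obtain i where i: "N * 2 ^ i \<le> norm (u - x)" "norm (u - x) < N * 2 ^ Suc i"
    using dyadic_scale_above[OF assms(1)] by blast
  then show "\<exists>i. u \<in> ball x (N * 2 ^ Suc i) \<and>
      ennreal (norm (u - x) powr (- s - \<alpha>)) \<le> ennreal ((N * 2 ^ i) powr (- s - \<alpha>))"
    using assms s_pos
    by (intro exI[of _ i]) (auto simp: dist_norm norm_minus_commute intro!: ennreal_leI powr_mono2')
next
  fix i :: nat
  define a where "a = N * 2 ^ i"
  have a: "0 < a" "N * 2 ^ Suc i = 2 * a" using assms by (simp_all add: a_def)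
  have "ennreal (a powr (- s - \<alpha>)) * emeasure \<mu> (ball x (2 * a))
      \<le> ennreal (a powr (- s - \<alpha>)) * ennreal (\<Lambda> * (2 * a) powr s)"
    using a by (intro mult_left_mono emeasure_ball_le) auto
  also have "\<dots> = ennreal (a powr (- s - \<alpha>) * (\<Lambda> * (2 * a) powr s))"
    using Lambda_pos by (intro ennreal_mult[symmetric]) auto
  also have "a powr (- s - \<alpha>) * (\<Lambda> * (2 * a) powr s) = \<Lambda> * 2 powr s * a powr (- \<alpha>)"
    using a by (simp add: powr_mult powr_diff powr_minus field_simps)
  also have "a powr (- \<alpha>) = N powr (- \<alpha>) * (2 powr (- \<alpha>)) ^ i"
    using assms by (simp add: a_def powr_mult powr_powr powr_realpow[symmetric] mult_ac)
  finally show "ennreal ((N * 2 ^ i) powr (- s - \<alpha>)) * emeasure \<mu> (ball x (N * 2 ^ Suc i))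
      \<le> ennreal (\<Lambda> * 2 powr s * N powr (- \<alpha>) * (2 powr (- \<alpha>)) ^ i)"
    unfolding a(2) by (simp add: a_def mult_ac)
qed (use assms Lambda_pos in \<open>auto simp: powr_less_one\<close>)

text \<open>Null balls cover the complement, possibly uncountably many; the Lindelof property leaves
  countably many. This turns a positive distance from \<open>x\<close> to the support into a null
  ball around \<open>x\<close>.\<close>

lemma emeasure_Compl_support: "emeasure \<mu> (- measure_support \<mu>) = 0"
proof -
  have "\<exists>r>0. emeasure \<mu> (ball x r) = 0" if "x \<notin> measure_support \<mu>" for x
    using that by (auto simp: measure_support_def not_less zero_less_iff_neq_zero)
  then obtain r where r: "\<And>x. x \<notin> measure_support \<mu> \<Longrightarrow> 0 < r x \<and> emeasure \<mu> (ball x (r x)) = 0"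
    by metis
  define \<F> where "\<F> = (\<lambda>x. ball x (r x)) ` (- measure_support \<mu>)"
  obtain \<F>' where F': "\<F>' \<subseteq> \<F>" "countable \<F>'" "\<Union>\<F>' = \<Union>\<F>"
    using Lindelof[of \<F>] by (auto simp: \<F>_def)
  have "- measure_support \<mu> \<subseteq> \<Union>\<F>"
    using r by (force simp: \<F>_def)
  moreover have "emeasure \<mu> (\<Union>\<F>') = 0"
  proof -
    have "\<F>' \<subseteq> null_sets \<mu>"
      using F'(1) r by (auto simp: \<F>_def null_sets_def sets_mu)
    then have "(\<Union>X\<in>\<F>'. X) \<in> null_sets \<mu>"
      using F'(2) by (intro null_sets_UN') auto
    then show ?thesis by (simp add: null_sets_def)
  qed
  moreover have "\<Union>\<F>' \<in> sets \<mu>"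
    using F' by (intro sets.countable_Union) (auto simp: \<F>_def sets_mu)
  ultimately show ?thesis
    using F'(3) by (metis emeasure_eq_0)
qed

lemma closed_measure_support: "closed (measure_support \<mu>)"
proof -
  have "open (- measure_support \<mu>)"
  proof (rule openI)
    fix x assume "x \<in> - measure_support \<mu>"
    then obtain r where r: "0 < r" "emeasure \<mu> (ball x r) = 0"
      by (auto simp: measure_support_def not_less zero_less_iff_neq_zero)
    have "y \<in> - measure_support \<mu>" if "y \<in> ball x r" for y
    proof -
      define t where "t = r - dist x y"
      have "0 < t" "ball y t \<subseteq> ball x r"
        using that by (auto simp: t_def) (smt (verit) dist_triangle)
      then show ?thesis using r emeasure_mono[of "ball y t" "ball x r" \<mu>]
        by (auto simp: measure_support_def sets_mu intro!: exI[of _ t])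
    qed
    then show "\<exists>e>0. ball x e \<subseteq> - measure_support \<mu>" using r by blast
  qed
  then show ?thesis by (simp add: closed_def)
qed

end

section \<open>Lipschitz functions and kernels\<close>

text \<open>In finite dimension the closure of a set is compact exactly when the set is bounded; in
  this form membership is easy to check for sums and images.\<close>

lemma Lip0_iff:
  "f \<in> Lip0 \<longleftrightarrow> (\<exists>L. L-lipschitz_on UNIV f) \<and> (\<exists>N. \<forall>x. N \<le> norm x \<longrightarrow> f x = 0)"
proof -
  have "bounded {x. f x \<noteq> 0} \<longleftrightarrow> (\<exists>N. \<forall>x. N \<le> norm x \<longrightarrow> f x = 0)"
  proof
    assume "bounded {x. f x \<noteq> 0}"
    then obtain a where a: "\<And>x. f x \<noteq> 0 \<Longrightarrow> norm x \<le> a" by (auto simp: bounded_iff)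
    then have "\<forall>x. a + 1 \<le> norm x \<longrightarrow> f x = 0" by force
    then show "\<exists>N. \<forall>x. N \<le> norm x \<longrightarrow> f x = 0" ..
  next
    assume "\<exists>N. \<forall>x. N \<le> norm x \<longrightarrow> f x = 0"
    then obtain N where "\<And>x. f x \<noteq> 0 \<Longrightarrow> norm x \<le> N" by (meson linear)
    then show "bounded {x. f x \<noteq> 0}" by (auto simp: bounded_iff)
  qed
  then show ?thesis by (simp add: Lip0_def closed_support_def)
qed

lemma Lip0E:
  assumes "f \<in> Lip0"
  obtains L C N where "0 \<le> L" "0 \<le> C" "0 < N" "L-lipschitz_on UNIV f"
    "\<And>x. norm (f x) \<le> C" "\<And>x. N \<le> norm x \<Longrightarrow> f x = 0"
proof -
  obtain L N where L: "L-lipschitz_on UNIV f" and N: "\<And>x. N \<le> norm x \<Longrightarrow> f x = 0"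
    using assms by (auto simp: Lip0_iff)
  have cont: "continuous_on UNIV f" by (rule lipschitz_on_continuous_on[OF L])
  have "compact (f ` cball 0 N)"
    by (intro compact_continuous_image continuous_on_subset[OF cont]) auto
  then obtain C where C: "\<And>x. x \<in> cball 0 N \<Longrightarrow> norm (f x) \<le> C"
    using compact_imp_bounded[of "f ` cball 0 N"] unfolding bounded_iff by (metis imageI)
  show ?thesis
  proof (rule that[of L "max C 0" "max N 1"])
    fix x show "norm (f x) \<le> max C 0"
      using C[of x] N[of x] by (cases "N \<le> norm x") auto
  qed (use L N lipschitz_on_nonneg[OF L] in auto)
qed

lemma Lip0_measurable: "f \<in> Lip0 \<Longrightarrow> f \<in> borel_measurable borel"
  using borel_measurable_continuous_onI lipschitz_on_continuous_on by (auto simp: Lip0_iff)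

lemma Lip0_add: "f \<in> Lip0 \<Longrightarrow> g \<in> Lip0 \<Longrightarrow> (\<lambda>x. f x + g x) \<in> Lip0"
proof -
  assume "f \<in> Lip0" "g \<in> Lip0"
  then obtain L1 L2 N1 N2 where "L1-lipschitz_on UNIV f" "L2-lipschitz_on UNIV g"
    "\<And>x. N1 \<le> norm x \<Longrightarrow> f x = 0" "\<And>x. N2 \<le> norm x \<Longrightarrow> g x = 0"
    by (auto simp: Lip0_iff)
  then show ?thesis unfolding Lip0_iff
    by (intro conjI exI[of _ "L1 + L2"] exI[of _ "max N1 N2"]) (auto intro: lipschitz_on_add)
qed

lemma Lip0_bounded_linear:
  assumes "bounded_linear h" "f \<in> Lip0"
  shows "(\<lambda>x. h (f x)) \<in> Lip0"
proof -
  interpret bounded_linear h by fact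
  obtain B where B: "B-lipschitz_on UNIV h"
    by (rule lipschitz_boundE) (use assms(1) in auto)
  obtain L N where L: "L-lipschitz_on UNIV f" and N: "\<And>x. N \<le> norm x \<Longrightarrow> f x = 0"
    using assms(2) by (auto simp: Lip0_iff)
  have "(B * L)-lipschitz_on UNIV (\<lambda>x. h (f x))"
    by (rule lipschitz_on_compose2[OF L lipschitz_on_subset[OF B]]) auto
  then show ?thesis unfolding Lip0_iff using N zero by metis
qed

lemma Lip0_diff: "f \<in> Lip0 \<Longrightarrow> g \<in> Lip0 \<Longrightarrow> (\<lambda>x. f x - g x) \<in> Lip0"
  using Lip0_add[of f "\<lambda>x. - g x"] Lip0_bounded_linear[OF bounded_linear_minus[OF bounded_linear_ident], of g]
  by simp

lemma Lip0_of_real: "f \<in> Lip0 \<Longrightarrow> (\<lambda>x. of_real (f x) :: complex) \<in> Lip0"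
  by (rule Lip0_bounded_linear[OF bounded_linear_of_real])

text \<open>A radial trapezoid of slope \<open>1 / R\<close>. Centred at the origin it is a cutoff;
  centred at the doubling ball and normalized it replaces \<open>\<eta>\<close>.\<close>

definition bump :: "real^'n \<Rightarrow> real \<Rightarrow> real^'n \<Rightarrow> real" where
  "bump p R y = max 0 (min 1 (2 - dist y p / R))"

lemma bump_bounds: "0 \<le> bump p R y" "bump p R y \<le> 1"
  by (auto simp: bump_def)

lemma bump_eq_1: "0 < R \<Longrightarrow> dist y p \<le> R \<Longrightarrow> bump p R y = 1"
  by (auto simp: bump_def)

lemma bump_eq_0: "0 < R \<Longrightarrow> 2 * R \<le> dist y p \<Longrightarrow> bump p R y = 0"
  by (auto simp: bump_def field_simps)

lemma bump_diff_le:
  assumes "0 < R"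
  shows "\<bar>bump p R u - bump p R v\<bar> \<le> dist u v / R"
proof -
  have "\<bar>bump p R u - bump p R v\<bar> \<le> \<bar>dist u p / R - dist v p / R\<bar>"
    by (auto simp: bump_def)
  also have "\<dots> = \<bar>dist u p - dist v p\<bar> / R"
    using assms by (simp add: diff_divide_distrib[symmetric])
  also have "\<dots> \<le> dist u v / R"
    using assms abs_dist_diff_le[of u p v] by (intro divide_right_mono) (auto simp: dist_commute)
  finally show ?thesis .
qed

lemma bump_Lip0:
  fixes p :: "real^'n"
  assumes "0 < R"
  shows "bump p R \<in> Lip0"
  unfolding Lip0_iff
proof
  show "\<exists>L. L-lipschitz_on UNIV (bump p R)"
    using bump_diff_le[OF assms] assms
    by (intro exI[of _ "1 / R"] lipschitz_onI) (auto simp: dist_real_def)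
  show "\<exists>N. \<forall>x. N \<le> norm x \<longrightarrow> bump p R x = 0"
  proof (intro exI[of _ "norm p + 2 * R"] allI impI)
    fix x :: "real^'n" assume "norm p + 2 * R \<le> norm x"
    then have "2 * R \<le> dist x p"
      using norm_triangle_ineq2[of x p] by (simp add: dist_norm)
    then show "bump p R x = 0" by (rule bump_eq_0[OF assms])
  qed
qed

text \<open>The radius \<open>real j + 1\<close> stays positive at \<open>j = 0\<close>; with radius
  \<open>0\<close> the function \<open>bump\<close> would be constantly \<open>1\<close>, as
  division by zero gives \<open>0\<close>.\<close>

lemma cutoff_sequence_bump: "cutoff_sequence (\<lambda>j. bump 0 (real j + 1))"
  by (auto simp: cutoff_sequence_def bump_bounds bump_Lip0 intro!: bump_eq_1)

section \<open>Regularity of a scalar kernel\<close>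

text \<open>The constant in the Hoelder estimate \<open>k_diff\<close> for the unweighted kernel.
  The first summand comes from the weighted kernel. The second comes from the variation of the
  weight: \<open>p * 2 powr (p + 1)\<close> with \<open>p = s + \<alpha>\<close> from
  \<open>powr_diff_le\<close>, times \<open>2 powr s\<close> for the size of \<open>k\<close> at a
  point of at least half the norm.\<close>

definition kernel_const :: "real \<Rightarrow> real \<Rightarrow> real \<Rightarrow> real" where
  "kernel_const s \<alpha> \<kappa> = \<kappa> + (s + \<alpha>) * 2 powr (2 * s + \<alpha> + 1)"

text \<open>A scalar kernel instead of a coordinate of \<open>K\<close>: the same assumptions, with
  the same \<open>\<kappa>\<close>, hold for the pairing of \<open>K\<close> with any vector of
  \<open>cnorm\<close> at most \<open>1\<close>. A zero argument is allowed in
  \<open>k_holder\<close> because the weight vanishes there, whatever \<open>k 0\<close> is.\<close>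

locale cz_setting = nice_measure s \<Lambda> \<mu>
  for s \<Lambda> :: real and \<mu> :: "(real^'n) measure" +
  fixes \<alpha> \<kappa> :: real and k :: "real^'n \<Rightarrow> complex"
  assumes alpha_pos: "0 < \<alpha>" and alpha_le_1: "\<alpha> \<le> 1" and kappa_nonneg: "0 \<le> \<kappa>"
    and k_bound: "x \<noteq> 0 \<Longrightarrow> cmod (k x) \<le> norm x powr (- s)"
    and k_odd: "x \<noteq> 0 \<Longrightarrow> k (- x) = - k x"
    and k_holder: "cmod ((norm x powr (s + \<alpha>)) *\<^sub>R k x - (norm y powr (s + \<alpha>)) *\<^sub>R k y)
                     \<le> \<kappa> * dist x y powr \<alpha>"
begin

lemma kernel_const_nonneg: "0 \<le> kernel_const s \<alpha> \<kappa>"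
  using s_pos alpha_pos kappa_nonneg by (simp add: kernel_const_def)

text \<open>Only the weighted kernel is assumed Hoelder continuous. Dividing by the weight costs the
  variation of the weight, which is controlled because the two norms are comparable.\<close>

lemma k_diff:
  assumes u: "u \<noteq> 0" and uv: "norm (u - v) \<le> norm u / 2"
  shows "cmod (k u - k v) \<le> kernel_const s \<alpha> \<kappa> * norm (u - v) powr \<alpha> * norm u powr (- s - \<alpha>)"
proof -
  define a b p where "a = norm u" and "b = norm v" and "p = s + \<alpha>"
  have p: "0 < p" using s_pos alpha_pos by (simp add: p_def)
  have a: "0 < a" using u by (simp add: a_def)
  have ba: "\<bar>b - a\<bar> \<le> norm (u - v)"
    using norm_triangle_ineq3[of u v] by (simp add: a_def b_def abs_minus_commute)
  have b: "a / 2 \<le> b" "b \<le> 2 * a"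
    using ba uv a by (auto simp: a_def)
  have b0: "0 < b" using a b by linarith
  have "k u - k v = (a powr (- p)) *\<^sub>R ((a powr p) *\<^sub>R k u - (b powr p) *\<^sub>R k v)
        + ((b powr p - a powr p) * a powr (- p)) *\<^sub>R k v"
    using a by (simp add: scaleR_diff_right algebra_simps powr_add[symmetric])
  then have "cmod (k u - k v) \<le> a powr (- p) * cmod ((a powr p) *\<^sub>R k u - (b powr p) *\<^sub>R k v)
        + \<bar>b powr p - a powr p\<bar> * a powr (- p) * cmod (k v)"
    by (metis (no_types, opaque_lifting) norm_triangle_ineq norm_scaleR abs_mult powr_ge_zero abs_of_nonneg)
  also have "\<dots> \<le> a powr (- p) * (\<kappa> * norm (u - v) powr \<alpha>)
        + (p * 2 powr (p + 1) * a powr (p - 1) * norm (u - v)) * a powr (- p) * (2 powr s * a powr (- s))"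
  proof (intro add_mono mult_mono)
    show "cmod ((a powr p) *\<^sub>R k u - (b powr p) *\<^sub>R k v) \<le> \<kappa> * norm (u - v) powr \<alpha>"
      using k_holder[of u v] by (simp add: a_def b_def p_def dist_norm)
    show "\<bar>b powr p - a powr p\<bar> \<le> p * 2 powr (p + 1) * a powr (p - 1) * norm (u - v)"
      using powr_diff_le[OF a b(1,2) p] ba p by (smt (verit) mult_left_mono mult_nonneg_nonneg powr_ge_zero)
    have "cmod (k v) \<le> b powr (- s)" using k_bound[of v] b0 by (auto simp: b_def)
    also have "\<dots> \<le> (a / 2) powr (- s)" using b a s_pos by (intro powr_mono2') auto
    also have "\<dots> = 2 powr s * a powr (- s)" using a by (simp add: powr_divide powr_minus field_simps)
    finally show "cmod (k v) \<le> 2 powr s * a powr (- s)" .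
  qed (use p in auto)
  also have "\<dots> = \<kappa> * norm (u - v) powr \<alpha> * a powr (- p)
        + p * 2 powr (p + 1 + s) * (norm (u - v) / a) * a powr (- s)"
    using a by (simp add: powr_add powr_diff powr_minus field_simps)
  also have "\<dots> \<le> \<kappa> * norm (u - v) powr \<alpha> * a powr (- p)
        + p * 2 powr (p + 1 + s) * (norm (u - v) / a) powr \<alpha> * a powr (- s)"
  proof -
    \<comment> \<open>The ratio is at most \<open>1\<close> and \<open>\<alpha> \<le> 1\<close>, so
      the first-order variation of the weight is absorbed into the Hoelder term.\<close>
    have "norm (u - v) / a \<le> (norm (u - v) / a) powr \<alpha>"
    proof (cases "u = v")
      case False
      have "(norm (u - v) / a) powr 1 \<le> (norm (u - v) / a) powr \<alpha>"
        using uv a alpha_le_1 by (intro powr_mono') (auto simp: a_def[symmetric] field_simps)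
      then show ?thesis using a by simp
    qed auto
    then show ?thesis using p by (intro add_left_mono mult_right_mono mult_left_mono) auto
  qed
  also have "\<dots> = kernel_const s \<alpha> \<kappa> * norm (u - v) powr \<alpha> * a powr (- s - \<alpha>)"
    using a by (simp add: kernel_const_def p_def powr_divide powr_diff powr_minus field_simps powr_add[symmetric])
  finally show ?thesis by (simp add: a_def)
qed

text \<open>The weighted kernel is Hoelder, hence continuous, and \<open>k\<close> is its quotient
  by the weight off the origin; the arbitrary value \<open>k 0\<close> affects a single
  point.\<close>

lemma k_measurable [measurable]: "k \<in> borel_measurable borel"
proof -
  define w where "w x = (norm x powr (s + \<alpha>)) *\<^sub>R k x" for x
  have "continuous_on UNIV w"
  proof (rule continuous_onI)
    fix x :: "real^'n" and e :: real assume e: "0 < e"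
    \<comment> \<open>The solution of \<open>(\<kappa> + 1) * d powr \<alpha> = e\<close>; adding
      \<open>1\<close> covers \<open>\<kappa> = 0\<close>.\<close>
    define d where "d = (e / (\<kappa> + 1)) powr (1 / \<alpha>)"
    have d: "0 < d" "d powr \<alpha> = e / (\<kappa> + 1)"
      using e kappa_nonneg alpha_pos by (auto simp: d_def powr_powr)
    have "dist (w y) (w x) \<le> e" if "dist y x < d" for y
    proof -
      have "dist (w y) (w x) \<le> \<kappa> * dist y x powr \<alpha>"
        using k_holder[of y x] by (simp add: w_def dist_norm)
      also have "\<dots> \<le> (\<kappa> + 1) * d powr \<alpha>"
        using that kappa_nonneg alpha_pos by (intro mult_mono powr_mono2) auto
      finally show ?thesis using d kappa_nonneg by simp
    qed
    then show "\<exists>d>0. \<forall>x'\<in>UNIV. dist x' x < d \<longrightarrow> dist (w x') (w x) \<le> e" using d by blast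
  qed
  then have [measurable]: "w \<in> borel_measurable borel" by (rule borel_measurable_continuous_onI)
  have "k = (\<lambda>x. if x = 0 then k 0 else inverse (norm x powr (s + \<alpha>)) *\<^sub>R w x)"
    by (auto simp: w_def fun_eq_iff)
  moreover have "(\<lambda>x. if x = 0 then k 0 else inverse (norm x powr (s + \<alpha>)) *\<^sub>R w x) \<in> borel_measurable borel"
    by measurable
  ultimately show ?thesis by simp
qed

end

section \<open>The bilinear form\<close>

text \<open>Inserting \<open>f v * \<phi> v\<close> with both signs turns \<open>H_form\<close> into
  differences. It thus vanishes to first order on the diagonal and improves the singularity of the
  kernel from order \<open>- s\<close> to order \<open>1 - s\<close>.\<close>

lemma H_form_le:
  assumes "Lf-lipschitz_on UNIV f" "Lg-lipschitz_on UNIV \<phi>"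
    "\<And>x. cmod (f x) \<le> Cf" "\<And>x. cmod (\<phi> x) \<le> Cg"
  shows "cmod (H_form f \<phi> u v) \<le> (Cf * Lg + Cg * Lf) / 2 * norm (u - v)"
proof -
  have eq: "H_form f \<phi> u v = (1/2) * (f v * (\<phi> u - \<phi> v) - \<phi> v * (f u - f v))"
    by (simp add: H_form_def algebra_simps)
  have "cmod (H_form f \<phi> u v) = (1/2) * cmod (f v * (\<phi> u - \<phi> v) - \<phi> v * (f u - f v))"
    unfolding eq norm_mult by simp
  also have "\<dots> \<le> (1/2) * (cmod (f v) * cmod (\<phi> u - \<phi> v) + cmod (\<phi> v) * cmod (f u - f v))"
    by (intro mult_left_mono order_trans[OF norm_triangle_ineq4]) (simp_all add: norm_mult)
  also have "\<dots> \<le> (1/2) * (Cf * (Lg * norm (u - v)) + Cg * (Lf * norm (u - v)))"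
    using assms(3)[of v] assms(4)[of v] lipschitz_onD[OF assms(1), of u v] lipschitz_onD[OF assms(2), of u v]
    by (intro mult_left_mono add_mono mult_mono) (auto simp: dist_norm intro: order_trans[OF norm_ge_zero])
  finally show ?thesis by (simp add: algebra_simps)
qed

lemma H_form_swap: "H_form f \<phi> v u = - H_form f \<phi> u v"
  by (simp add: H_form_def algebra_simps)

lemma H_form_same [simp]: "H_form f \<phi> u u = 0"
  by (simp add: H_form_def)

context nice_measure
begin

lemma double_integral_near:
  assumes [measurable]: "A \<in> sets borel"
    and le: "\<And>u. u \<in> A \<Longrightarrow> (\<integral>\<^sup>+v\<in>A. ennreal (norm (u - v) powr (1 - s)) \<partial>\<mu>) \<le> ennreal \<sigma>"
  shows "(\<integral>\<^sup>+w\<in>A \<times> A. ennreal (norm (fst w - snd w) powr (1 - s)) \<partial>(\<mu> \<Otimes>\<^sub>M \<mu>)) \<le> ennreal \<sigma> * emeasure \<mu> A"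
proof -
  have [measurable]: "A \<in> sets \<mu>" by (simp add: sets_mu)
  have "(\<integral>\<^sup>+w\<in>A \<times> A. ennreal (norm (fst w - snd w) powr (1 - s)) \<partial>(\<mu> \<Otimes>\<^sub>M \<mu>))
      = (\<integral>\<^sup>+u. \<integral>\<^sup>+v. ennreal (norm (u - v) powr (1 - s)) * indicator (A \<times> A) (u, v) \<partial>\<mu> \<partial>\<mu>)"
    using nn_integral_fst[of "\<lambda>w. ennreal (norm (fst w - snd w) powr (1 - s)) * indicator (A \<times> A) w" \<mu>]
    by simp
  also have "\<dots> \<le> (\<integral>\<^sup>+u. ennreal \<sigma> * indicator A u \<partial>\<mu>)"
  proof (intro nn_integral_mono)
    fix u
    show "(\<integral>\<^sup>+v. ennreal (norm (u - v) powr (1 - s)) * indicator (A \<times> A) (u, v) \<partial>\<mu>) \<le> ennreal \<sigma> * indicator A u"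
      using le[of u] by (cases "u \<in> A") (auto simp: indicator_times)
  qed
  also have "\<dots> = ennreal \<sigma> * emeasure \<mu> A"
    by (simp add: nn_integral_cmult_indicator)
  finally show ?thesis .
qed

text \<open>The bound is asked almost everywhere because the kernel centred at \<open>x\<close> is
  bounded only outside a null ball around \<open>x\<close>.\<close>

lemma integrable_bounded_support:
  fixes h :: "real^'n \<Rightarrow> complex"
  assumes [measurable]: "h \<in> borel_measurable borel"
    and "AE x in \<mu>. cmod (h x) \<le> C" and "\<And>x. N \<le> norm x \<Longrightarrow> h x = 0"
  shows "integrable \<mu> h"
proof (rule integrableI_bounded_set[where A = "ball 0 N" and B = C])
  show "AE x in \<mu>. x \<in> ball 0 N \<longrightarrow> norm (h x) \<le> C" using assms(2) by auto
qed (use assms(3) emeasure_ball_finite[of 0 N] in \<open>auto simp: sets_mu measurable_cong_sets[OF sets_mu refl] less_top\<close>)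

lemma Lip0_integrable:
  fixes f :: "real^'n \<Rightarrow> complex"
  assumes "f \<in> Lip0"
  shows "integrable \<mu> f"
proof -
  obtain L C N where "\<And>x. norm (f x) \<le> C" "\<And>x. N \<le> norm x \<Longrightarrow> f x = 0"
    using Lip0E[OF assms] by metis
  then show ?thesis using Lip0_measurable[OF assms]
    by (intro integrable_bounded_support) auto
qed

lemma integrable_decay:
  fixes h :: "real^'n \<Rightarrow> complex"
  assumes [measurable]: "h \<in> borel_measurable borel"
    and C: "\<And>u. cmod (h u) \<le> C" and N: "0 < N" and a: "0 < \<alpha>" and C': "0 \<le> C'"
    and decay: "\<And>u. N \<le> dist u x \<Longrightarrow> cmod (h u) \<le> C' * norm (u - x) powr (- s - \<alpha>)"
  shows "integrable \<mu> h"
proof (rule integrableI_bounded)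
  have [measurable]: "ball x N \<in> sets \<mu>" by (simp add: sets_mu)
  have "(\<integral>\<^sup>+u. ennreal (norm (h u)) \<partial>\<mu>)
    \<le> (\<integral>\<^sup>+u. ennreal C * indicator (ball x N) u
           + ennreal C' * (ennreal (norm (u - x) powr (- s - \<alpha>)) * indicator (- ball x N) u) \<partial>\<mu>)"
  proof (intro nn_integral_mono)
    fix u
    show "ennreal (norm (h u)) \<le> ennreal C * indicator (ball x N) u
           + ennreal C' * (ennreal (norm (u - x) powr (- s - \<alpha>)) * indicator (- ball x N) u)"
      using C[of u] decay[of u] C'
      by (cases "u \<in> ball x N") (auto simp: ennreal_mult[symmetric] dist_commute intro!: ennreal_leI)
  qed
  also have "\<dots> = ennreal C * emeasure \<mu> (ball x N)
      + ennreal C' * (\<integral>\<^sup>+u\<in>- ball x N. ennreal (norm (u - x) powr (- s - \<alpha>)) \<partial>\<mu>)"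
    by (simp add: nn_integral_add nn_integral_cmult nn_integral_cmult_indicator)
  also have "\<dots> < \<infinity>"
    using emeasure_ball_finite[of x N] order_le_less_trans[OF nn_integral_tail[OF N a, of x] ennreal_less_top]
    by (simp add: ennreal_mult_less_top less_top)
  finally show "(\<integral>\<^sup>+u. ennreal (norm (h u)) \<partial>\<mu>) < \<infinity>" .
qed (simp add: measurable_cong_sets[OF sets_mu refl])

end

context cz_setting
begin

interpretation pair_sigma_finite \<mu> \<mu> by (fact pair_mu)

lemma kernel_H_le:
  assumes "\<And>u v. cmod (H_form f \<phi> u v) \<le> C * norm (u - v)"
  shows "cmod (k (u - v) * H_form f \<phi> u v) \<le> C * norm (u - v) powr (1 - s)"
proof (cases "u = v")
  case False
  have "cmod (k (u - v) * H_form f \<phi> u v) \<le> norm (u - v) powr (- s) * (C * norm (u - v))"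
    unfolding norm_mult using k_bound[of "u - v"] assms False by (intro mult_mono) auto
  also have "\<dots> = C * norm (u - v) powr (1 - s)"
    using False by (simp add: powr_diff powr_minus divide_inverse)
  finally show ?thesis .
qed simp

lemma kernel_H_swap: "k (v - u) * H_form f \<phi> v u = k (u - v) * H_form f \<phi> u v"
  using k_odd[of "u - v"] H_form_swap[of f \<phi> v u] by (cases "u = v") auto

text \<open>Bochner integrals add only for integrable functions, so linearity of the form in either
  argument rests on this. The integrand is of order \<open>norm (u - v) powr (1 - s)\<close> and
  lives on a bounded square.\<close>

lemma T_form_integrable:
  assumes f: "f \<in> Lip0" and g: "\<phi> \<in> Lip0"
  shows "integrable (\<mu> \<Otimes>\<^sub>M \<mu>) (\<lambda>(u, v). k (u - v) * H_form f \<phi> u v)"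
proof -
  note [measurable] = Lip0_measurable[OF f] Lip0_measurable[OF g]
  obtain Lf Cf Nf where F: "0 \<le> Lf" "0 \<le> Cf" "Lf-lipschitz_on UNIV f"
    "\<And>x. norm (f x) \<le> Cf" "\<And>x. Nf \<le> norm x \<Longrightarrow> f x = 0"
    using Lip0E[OF f] by metis
  obtain Lg Cg Ng where G: "0 \<le> Lg" "0 \<le> Cg" "Lg-lipschitz_on UNIV \<phi>"
    "\<And>x. norm (\<phi> x) \<le> Cg" "\<And>x. Ng \<le> norm x \<Longrightarrow> \<phi> x = 0"
    using Lip0E[OF g] by metis
  define C where "C = (Cf * Lg + Cg * Lf) / 2"
  define N where "N = max 1 (max Nf Ng)"
  have C: "0 \<le> C" using F G by (simp add: C_def)
  have H: "cmod (H_form f \<phi> u v) \<le> C * norm (u - v)" for u v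
    unfolding C_def by (rule H_form_le[OF F(3) G(3) F(4) G(4)])
  have Z: "H_form f \<phi> u v = 0" if "u \<notin> ball 0 N \<or> v \<notin> ball 0 N" for u v
    using that F(5)[of u] F(5)[of v] G(5)[of u] G(5)[of v] by (auto simp: H_form_def N_def)
  have N: "0 < N" by (simp add: N_def)
  have near: "(\<integral>\<^sup>+v\<in>ball 0 N. ennreal (norm (u - v) powr (1 - s)) \<partial>\<mu>)
      \<le> ennreal (2 powr (s + 1) * \<Lambda> * (2 * N))" if "u \<in> ball 0 N" for u
  proof -
    have "v \<in> ball u (2 * N)" if "v \<in> ball 0 N" for v
      using that \<open>u \<in> ball 0 N\<close> norm_triangle_ineq4[of u v] by (auto simp: dist_norm)
    then have "(\<integral>\<^sup>+v\<in>ball 0 N. ennreal (norm (u - v) powr (1 - s)) \<partial>\<mu>)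
        \<le> (\<integral>\<^sup>+v\<in>ball u (2 * N). ennreal (norm (u - v) powr (1 - s)) \<partial>\<mu>)"
      by (intro nn_integral_mono) (auto simp: indicator_def)
    also have "\<dots> \<le> ennreal (2 powr (s + 1) * \<Lambda> * (2 * N))"
      using N by (intro nn_integral_kernel_near) auto
    finally show ?thesis .
  qed
  show ?thesis
  proof (rule integrableI_bounded)
    have "(\<integral>\<^sup>+w. ennreal (norm ((\<lambda>(u, v). k (u - v) * H_form f \<phi> u v) w)) \<partial>(\<mu> \<Otimes>\<^sub>M \<mu>))
       \<le> (\<integral>\<^sup>+w. ennreal C * (ennreal (norm (fst w - snd w) powr (1 - s)) * indicator (ball 0 N \<times> ball 0 N) w) \<partial>(\<mu> \<Otimes>\<^sub>M \<mu>))"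
    proof (intro nn_integral_mono)
      fix w :: "(real^'n) \<times> (real^'n)"
      obtain u v where w: "w = (u, v)" by (cases w)
      show "ennreal (norm ((\<lambda>(u, v). k (u - v) * H_form f \<phi> u v) w))
        \<le> ennreal C * (ennreal (norm (fst w - snd w) powr (1 - s)) * indicator (ball 0 N \<times> ball 0 N) w)"
      proof (cases "u \<in> ball 0 N \<and> v \<in> ball 0 N")
        case True
        then show ?thesis using kernel_H_le[OF H, of u v] C w
          by (auto simp: ennreal_mult[symmetric] intro!: ennreal_leI)
      next
        case False
        then show ?thesis using Z[of u v] w by auto
      qed
    qed
    also have "\<dots> = ennreal C * (\<integral>\<^sup>+w\<in>ball 0 N \<times> ball 0 N. ennreal (norm (fst w - snd w) powr (1 - s)) \<partial>(\<mu> \<Otimes>\<^sub>M \<mu>))"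
    proof -
      have [measurable]: "ball 0 N \<in> sets \<mu>" by (simp add: sets_mu)
      show ?thesis by (intro nn_integral_cmult) measurable
    qed
    also have "\<dots> \<le> ennreal C * (ennreal (2 powr (s + 1) * \<Lambda> * (2 * N)) * emeasure \<mu> (ball 0 N))"
      by (intro mult_left_mono double_integral_near near) auto
    also have "\<dots> < \<infinity>"
      using emeasure_ball_finite[of 0 N] by (simp add: ennreal_mult_less_top less_top)
    finally show "(\<integral>\<^sup>+w. ennreal (norm ((\<lambda>(u, v). k (u - v) * H_form f \<phi> u v) w)) \<partial>(\<mu> \<Otimes>\<^sub>M \<mu>)) < \<infinity>" .
  qed (simp add: H_form_def split_beta')
qed

lemma T_form_diff_right:
  assumes "f \<in> Lip0" "\<phi> \<in> Lip0" "\<psi> \<in> Lip0"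
  shows "T_form k \<mu> f (\<lambda>x. \<phi> x - \<psi> x) = T_form k \<mu> f \<phi> - T_form k \<mu> f \<psi>"
proof -
  have "T_form k \<mu> f (\<lambda>x. \<phi> x - \<psi> x) = (\<integral>w. (\<lambda>(u, v). k (u - v) * H_form f \<phi> u v) w
      - (\<lambda>(u, v). k (u - v) * H_form f \<psi> u v) w \<partial>(\<mu> \<Otimes>\<^sub>M \<mu>))"
    unfolding T_form_def by (intro Bochner_Integration.integral_cong) (auto simp: H_form_def algebra_simps)
  then show ?thesis
    using T_form_integrable[OF assms(1,2)] T_form_integrable[OF assms(1,3)]
    by (simp add: T_form_def split_beta')
qed

lemma T_form_diff_left:
  assumes "f \<in> Lip0" "g \<in> Lip0" "\<phi> \<in> Lip0"
  shows "T_form k \<mu> (\<lambda>x. f x - g x) \<phi> = T_form k \<mu> f \<phi> - T_form k \<mu> g \<phi>"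
proof -
  have "T_form k \<mu> (\<lambda>x. f x - g x) \<phi> = (\<integral>w. (\<lambda>(u, v). k (u - v) * H_form f \<phi> u v) w
      - (\<lambda>(u, v). k (u - v) * H_form g \<phi> u v) w \<partial>(\<mu> \<Otimes>\<^sub>M \<mu>))"
    unfolding T_form_def by (intro Bochner_Integration.integral_cong) (auto simp: H_form_def algebra_simps)
  then show ?thesis
    using T_form_integrable[OF assms(1,3)] T_form_integrable[OF assms(2,3)]
    by (simp add: T_form_def split_beta')
qed

section \<open>\<open>T(f\<mu>)\<close> away from the support of \<open>f\<close>\<close>

lemma T_fun_integrable:
  assumes f: "f \<in> Lip0" and d: "0 < \<delta>" and sep: "\<And>v. f v \<noteq> 0 \<Longrightarrow> \<delta> \<le> dist u v"
  shows "integrable \<mu> (\<lambda>v. k (u - v) * f v)"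
    and "cmod (T_fun k \<mu> f u) \<le> \<delta> powr (- s) * (\<integral>v. cmod (f v) \<partial>\<mu>)"
proof -
  note [measurable] = Lip0_measurable[OF f]
  have le: "cmod (k (u - v) * f v) \<le> \<delta> powr (- s) * cmod (f v)" for v
  proof (cases "f v = 0")
    case False
    then have uv: "\<delta> \<le> norm (u - v)" using sep by (auto simp: dist_norm)
    then have "cmod (k (u - v)) \<le> norm (u - v) powr (- s)" using d by (intro k_bound) auto
    also have "\<dots> \<le> \<delta> powr (- s)" using uv d s_pos by (intro powr_mono2') auto
    finally show ?thesis by (simp add: norm_mult mult_right_mono)
  qed simp
  have int: "integrable \<mu> (\<lambda>v. \<delta> powr (- s) * cmod (f v))"
    using Lip0_integrable[OF f] by auto
  show i: "integrable \<mu> (\<lambda>v. k (u - v) * f v)"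
    by (rule Bochner_Integration.integrable_bound[OF int]) (use le in \<open>auto simp: abs_mult\<close>)
  have "cmod (T_fun k \<mu> f u) \<le> (\<integral>v. cmod (k (u - v) * f v) \<partial>\<mu>)"
    unfolding T_fun_def by (rule integral_norm_bound)
  also have "\<dots> \<le> (\<integral>v. \<delta> powr (- s) * cmod (f v) \<partial>\<mu>)"
    by (intro integral_mono int integrable_norm i le)
  finally show "cmod (T_fun k \<mu> f u) \<le> \<delta> powr (- s) * (\<integral>v. cmod (f v) \<partial>\<mu>)" by simp
qed

text \<open>Freezing the kernel at \<open>x\<close>: the shift is at most \<open>D\<close>, which is
  at most half of \<open>norm (u - x)\<close>, so \<open>k_diff\<close> applies. It is used in two
  ways: for mean \<open>0\<close> it says that \<open>T(f\<mu>)\<close> decays with the extra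
  exponent \<open>\<alpha>\<close>, for mean \<open>1\<close> that its difference to
  \<open>k (u - x)\<close> does.\<close>

lemma T_fun_approx:
  assumes f: "f \<in> Lip0" and D: "0 < D" and supp: "\<And>y. f y \<noteq> 0 \<Longrightarrow> dist y x \<le> D"
    and u: "2 * D \<le> dist u x"
  shows "cmod (T_fun k \<mu> f u - k (u - x) * (\<integral>y. f y \<partial>\<mu>))
     \<le> kernel_const s \<alpha> \<kappa> * D powr \<alpha> * norm (u - x) powr (- s - \<alpha>) * (\<integral>y. cmod (f y) \<partial>\<mu>)"
proof -
  note [measurable] = Lip0_measurable[OF f]
  define c where "c = kernel_const s \<alpha> \<kappa> * D powr \<alpha> * norm (u - x) powr (- s - \<alpha>)"
  have sep: "D \<le> dist u y" if "f y \<noteq> 0" for y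
    using supp[OF that] u dist_triangle[of u x y] by linarith
  note i1 = T_fun_integrable(1)[OF f D sep]
  have i2: "integrable \<mu> (\<lambda>y. k (u - x) * f y)" using Lip0_integrable[OF f] by auto
  have eq: "T_fun k \<mu> f u - k (u - x) * (\<integral>y. f y \<partial>\<mu>) = (\<integral>y. (k (u - y) - k (u - x)) * f y \<partial>\<mu>)"
    using i1 i2 by (simp add: T_fun_def left_diff_distrib)
  have i3: "integrable \<mu> (\<lambda>y. (k (u - y) - k (u - x)) * f y)"
    using i1 i2 by (simp add: left_diff_distrib)
  have le: "cmod ((k (u - y) - k (u - x)) * f y) \<le> c * cmod (f y)" for y
  proof (cases "f y = 0")
    case False
    then have y: "norm (y - x) \<le> D" using supp by (simp add: dist_norm)
    have "cmod (k (u - x) - k (u - y)) \<le> kernel_const s \<alpha> \<kappa> * norm ((u - x) - (u - y)) powr \<alpha> * norm (u - x) powr (- s - \<alpha>)"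
      using D u y by (intro k_diff) (auto simp: dist_norm)
    also have "\<dots> \<le> c"
      unfolding c_def using y alpha_pos kernel_const_nonneg
      by (intro mult_right_mono mult_left_mono powr_mono2) auto
    finally show ?thesis by (simp add: norm_mult norm_minus_commute mult_right_mono)
  qed simp
  have "cmod (\<integral>y. (k (u - y) - k (u - x)) * f y \<partial>\<mu>) \<le> (\<integral>y. cmod ((k (u - y) - k (u - x)) * f y) \<partial>\<mu>)"
    by (rule integral_norm_bound)
  also have "\<dots> \<le> (\<integral>y. c * cmod (f y) \<partial>\<mu>)"
    using Lip0_integrable[OF f] by (intro integral_mono le integrable_norm i3) auto
  finally show ?thesis using eq by (simp add: c_def)
qed

lemma T_fun_measurable [measurable]:
  assumes [measurable]: "f \<in> borel_measurable borel"
  shows "T_fun k \<mu> f \<in> borel_measurable borel"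
  unfolding T_fun_def by measurable

text \<open>Off \<open>B \<times> B\<close> one of the two terms of \<open>H_form\<close> vanishes, and oddness of \<open>k\<close> identifies the two
  mixed regions, which compensates the factor \<open>1/2\<close>.\<close>

lemma T_form_split:
  assumes f: "f \<in> Lip0" and g: "\<phi> \<in> Lip0" and B: "B \<in> sets borel" and d: "0 < \<delta>"
    and sep: "\<And>u v. u \<notin> B \<Longrightarrow> f v \<noteq> 0 \<Longrightarrow> \<delta> \<le> dist u v"
  shows "integrable \<mu> (\<lambda>u. indicator (- B) u *\<^sub>R (\<phi> u * T_fun k \<mu> f u))"
    and "T_form k \<mu> f \<phi> =
      (\<integral>w. indicator (B \<times> B) w *\<^sub>R (case w of (u, v) \<Rightarrow> k (u - v) * H_form f \<phi> u v) \<partial>(\<mu> \<Otimes>\<^sub>M \<mu>))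
      + (\<integral>u. indicator (- B) u *\<^sub>R (\<phi> u * T_fun k \<mu> f u) \<partial>\<mu>)"
proof -
  define F where "F = (\<lambda>(u, v). k (u - v) * H_form f \<phi> u v)"
  have [measurable]: "B \<in> sets \<mu>" using B by (simp add: sets_mu)
  have F: "integrable (\<mu> \<Otimes>\<^sub>M \<mu>) F" unfolding F_def by (rule T_form_integrable[OF f g])
  have f0: "f u = 0" if "u \<notin> B" for u using sep[OF that, of u] d by auto
  define G where "G w = indicator ((- B) \<times> UNIV) w *\<^sub>R F w" for w
  have cB: "- B \<in> sets \<mu>" using B by (auto simp: sets_mu)
  have G: "integrable (\<mu> \<Otimes>\<^sub>M \<mu>) G"
    unfolding G_def using cB by (intro integrable_mult_indicator F pair_measureI) (auto simp: sets_mu)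
  have I: "integrable (\<mu> \<Otimes>\<^sub>M \<mu>) (\<lambda>w. indicator (B \<times> B) w *\<^sub>R F w)"
    by (intro integrable_mult_indicator F) auto
  have Gs: "integrable (\<mu> \<Otimes>\<^sub>M \<mu>) (\<lambda>(u, v). G (v, u))"
    using integrable_product_swap[OF G] by simp
  have Gsw: "(\<integral>w. (\<lambda>(u, v). G (v, u)) w \<partial>(\<mu> \<Otimes>\<^sub>M \<mu>)) = integral\<^sup>L (\<mu> \<Otimes>\<^sub>M \<mu>) G"
    using integral_product_swap[of G] G by simp
  have inner: "2 * (\<integral>v. G (u, v) \<partial>\<mu>) = indicator (- B) u *\<^sub>R (\<phi> u * T_fun k \<mu> f u)" for u
  proof (cases "u \<in> B")
    case False
    then have eq: "(\<integral>v. G (u, v) \<partial>\<mu>) = (\<integral>v. ((1/2) * \<phi> u) * (k (u - v) * f v) \<partial>\<mu>)"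
      by (intro Bochner_Integration.integral_cong) (simp_all add: G_def F_def H_form_def f0)
    show ?thesis unfolding eq using False by (simp add: T_fun_def)
  qed (simp add: G_def)
  have "integrable \<mu> (\<lambda>u. 2 * (\<integral>v. G (u, v) \<partial>\<mu>))"
    by (intro integrable_mult_right integrable_fst' G)
  then show "integrable \<mu> (\<lambda>u. indicator (- B) u *\<^sub>R (\<phi> u * T_fun k \<mu> f u))"
    by (simp add: inner)
  \<comment> \<open>The regions of \<open>G\<close> and of its swap overlap where both points lie
    outside \<open>B\<close>; there \<open>F\<close> is \<open>0\<close>, since \<open>f\<close>
    vanishes off \<open>B\<close>.\<close>
  have "F w = indicator (B \<times> B) w *\<^sub>R F w + G w + (\<lambda>(u, v). G (v, u)) w" for w
  proof -
    obtain u v where w: "w = (u, v)" by (cases w)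
    have sw: "F (v, u) = F (u, v)" by (simp add: F_def kernel_H_swap)
    have "F (u, v) = 0" if "u \<notin> B" "v \<notin> B" using that by (simp add: F_def H_form_def f0)
    then show ?thesis using sw w by (auto simp: G_def indicator_def)
  qed
  then have "integral\<^sup>L (\<mu> \<Otimes>\<^sub>M \<mu>) F
    = (\<integral>w. indicator (B \<times> B) w *\<^sub>R F w + G w + (\<lambda>(u, v). G (v, u)) w \<partial>(\<mu> \<Otimes>\<^sub>M \<mu>))" by simp
  also have "\<dots> = (\<integral>w. indicator (B \<times> B) w *\<^sub>R F w \<partial>(\<mu> \<Otimes>\<^sub>M \<mu>)) + integral\<^sup>L (\<mu> \<Otimes>\<^sub>M \<mu>) G + integral\<^sup>L (\<mu> \<Otimes>\<^sub>M \<mu>) G"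
    using I G Gs Gsw by simp
  also have "integral\<^sup>L (\<mu> \<Otimes>\<^sub>M \<mu>) G = (\<integral>u. \<integral>v. G (u, v) \<partial>\<mu> \<partial>\<mu>)"
    using integral_fst'[OF G] by simp
  also have "(\<integral>w. indicator (B \<times> B) w *\<^sub>R F w \<partial>(\<mu> \<Otimes>\<^sub>M \<mu>)) + (\<integral>u. \<integral>v. G (u, v) \<partial>\<mu> \<partial>\<mu>) + (\<integral>u. \<integral>v. G (u, v) \<partial>\<mu> \<partial>\<mu>)
      = (\<integral>w. indicator (B \<times> B) w *\<^sub>R F w \<partial>(\<mu> \<Otimes>\<^sub>M \<mu>)) + (\<integral>u. 2 * (\<integral>v. G (u, v) \<partial>\<mu>) \<partial>\<mu>)"
    by simp
  finally show "T_form k \<mu> f \<phi> =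
      (\<integral>w. indicator (B \<times> B) w *\<^sub>R (case w of (u, v) \<Rightarrow> k (u - v) * H_form f \<phi> u v) \<partial>(\<mu> \<Otimes>\<^sub>M \<mu>))
      + (\<integral>u. indicator (- B) u *\<^sub>R (\<phi> u * T_fun k \<mu> f u) \<partial>\<mu>)"
    by (simp add: inner T_form_def F_def)
qed

end

section \<open>Limits along cutoff sequences\<close>

text \<open>The expression under the limit in \<open>potential\<close> for \<phi> = 1, at a single
  cutoff and with the normalizer as an argument, so that normalizers can be exchanged and bounds
  proved before passing to the limit.\<close>

definition pot_approx ::
    "(real^'n \<Rightarrow> complex) \<Rightarrow> (real^'n) measure \<Rightarrow> real^'n \<Rightarrow> (real^'n \<Rightarrow> complex)
       \<Rightarrow> (real^'n \<Rightarrow> real) \<Rightarrow> complex" where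
  "pot_approx k \<mu> x f \<psi> =
     (\<integral>y. k (y - x) * of_real (\<psi> y) \<partial>\<mu>) - T_form k \<mu> f (\<lambda>y. of_real (\<psi> y))"

context cz_setting
begin

text \<open>At a fixed point the cutoffs are eventually \<open>1\<close>, so dominated convergence
  applies. The set \<open>B\<close> keeps away from the bounded region in which \<open>G\<close> may
  be singular.\<close>

lemma cutoff_integral_limit:
  assumes \<psi>: "cutoff_sequence \<psi>" and \<theta>: "\<theta> \<in> Lip0" and B: "B \<in> sets borel"
    and [measurable]: "G \<in> borel_measurable borel"
    and G: "integrable \<mu> (\<lambda>u. indicator B u *\<^sub>R G u)"
  shows "(\<lambda>j. \<integral>u. indicator B u *\<^sub>R ((of_real (\<psi> j u) - \<theta> u) * G u) \<partial>\<mu>)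
     \<longlonglongrightarrow> (\<integral>u. indicator B u *\<^sub>R ((1 - \<theta> u) * G u :: complex) \<partial>\<mu>)"
proof -
  note [measurable] = Lip0_measurable[OF \<theta>]
  have [measurable]: "\<psi> j \<in> borel_measurable borel" for j
    using \<psi> by (auto simp: cutoff_sequence_def intro: Lip0_measurable)
  have [measurable]: "B \<in> sets \<mu>" using B by (simp add: sets_mu)
  obtain C where C: "0 \<le> C" "\<And>u. cmod (\<theta> u) \<le> C" using Lip0E[OF \<theta>] by metis
  show ?thesis
  proof (rule integral_dominated_convergence[where w = "\<lambda>u. (1 + C) * norm (indicator B u *\<^sub>R G u)"])
    show "integrable \<mu> (\<lambda>u. (1 + C) * norm (indicator B u *\<^sub>R G u))"
      by (intro integrable_mult_right integrable_norm G)
    show "AE u in \<mu>. (\<lambda>j. indicator B u *\<^sub>R ((of_real (\<psi> j u) - \<theta> u) * G u))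
        \<longlonglongrightarrow> indicator B u *\<^sub>R ((1 - \<theta> u) * G u)"
    proof (intro always_eventually allI)
      fix u :: "real^'n"
      have "\<forall>\<^sub>F j in sequentially. norm u < real j"
        using filterlim_real_sequentially by (simp add: filterlim_at_top_dense)
      then have "\<forall>\<^sub>F j in sequentially. indicator B u *\<^sub>R ((1 - \<theta> u) * G u) =
          indicator B u *\<^sub>R ((of_real (\<psi> j u) - \<theta> u) * G u)"
        by eventually_elim (use \<psi> in \<open>auto simp: cutoff_sequence_def\<close>)
      then show "(\<lambda>j. indicator B u *\<^sub>R ((of_real (\<psi> j u) - \<theta> u) * G u))
          \<longlonglongrightarrow> indicator B u *\<^sub>R ((1 - \<theta> u) * G u)"
        by (rule Lim_transform_eventually[OF tendsto_const])
    qed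
    show "AE u in \<mu>. norm (indicator B u *\<^sub>R ((of_real (\<psi> j u) - \<theta> u) * G u))
        \<le> (1 + C) * norm (indicator B u *\<^sub>R G u)" for j
    proof (intro always_eventually allI)
      fix u :: "real^'n"
      have "cmod (of_real (\<psi> j u) - \<theta> u) \<le> cmod (of_real (\<psi> j u)) + cmod (\<theta> u)"
        by (rule norm_triangle_ineq4)
      also have "cmod (of_real (\<psi> j u)) \<le> 1" using \<psi> by (auto simp: cutoff_sequence_def)
      finally have "cmod (of_real (\<psi> j u) - \<theta> u) \<le> 1 + C" using C(2)[of u] by simp
      then show "norm (indicator B u *\<^sub>R ((of_real (\<psi> j u) - \<theta> u) * G u))
        \<le> (1 + C) * norm (indicator B u *\<^sub>R G u)"
        by (auto simp: norm_mult indicator_def intro: mult_right_mono)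
    qed
  qed measurable
qed

text \<open>The left side does not mention \<open>\<theta>\<close>, which is what makes the
  mean-zero form well defined. For late indices the difference of the cutoff and
  \<open>\<theta>\<close> vanishes near the support of \<open>f\<close>, so only an integral of
  \<open>T(f\<mu>)\<close> away from the support changes.\<close>

lemma T_form_cutoff_limit:
  assumes f: "f \<in> Lip0" and mean: "(\<integral>x. f x \<partial>\<mu>) = 0" and \<theta>: "\<theta> \<in> Lip0"
    and U: "open U" "closed_support f \<subseteq> U" "\<And>x. x \<in> U \<Longrightarrow> \<theta> x = 1"
    and \<psi>: "cutoff_sequence \<psi>"
  shows "(\<lambda>j. T_form k \<mu> f (\<lambda>x. of_real (\<psi> j x)))
    \<longlonglongrightarrow> T_form k \<mu> f \<theta> + (\<integral>x. T_fun k \<mu> f x * (1 - \<theta> x) \<partial>\<mu>)"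
proof -
  note [measurable] = Lip0_measurable[OF f] Lip0_measurable[OF \<theta>]
  have cs: "compact (closed_support f)" using f by (simp add: Lip0_def)
  obtain N where N: "0 < N" "\<And>x. N \<le> norm x \<Longrightarrow> f x = 0" using Lip0E[OF f] by metis
  obtain N1 where N1: "closed_support f \<subseteq> ball 0 N1"
    using compact_imp_bounded[OF cs] bounded_subset_ballD by blast
  \<comment> \<open>Intersecting with a ball makes \<open>V\<close> bounded, so that from some index
    on the cutoffs equal \<open>1\<close> on all of \<open>V\<close>.\<close>
  define V where "V = U \<inter> ball 0 N1"
  have V: "open V" "closed_support f \<subseteq> V" using U N1 by (auto simp: V_def)
  have "closed (- V)" "closed_support f \<inter> - V = {}" using V by auto
  then obtain \<delta> where d: "0 < \<delta>" "\<And>x y. x \<in> closed_support f \<Longrightarrow> y \<in> - V \<Longrightarrow> \<delta> \<le> dist x y"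
    using separate_compact_closed[OF cs, of "- V"] by blast
  have sep: "\<delta> \<le> dist u v" if "u \<notin> V" "f v \<noteq> 0" for u v
  proof -
    have "v \<in> closed_support f" using that closure_subset[of "{x. f x \<noteq> 0}"] by (auto simp: closed_support_def)
    then show ?thesis using d(2)[of v u] that by (simp add: dist_commute)
  qed
  define G where "G = T_fun k \<mu> f"
  have [measurable]: "G \<in> borel_measurable borel" unfolding G_def by measurable
  have VB: "V \<in> sets borel" "- V \<in> sets borel" using V(1) by auto
  \<comment> \<open>Bounded because \<open>V\<close> keeps a distance from the support, and decaying
    because the main term of \<open>T_fun_approx\<close> carries the mean of \<open>f\<close>, which
    is \<open>0\<close>.\<close>
  have G: "integrable \<mu> (\<lambda>u. indicator (- V) u *\<^sub>R G u)"
  proof (rule integrable_decay[where x = 0 and N = "2 * N" and \<alpha> = \<alpha>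
        and C = "\<delta> powr (- s) * (\<integral>v. cmod (f v) \<partial>\<mu>)"
        and C' = "kernel_const s \<alpha> \<kappa> * N powr \<alpha> * (\<integral>v. cmod (f v) \<partial>\<mu>)"])
    show "cmod (indicator (- V) u *\<^sub>R G u) \<le> \<delta> powr (- s) * (\<integral>v. cmod (f v) \<partial>\<mu>)" for u
      using T_fun_integrable(2)[OF f d(1) sep[of u]] by (cases "u \<in> V") (auto simp: G_def)
    fix u :: "real^'n" assume "2 * N \<le> dist u 0"
    then have "cmod (G u) \<le> kernel_const s \<alpha> \<kappa> * N powr \<alpha> * norm (u - 0) powr (- s - \<alpha>) * (\<integral>v. cmod (f v) \<partial>\<mu>)"
      using T_fun_approx[OF f N(1), of 0 u] N(2) mean by (force simp: G_def)
    moreover have "cmod (indicator (- V) u *\<^sub>R G u) \<le> cmod (G u)"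
      by (auto simp: indicator_def)
    ultimately show "cmod (indicator (- V) u *\<^sub>R G u)
      \<le> kernel_const s \<alpha> \<kappa> * N powr \<alpha> * (\<integral>v. cmod (f v) \<partial>\<mu>) * norm (u - 0) powr (- s - \<alpha>)"
      by (simp add: mult_ac)
  qed (use VB N alpha_pos kernel_const_nonneg in auto)
  have lim: "(\<lambda>j. \<integral>u. indicator (- V) u *\<^sub>R ((of_real (\<psi> j u) - \<theta> u) * G u) \<partial>\<mu>)
     \<longlonglongrightarrow> (\<integral>u. indicator (- V) u *\<^sub>R ((1 - \<theta> u) * G u) \<partial>\<mu>)"
    by (rule cutoff_integral_limit[OF \<psi> \<theta> VB(2) _ G]) measurable
  \<comment> \<open>On \<open>V\<close> the factor \<open>1 - \<theta> u\<close> is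
    \<open>0\<close>, so restricting to the complement changes nothing.\<close>
  have rhs: "(\<integral>u. indicator (- V) u *\<^sub>R ((1 - \<theta> u) * G u) \<partial>\<mu>) = (\<integral>x. G x * (1 - \<theta> x) \<partial>\<mu>)"
    by (intro Bochner_Integration.integral_cong) (auto simp: indicator_def V_def U(3))
  have ev: "\<forall>\<^sub>F j in sequentially. T_form k \<mu> f \<theta> + (\<integral>u. indicator (- V) u *\<^sub>R ((of_real (\<psi> j u) - \<theta> u) * G u) \<partial>\<mu>)
       = T_form k \<mu> f (\<lambda>x. of_real (\<psi> j x))"
  proof -
    obtain n :: nat where n: "N1 \<le> real n" using real_arch_simple by blast
    show ?thesis
    proof (rule eventually_sequentiallyI[of n])
      fix j assume j: "n \<le> j"
      have \<psi>j: "(\<lambda>x. of_real (\<psi> j x) :: complex) \<in> Lip0"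
        using \<psi> by (auto simp: cutoff_sequence_def intro: Lip0_of_real)
      have one: "\<psi> j x = 1" "\<theta> x = 1" if "x \<in> V" for x
        using that \<psi> j n U(3) by (auto simp: cutoff_sequence_def V_def)
      have "T_form k \<mu> f (\<lambda>x. of_real (\<psi> j x)) - T_form k \<mu> f \<theta> = T_form k \<mu> f (\<lambda>x. of_real (\<psi> j x) - \<theta> x)"
        by (rule T_form_diff_right[OF f \<psi>j \<theta>, symmetric])
      also have "\<dots> = (\<integral>w. indicator (V \<times> V) w *\<^sub>R (case w of (u, v) \<Rightarrow> k (u - v) * H_form f (\<lambda>x. of_real (\<psi> j x) - \<theta> x) u v) \<partial>(\<mu> \<Otimes>\<^sub>M \<mu>))
        + (\<integral>u. indicator (- V) u *\<^sub>R ((of_real (\<psi> j u) - \<theta> u) * T_fun k \<mu> f u) \<partial>\<mu>)"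
        by (rule T_form_split(2)[OF f Lip0_diff[OF \<psi>j \<theta>] VB(1) d(1) sep])
      also have "(\<lambda>w. indicator (V \<times> V) w *\<^sub>R (case w of (u, v) \<Rightarrow> k (u - v) * H_form f (\<lambda>x. of_real (\<psi> j x) - \<theta> x) u v)) = (\<lambda>w. 0)"
        by (auto simp: fun_eq_iff indicator_def H_form_def one)
      finally show "T_form k \<mu> f \<theta> + (\<integral>u. indicator (- V) u *\<^sub>R ((of_real (\<psi> j u) - \<theta> u) * G u) \<partial>\<mu>)
       = T_form k \<mu> f (\<lambda>x. of_real (\<psi> j x))" by (simp add: G_def algebra_simps)
    qed
  qed
  show ?thesis
    using Lim_transform_eventually[OF tendsto_add[OF tendsto_const lim] ev] rhs by (simp add: G_def)
qed

text \<open>All admissible right-hand sides are limits of one and the same sequence, hence equal;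
  this resolves the definite description.\<close>

lemma T_form_mean_zero_limit:
  assumes f: "f \<in> Lip0" and mean: "(\<integral>x. f x \<partial>\<mu>) = 0" and \<psi>: "cutoff_sequence \<psi>"
  shows "(\<lambda>j. T_form k \<mu> f (\<lambda>x. of_real (\<psi> j x))) \<longlonglongrightarrow> T_form_mean_zero k \<mu> f (\<lambda>_. 1)"
proof -
  define adm where "adm \<theta> \<longleftrightarrow> \<theta> \<in> Lip0 \<and> (\<exists>U. open U \<and> closed_support f \<subseteq> U \<and> (\<forall>x\<in>U. \<theta> x = 1))"
    for \<theta> :: "real^'n \<Rightarrow> complex"
  define R where "R \<theta> = T_form k \<mu> f \<theta> + (\<integral>x. T_fun k \<mu> f x * (1 - \<theta> x) \<partial>\<mu>)" for \<theta>
  have lim: "(\<lambda>j. T_form k \<mu> f (\<lambda>x. of_real (\<psi> j x))) \<longlonglongrightarrow> R \<theta>" if "adm \<theta>" for \<theta>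
    using that T_form_cutoff_limit[OF f mean _ _ _ _ \<psi>] by (auto simp: adm_def R_def)
  have cs: "compact (closed_support f)" using f by (simp add: Lip0_def)
  obtain a where a: "0 < a" "closed_support f \<subseteq> ball 0 a"
    using bounded_subset_ballD[OF compact_imp_bounded[OF cs]] by blast
  \<comment> \<open>One admissible cutoff has to exist, since otherwise every value would satisfy
    the description.\<close>
  define \<theta>0 where "\<theta>0 = (\<lambda>x::real^'n. of_real (bump 0 a x) :: complex)"
  have adm0: "adm \<theta>0"
    unfolding adm_def \<theta>0_def using a
    by (auto intro!: Lip0_of_real bump_Lip0 exI[of _ "ball 0 a"] simp: bump_eq_1 dist_commute)
  have "T_form_mean_zero k \<mu> f (\<lambda>_. 1) = (THE v. \<forall>\<theta>. adm \<theta> \<longrightarrow> v = R \<theta>)"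
    unfolding T_form_mean_zero_def adm_def R_def by (simp add: Ball_def imp_conjL)
  also have "\<dots> = R \<theta>0"
  proof (rule the_equality)
    show "\<forall>\<theta>. adm \<theta> \<longrightarrow> R \<theta>0 = R \<theta>" using LIMSEQ_unique[OF lim[OF adm0] lim] by blast
    show "v = R \<theta>0" if "\<forall>\<theta>. adm \<theta> \<longrightarrow> v = R \<theta>" for v using that adm0 by blast
  qed
  finally show ?thesis using lim[OF adm0] by simp
qed

section \<open>Existence of the potential off the support and its independence of the
  normalizer\<close>

lemma kernel_cutoff_integrable:
  assumes r: "0 < r" "emeasure \<mu> (ball x r) = 0" and h: "h \<in> Lip0"
  shows "integrable \<mu> (\<lambda>y. k (y - x) * h y)"
proof -
  note [measurable] = Lip0_measurable[OF h]
  obtain C N where C: "0 \<le> C" "\<And>y. cmod (h y) \<le> C" and N: "\<And>y. N \<le> norm y \<Longrightarrow> h y = 0"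
    using Lip0E[OF h] by metis
  have "AE y in \<mu>. y \<notin> ball x r"
    using r by (intro AE_not_in) (auto simp: null_sets_def sets_mu)
  then have "AE y in \<mu>. cmod (k (y - x) * h y) \<le> r powr (- s) * C"
  proof eventually_elim
    case (elim y)
    then have y: "r \<le> norm (y - x)" by (simp add: dist_norm norm_minus_commute)
    have "cmod (k (y - x)) \<le> norm (y - x) powr (- s)" using y r by (intro k_bound) auto
    also have "\<dots> \<le> r powr (- s)" using y r s_pos by (intro powr_mono2') auto
    finally show ?case using C by (simp add: norm_mult mult_mono)
  qed
  then show ?thesis using N by (intro integrable_bounded_support) auto
qed

text \<open>Outside a large ball the two terms combine to \<open>k (u - x)\<close> minus
  \<open>T(f\<mu>)(u)\<close>. As \<open>f\<close> has mean \<open>1\<close>, this is of order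
  \<open>- s - \<alpha>\<close> and hence integrable; inside the ball nothing changes for late
  indices.\<close>

lemma pot_approx_convergent:
  assumes r: "0 < r" "emeasure \<mu> (ball x r) = 0" and f: "f \<in> Lip0" and mean: "(\<integral>y. f y \<partial>\<mu>) = 1"
  shows "\<exists>v. \<forall>\<psi>. cutoff_sequence \<psi> \<longrightarrow> (\<lambda>j. pot_approx k \<mu> x f (\<psi> j)) \<longlonglongrightarrow> v"
proof -
  note [measurable] = Lip0_measurable[OF f]
  obtain N0 where N0: "0 < N0" "\<And>y. N0 \<le> norm y \<Longrightarrow> f y = 0"
    using Lip0E[OF f] by metis
  \<comment> \<open>The ball of radius \<open>N\<close> contains the support of \<open>f\<close> and
    its closure contains \<open>x\<close>; leaving the ball of radius \<open>2 * N\<close> therefore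
    gives distance \<open>N\<close> from both.\<close>
  define N where "N = max N0 (norm x)"
  have N: "0 < N" "\<And>y. N \<le> norm y \<Longrightarrow> f y = 0" "norm x \<le> N" using N0 by (auto simp: N_def)
  define B where "B = ball (0::real^'n) (2 * N)"
  have B: "B \<in> sets borel" "- B \<in> sets borel" by (auto simp: B_def)
  \<comment> \<open>A fixed reference cutoff: subtracting it from the cutoffs leaves functions that
    vanish on \<open>B\<close> for late indices.\<close>
  define \<theta> where "\<theta> = (\<lambda>y::real^'n. of_real (bump 0 (2 * N) y) :: complex)"
  have \<theta>: "\<theta> \<in> Lip0" unfolding \<theta>_def using N by (intro Lip0_of_real bump_Lip0) auto
  note [measurable] = Lip0_measurable[OF \<theta>]
  have sep: "N \<le> dist u v" if "u \<notin> B" "f v \<noteq> 0" for u v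
    using that N(2)[of v] norm_triangle_ineq2[of u v] by (fastforce simp: B_def dist_norm)
  have sepx: "N \<le> dist u x" if "u \<notin> B" for u
    using that N(3) norm_triangle_ineq2[of u x] by (simp add: B_def dist_norm)
  define G where "G u = k (u - x) - T_fun k \<mu> f u" for u
  have Gm [measurable]: "G \<in> borel_measurable borel" unfolding G_def by measurable
  have G: "integrable \<mu> (\<lambda>u. indicator (- B) u *\<^sub>R G u)"
  proof (rule integrable_decay[where x = x and N = "4 * N" and \<alpha> = \<alpha>
        and C = "N powr (- s) + N powr (- s) * (\<integral>v. cmod (f v) \<partial>\<mu>)"
        and C' = "kernel_const s \<alpha> \<kappa> * (2 * N) powr \<alpha> * (\<integral>v. cmod (f v) \<partial>\<mu>)"])
    fix u
    show "cmod (indicator (- B) u *\<^sub>R G u) \<le> N powr (- s) + N powr (- s) * (\<integral>v. cmod (f v) \<partial>\<mu>)"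
    proof (cases "u \<in> B")
      case False
      have ux: "N \<le> norm (u - x)" using sepx[OF False] by (simp add: dist_norm)
      have "cmod (k (u - x)) \<le> norm (u - x) powr (- s)" using ux N(1) by (intro k_bound) auto
      also have "\<dots> \<le> N powr (- s)" using ux N(1) s_pos by (intro powr_mono2') auto
      finally have "cmod (k (u - x)) \<le> N powr (- s)" .
      then have "cmod (G u) \<le> N powr (- s) + N powr (- s) * (\<integral>v. cmod (f v) \<partial>\<mu>)"
        unfolding G_def using T_fun_integrable(2)[OF f N(1) sep[OF False]]
        by (intro order_trans[OF norm_triangle_ineq4] add_mono)
      then show ?thesis using False by simp
    qed simp
    assume u: "4 * N \<le> dist u x"
    have "cmod (G u) = cmod (T_fun k \<mu> f u - k (u - x) * (\<integral>y. f y \<partial>\<mu>))"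
      by (simp add: G_def mean norm_minus_commute)
    also have "\<dots> \<le> kernel_const s \<alpha> \<kappa> * (2 * N) powr \<alpha> * norm (u - x) powr (- s - \<alpha>) * (\<integral>v. cmod (f v) \<partial>\<mu>)"
    \<comment> \<open>Seen from \<open>x\<close>, the support of \<open>f\<close> has radius
      \<open>2 * N\<close>; the threshold \<open>4 * N\<close> is twice that, as the approximation
      requires.\<close>
    proof (rule T_fun_approx[OF f])
      fix y assume "f y \<noteq> 0"
      then have "norm y < N" using N(2)[of y] by force
      then show "dist y x \<le> 2 * N" using N(3) norm_triangle_ineq4[of y x] by (simp add: dist_norm)
    qed (use u N in auto)
    finally have "cmod (G u) \<le> kernel_const s \<alpha> \<kappa> * (2 * N) powr \<alpha> * (\<integral>v. cmod (f v) \<partial>\<mu>) * norm (u - x) powr (- s - \<alpha>)"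
      by (simp add: mult_ac)
    moreover have "cmod (indicator (- B) u *\<^sub>R G u) \<le> cmod (G u)" by (auto simp: indicator_def)
    ultimately show "cmod (indicator (- B) u *\<^sub>R G u)
      \<le> kernel_const s \<alpha> \<kappa> * (2 * N) powr \<alpha> * (\<integral>v. cmod (f v) \<partial>\<mu>) * norm (u - x) powr (- s - \<alpha>)" by (rule order_trans[rotated])
  qed (use B N alpha_pos kernel_const_nonneg in auto)
  define E where "E = (\<integral>y. k (y - x) * \<theta> y \<partial>\<mu>) - T_form k \<mu> f \<theta>"
  have "(\<lambda>j. pot_approx k \<mu> x f (\<psi> j)) \<longlonglongrightarrow> E + (\<integral>u. indicator (- B) u *\<^sub>R ((1 - \<theta> u) * G u) \<partial>\<mu>)"
    if \<psi>: "cutoff_sequence \<psi>" for \<psi>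
  proof -
    have lim: "(\<lambda>j. \<integral>u. indicator (- B) u *\<^sub>R ((of_real (\<psi> j u) - \<theta> u) * G u) \<partial>\<mu>)
     \<longlonglongrightarrow> (\<integral>u. indicator (- B) u *\<^sub>R ((1 - \<theta> u) * G u) \<partial>\<mu>)"
      by (rule cutoff_integral_limit[OF \<psi> \<theta> B(2) Gm G])
    obtain n :: nat where n: "2 * N \<le> real n" using real_arch_simple by blast
    have ev: "\<forall>\<^sub>F j in sequentially. E + (\<integral>u. indicator (- B) u *\<^sub>R ((of_real (\<psi> j u) - \<theta> u) * G u) \<partial>\<mu>)
       = pot_approx k \<mu> x f (\<psi> j)"
    proof (rule eventually_sequentiallyI[of n])
      fix j assume j: "n \<le> j"
      define h where "h = (\<lambda>y. of_real (\<psi> j y) - \<theta> y)"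
      have \<psi>j: "(\<lambda>y. of_real (\<psi> j y) :: complex) \<in> Lip0"
        using \<psi> by (auto simp: cutoff_sequence_def intro: Lip0_of_real)
      have h: "h \<in> Lip0" unfolding h_def by (rule Lip0_diff[OF \<psi>j \<theta>])
      have h0: "h y = 0" if "y \<in> B" for y
        using that \<psi> j n N(1) by (auto simp: cutoff_sequence_def h_def \<theta>_def B_def bump_eq_1 dist_commute)
      have 1: "T_form k \<mu> f (\<lambda>y. of_real (\<psi> j y)) - T_form k \<mu> f \<theta>
          = (\<integral>u. indicator (- B) u *\<^sub>R (h u * T_fun k \<mu> f u) \<partial>\<mu>)"
      proof -
        have "T_form k \<mu> f (\<lambda>y. of_real (\<psi> j y)) - T_form k \<mu> f \<theta> = T_form k \<mu> f h"
          unfolding h_def by (rule T_form_diff_right[OF f \<psi>j \<theta>, symmetric])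
        also have "\<dots> = (\<integral>w. indicator (B \<times> B) w *\<^sub>R (case w of (u, v) \<Rightarrow> k (u - v) * H_form f h u v) \<partial>(\<mu> \<Otimes>\<^sub>M \<mu>))
          + (\<integral>u. indicator (- B) u *\<^sub>R (h u * T_fun k \<mu> f u) \<partial>\<mu>)"
          by (rule T_form_split(2)[OF f h B(1) N(1) sep])
        also have "(\<lambda>w. indicator (B \<times> B) w *\<^sub>R (case w of (u, v) \<Rightarrow> k (u - v) * H_form f h u v)) = (\<lambda>w. 0)"
          by (auto simp: fun_eq_iff indicator_def H_form_def h0)
        finally show ?thesis by simp
      qed
      have 2: "(\<integral>y. k (y - x) * of_real (\<psi> j y) \<partial>\<mu>) - (\<integral>y. k (y - x) * \<theta> y \<partial>\<mu>)
          = (\<integral>u. indicator (- B) u *\<^sub>R (h u * k (u - x)) \<partial>\<mu>)"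
      proof -
        have "(\<integral>y. k (y - x) * of_real (\<psi> j y) \<partial>\<mu>) - (\<integral>y. k (y - x) * \<theta> y \<partial>\<mu>)
           = (\<integral>y. k (y - x) * of_real (\<psi> j y) - k (y - x) * \<theta> y \<partial>\<mu>)"
          by (rule Bochner_Integration.integral_diff[symmetric])
            (intro kernel_cutoff_integrable[OF r] \<psi>j \<theta>)+
        also have "\<dots> = (\<integral>u. indicator (- B) u *\<^sub>R (h u * k (u - x)) \<partial>\<mu>)"
        proof (intro Bochner_Integration.integral_cong refl)
          fix y
          show "k (y - x) * of_real (\<psi> j y) - k (y - x) * \<theta> y = indicator (- B) y *\<^sub>R (h y * k (y - x))"
            using h0[of y] by (cases "y \<in> B") (auto simp: h_def algebra_simps)
        qed
        finally show ?thesis .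
      qed
      have i1: "integrable \<mu> (\<lambda>u. indicator (- B) u *\<^sub>R (h u * T_fun k \<mu> f u))"
        by (rule T_form_split(1)[OF f h B(1) N(1) sep])
      have i2: "integrable \<mu> (\<lambda>u. indicator (- B) u *\<^sub>R (h u * k (u - x)))"
        using kernel_cutoff_integrable[OF r h] B
        by (intro integrable_mult_indicator) (auto simp: sets_mu mult.commute)
      have "(\<integral>u. indicator (- B) u *\<^sub>R (h u * G u) \<partial>\<mu>) =
         (\<integral>u. indicator (- B) u *\<^sub>R (h u * k (u - x)) \<partial>\<mu>) - (\<integral>u. indicator (- B) u *\<^sub>R (h u * T_fun k \<mu> f u) \<partial>\<mu>)"
        using Bochner_Integration.integral_diff[OF i2 i1] by (simp add: G_def right_diff_distrib scaleR_diff_right)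
      then show "E + (\<integral>u. indicator (- B) u *\<^sub>R ((of_real (\<psi> j u) - \<theta> u) * G u) \<partial>\<mu>) = pot_approx k \<mu> x f (\<psi> j)"
        using 1 2 by (simp add: pot_approx_def E_def h_def algebra_simps)
    qed
    show ?thesis
      by (rule Lim_transform_eventually[OF tendsto_add[OF tendsto_const lim] ev])
  qed
  then show ?thesis by blast
qed

lemma normalizer_Lip0:
  assumes "normalizer \<mu> \<eta>"
  shows "(\<lambda>y. of_real (\<eta> y) :: complex) \<in> Lip0" "(\<integral>y. of_real (\<eta> y) \<partial>\<mu>) = (1::complex)"
  using assms unfolding normalizer_def by (simp_all only: Lip0_of_real integral_complex_of_real of_real_1)

lemma potential_limit:
  assumes r: "0 < r" "emeasure \<mu> (ball x r) = 0" and \<eta>: "normalizer \<mu> \<eta>" and \<psi>: "cutoff_sequence \<psi>"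
  shows "(\<lambda>j. pot_approx k \<mu> x (\<lambda>y. of_real (\<eta> y)) (\<psi> j)) \<longlonglongrightarrow> potential k \<mu> \<eta> (\<lambda>_. 1) x"
proof -
  obtain v where v: "\<And>\<psi>. cutoff_sequence \<psi> \<Longrightarrow> (\<lambda>j. pot_approx k \<mu> x (\<lambda>y. of_real (\<eta> y)) (\<psi> j)) \<longlonglongrightarrow> v"
    using pot_approx_convergent[OF r normalizer_Lip0[OF \<eta>]] by blast
  have "potential k \<mu> \<eta> (\<lambda>_. 1) x
      = (THE v. \<forall>\<psi>. cutoff_sequence \<psi> \<longrightarrow> (\<lambda>j. pot_approx k \<mu> x (\<lambda>y. of_real (\<eta> y)) (\<psi> j)) \<longlonglongrightarrow> v)"
    by (simp add: potential_def pot_approx_def)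
  also have "\<dots> = v"
    using v LIMSEQ_unique[OF v[OF \<psi>]] \<psi> by (intro the_equality) blast+
  finally show ?thesis using v[OF \<psi>] by simp
qed

text \<open>The difference of two normalizers has mean zero, so the difference of the two forms
  tends to a mean-zero form against \<open>1\<close>, which vanishes for a reflectionless measure.
  Thus approximations built with a convenient \<open>g\<close> tend to the potential defined through
  \<open>\<eta>\<close>.\<close>

lemma potential_limit_change_normalizer:
  assumes r: "0 < r" "emeasure \<mu> (ball x r) = 0" and \<eta>: "normalizer \<mu> \<eta>" and \<psi>: "cutoff_sequence \<psi>"
    and g: "normalizer \<mu> g"
    and refl: "\<And>f. f \<in> Lip0 \<Longrightarrow> (\<integral>x. f x \<partial>\<mu>) = 0 \<Longrightarrow> T_form_mean_zero k \<mu> f (\<lambda>_. 1) = 0"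
  shows "(\<lambda>j. pot_approx k \<mu> x (\<lambda>y. of_real (g y)) (\<psi> j)) \<longlonglongrightarrow> potential k \<mu> \<eta> (\<lambda>_. 1) x"
proof -
  note E = normalizer_Lip0[OF \<eta>] and G = normalizer_Lip0[OF g]
  define f where "f = (\<lambda>y. of_real (\<eta> y) - of_real (g y) :: complex)"
  have f: "f \<in> Lip0" unfolding f_def by (rule Lip0_diff[OF E(1) G(1)])
  have mean: "(\<integral>x. f x \<partial>\<mu>) = 0"
    unfolding f_def by (subst Bochner_Integration.integral_diff) (use E G in \<open>simp_all add: Lip0_integrable\<close>)
  have lim: "(\<lambda>j. T_form k \<mu> f (\<lambda>x. of_real (\<psi> j x))) \<longlonglongrightarrow> 0"
    using T_form_mean_zero_limit[OF f mean \<psi>] refl[OF f mean] by simp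
  have "T_form k \<mu> f (\<lambda>x. of_real (\<psi> j x)) =
     T_form k \<mu> (\<lambda>y. of_real (\<eta> y)) (\<lambda>x. of_real (\<psi> j x)) - T_form k \<mu> (\<lambda>y. of_real (g y)) (\<lambda>x. of_real (\<psi> j x))" for j
    unfolding f_def using \<psi>
    by (intro T_form_diff_left E G) (auto simp: cutoff_sequence_def intro: Lip0_of_real)
  then have "pot_approx k \<mu> x (\<lambda>y. of_real (g y)) (\<psi> j) =
     pot_approx k \<mu> x (\<lambda>y. of_real (\<eta> y)) (\<psi> j) + T_form k \<mu> f (\<lambda>x. of_real (\<psi> j x))" for j
    by (simp add: pot_approx_def)
  then show ?thesis
    using tendsto_add[OF potential_limit[OF r \<eta> \<psi>] lim] by simp
qed

end

section \<open>The estimate at a doubling scale\<close>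

context nice_measure
begin

lemma emeasure_ball_eq: "emeasure \<mu> (ball x r) = ennreal (measure \<mu> (ball x r))"
  using emeasure_ball_finite[of x r] by (simp add: emeasure_eq_ennreal_measure less_top)

lemma measure_ball_le: "0 < r \<Longrightarrow> measure \<mu> (ball x r) \<le> \<Lambda> * r powr s"
  using emeasure_ball_le[of r x] Lambda_pos by (simp add: emeasure_ball_eq)

lemma measure_ball_mono: "ball x r \<subseteq> ball y t \<Longrightarrow> measure \<mu> (ball x r) \<le> measure \<mu> (ball y t)"
  using emeasure_mono[of "ball x r" "ball y t" \<mu>] by (simp add: emeasure_ball_eq sets_mu)

section \<open>Existence of a doubling scale\<close>

text \<open>Tonelli for the pairs \<open>(p, y)\<close> at distance below \<open>t\<close> with
  \<open>p\<close> in \<open>ball x r\<close>. Every \<open>y\<close> in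
  \<open>ball x (r / 2)\<close> sees a full Lebesgue ball of such \<open>p\<close>, because
  \<open>t \<le> r / 2\<close>; every \<open>p\<close> sees mass at most \<open>c\<close>. The
  volume of the unit ball cancels.\<close>

lemma ball_measure_average:
  assumes t: "0 < t" "t \<le> r / 2" and c: "0 \<le> c"
    and le: "\<And>p. p \<in> ball x r \<Longrightarrow> measure \<mu> (ball p t) \<le> c"
  shows "measure \<mu> (ball x (r / 2)) * t ^ CARD('n) \<le> c * r ^ CARD('n)"
proof -
  interpret L: pair_sigma_finite "lborel :: (real^'n) measure" \<mu>
    by (intro pair_sigma_finite.intro sigma_finite_lborel sigma_finite_measure_axioms)
  define V where "V = unit_ball_vol (real CARD('n))"
  have V: "0 < V" by (simp add: V_def)
  define f where "f = (\<lambda>(p :: real^'n, y :: real^'n). (if norm (x - p) < r \<and> norm (p - y) < t then 1 else 0) :: ennreal)"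
  have [measurable]: "f \<in> borel_measurable (lborel \<Otimes>\<^sub>M \<mu>)"
    unfolding f_def split_beta' by measurable
  have "ennreal V * ennreal (t ^ CARD('n)) * emeasure \<mu> (ball x (r / 2))
      = (\<integral>\<^sup>+y. (ennreal V * ennreal (t ^ CARD('n))) * indicator (ball x (r / 2)) y \<partial>\<mu>)"
    by (subst nn_integral_cmult_indicator) (auto simp: sets_mu)
  also have "\<dots> \<le> (\<integral>\<^sup>+y. \<integral>\<^sup>+p. f (p, y) \<partial>lborel \<partial>\<mu>)"
  proof (intro nn_integral_mono)
    fix y
    show "(ennreal V * ennreal (t ^ CARD('n))) * indicator (ball x (r / 2)) y \<le> (\<integral>\<^sup>+p. f (p, y) \<partial>lborel)"
    proof (cases "y \<in> ball x (r / 2)")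
      case True
      have "ennreal V * ennreal (t ^ CARD('n)) = emeasure lborel (ball y t)"
        using t V by (simp add: emeasure_ball V_def ennreal_mult)
      also have "\<dots> = (\<integral>\<^sup>+p. indicator (ball y t) p \<partial>lborel)" by simp
      also have "\<dots> \<le> (\<integral>\<^sup>+p. f (p, y) \<partial>lborel)"
      proof (intro nn_integral_mono)
        fix p
        show "indicator (ball y t) p \<le> f (p, y)"
        proof (cases "p \<in> ball y t")
          case p: True
          have "dist x p < r" using p True t dist_triangle[of x p y] by simp
          then show ?thesis using p by (simp add: f_def dist_norm norm_minus_commute)
        qed simp
      qed
      finally show ?thesis using True by simp
    qed simp
  qed
  also have "\<dots> = (\<integral>\<^sup>+p. \<integral>\<^sup>+y. f (p, y) \<partial>\<mu> \<partial>lborel)"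
    by (rule L.Fubini) measurable
  also have "\<dots> \<le> (\<integral>\<^sup>+p. ennreal c * indicator (ball x r) p \<partial>lborel)"
  proof (intro nn_integral_mono)
    fix p
    have "(\<integral>\<^sup>+y. f (p, y) \<partial>\<mu>) = (\<integral>\<^sup>+y. indicator (ball x r) p * indicator (ball p t) y \<partial>\<mu>)"
      by (intro nn_integral_cong) (auto simp: f_def indicator_def dist_norm)
    also have "\<dots> = indicator (ball x r) p * emeasure \<mu> (ball p t)"
      by (subst nn_integral_cmult_indicator) (auto simp: sets_mu)
    also have "\<dots> \<le> ennreal c * indicator (ball x r) p"
      using le[of p] by (cases "p \<in> ball x r") (auto simp: emeasure_ball_eq intro!: ennreal_leI)
    finally show "(\<integral>\<^sup>+y. f (p, y) \<partial>\<mu>) \<le> ennreal c * indicator (ball x r) p" .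
  qed
  also have "\<dots> = ennreal c * (ennreal V * ennreal (r ^ CARD('n)))"
    using t V by (simp add: nn_integral_cmult_indicator emeasure_ball V_def ennreal_mult)
  finally have "V * t ^ CARD('n) * measure \<mu> (ball x (r / 2)) \<le> c * (V * r ^ CARD('n))"
    using t V c by (simp add: emeasure_ball_eq ennreal_mult[symmetric] mult_nonneg_nonneg)
  then have "V * (measure \<mu> (ball x (r / 2)) * t ^ CARD('n)) \<le> V * (c * r ^ CARD('n))"
    by (simp add: mult_ac)
  then show ?thesis using V by simp
qed

text \<open>The centre must be free to move. If doubling failed at all scales for all centres in
  \<open>ball x r\<close>, the mass of \<open>ball p (r / 4 ^ n)\<close> would be at most
  \<open>A powr (- n)\<close> times \<open>\<Lambda> * r powr s\<close>. Averaging loses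
  \<open>4 ^ (d * n)\<close>, so \<open>ball x (r / 2)\<close> would have mass at most
  \<open>4 powr (- n)\<close> times the same bound for all \<open>n \<ge> 1\<close>, against
  \<open>x\<close> being in the support.\<close>

lemma exists_doubling_scale:
  assumes x: "x \<in> measure_support \<mu>" and r: "0 < r"
  shows "\<exists>p\<in>ball x r. \<exists>j. 0 < measure \<mu> (ball p (r / 4 ^ j)) \<and>
    measure \<mu> (ball p (r / 4 ^ j)) \<le> 4 ^ (CARD('n) + 1) * measure \<mu> (ball p (r / 4 ^ Suc j)) \<and>
    (\<forall>i\<le>j. (4 ^ (CARD('n) + 1)) ^ i * measure \<mu> (ball p (r / 4 ^ i)) \<le> measure \<mu> (ball p r))"
proof -
  define A where "A = (4::real) ^ (CARD('n) + 1)"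
  define m where "m p i = measure \<mu> (ball p (r / 4 ^ i))" for p i
  have A: "0 < A" by (simp add: A_def)
  have m_anti: "m p i \<le> m p j" if "j \<le> i" for p i j
    unfolding m_def using that r by (intro measure_ball_mono subset_ball) (auto simp: field_simps power_increasing)
  have decay: "A ^ i * m p i \<le> m p 0" if "\<And>l. l < i \<Longrightarrow> A * m p (Suc l) \<le> m p l" for p i
    using that
  proof (induction i)
    case (Suc i)
    have "A ^ Suc i * m p (Suc i) = A ^ i * (A * m p (Suc i))" by simp
    also have "\<dots> \<le> A ^ i * m p i" using Suc.prems[of i] A by (intro mult_left_mono) auto
    also have "\<dots> \<le> m p 0" using Suc.IH Suc.prems by simp
    finally show ?case .
  qed simp
  have "\<exists>p\<in>ball x r. \<exists>j. 0 < m p j \<and> m p j \<le> A * m p (Suc j)"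
  proof (rule ccontr)
    assume neg: "\<not> ?thesis"
    \<comment> \<open>The negated claim speaks of balls of positive mass only; for null balls the
      inequality is trivial.\<close>
    have *: "A * m p (Suc j) \<le> m p j" if "p \<in> ball x r" for p j
    proof (cases "0 < m p j")
      case False
      then have "m p j = 0" "m p (Suc j) = 0"
        using m_anti[of j "Suc j" p] by (auto simp: m_def not_less measure_le_0_iff)
      then show ?thesis by simp
    qed (use that neg in force)
    define h where "h = measure \<mu> (ball x (r / 2))"
    have "h \<le> (1/4) ^ Suc j * (\<Lambda> * r powr s)" for j
    proof -
      \<comment> \<open>At index \<open>0\<close> the radius would be \<open>r\<close>, too large
        for the averaging lemma.\<close>
      define n where "n = Suc j"
      have "h * (r / 4 ^ n) ^ CARD('n) \<le> (\<Lambda> * r powr s / A ^ n) * r ^ CARD('n)"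
        unfolding h_def
      proof (rule ball_measure_average)
        have "(4::real) ^ 1 \<le> 4 ^ n" unfolding n_def by (intro power_increasing) auto
        then have "r * 2 \<le> r * 4 ^ n" using r by (intro mult_left_mono) auto
        then show "r / 4 ^ n \<le> r / 2" by (simp add: field_simps)
        fix p assume p: "p \<in> ball x r"
        have "A ^ n * m p n \<le> m p 0" by (rule decay) (use *[OF p] in auto)
        also have "\<dots> \<le> \<Lambda> * r powr s" using measure_ball_le[OF r] by (simp add: m_def)
        finally show "measure \<mu> (ball p (r / 4 ^ n)) \<le> \<Lambda> * r powr s / A ^ n"
          using A by (simp add: m_def field_simps)
      qed (use r A Lambda_pos in auto)
      then have "h * r ^ CARD('n) / (4 ^ n) ^ CARD('n) \<le> \<Lambda> * r powr s * r ^ CARD('n) / A ^ n"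
        by (simp add: power_divide)
      moreover have "A ^ n = (4 ^ n) ^ CARD('n) * 4 ^ n"
        by (simp add: A_def power_mult[symmetric] power_add power_mult_distrib mult_ac)
      ultimately have "h \<le> \<Lambda> * r powr s / 4 ^ n"
        using r by (simp add: field_simps)
      then show ?thesis by (simp add: n_def power_divide mult_ac)
    qed
    moreover have "(\<lambda>j. (1/4) ^ Suc j * (\<Lambda> * r powr s)) \<longlonglongrightarrow> 0 * (\<Lambda> * r powr s)"
      by (intro tendsto_mult_right LIMSEQ_Suc LIMSEQ_realpow_zero) auto
    ultimately have "h \<le> 0 * (\<Lambda> * r powr s)" by (intro LIMSEQ_le_const) blast+
    then have "h \<le> 0" by simp
    moreover have "0 < h"
      using x r by (auto simp: measure_support_def h_def emeasure_ball_eq dest!: spec[of _ "r / 2"])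
    ultimately show False by simp
  qed
  then obtain p j0 where p: "p \<in> ball x r" "0 < m p j0" "m p j0 \<le> A * m p (Suc j0)" by blast
  \<comment> \<open>The first scale with the inequality, so that all earlier ones have decay.
    Positivity is not part of the minimized condition; it is inherited from the smaller ball of
    index \<open>j0\<close>.\<close>
  define j where "j = (LEAST j. m p j \<le> A * m p (Suc j))"
  have j: "m p j \<le> A * m p (Suc j)" unfolding j_def using p(3) by (rule LeastI)
  have jle: "j \<le> j0" unfolding j_def using p(3) by (rule Least_le)
  have less: "A * m p (Suc l) \<le> m p l" if "l < j" for l
    using not_less_Least[of l "\<lambda>j. m p j \<le> A * m p (Suc j)"] that by (simp add: j_def)
  have "0 < m p j" using p(2) m_anti[OF jle, of p] by simp
  moreover have "A ^ i * m p i \<le> m p 0" if "i \<le> j" for i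
    by (rule decay) (use that less in auto)
  ultimately show ?thesis
    using p(1) j by (auto simp: m_def A_def intro!: bexI[of _ p] exI[of _ j])
qed

end

lemma quaternary_scale:
  assumes "r / 4 ^ j \<le> (a::real)" "a < r"
  shows "\<exists>i<j. r / 4 ^ Suc i \<le> a \<and> a < r / 4 ^ i"
  using assms
proof (induction j)
  case (Suc j)
  then show ?case
  proof (cases "r / 4 ^ j \<le> a")
    case True
    then show ?thesis using Suc.IH Suc.prems by (meson less_Suc_eq)
  next
    case False
    then show ?thesis using Suc.prems by (intro exI[of _ j]) auto
  qed
qed simp

section \<open>The four-part estimate of the approximations\<close>

text \<open>The doubling ball has radius \<open>r / 4 ^ j\<close>, which is \<open>4 * R\<close>;
  the normalizer lives in the ball of radius \<open>2 * R\<close>. In \<open>px\<close>,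
  \<open>2 * r\<close> allows for \<open>p\<close> within \<open>r\<close> of a nearest support
  point, itself at distance \<open>r\<close> from \<open>x\<close>. The support of the normalizer is
  then within \<open>3 * r\<close> of \<open>x\<close>, and freezing the kernel at \<open>x\<close>
  needs twice that distance, whence \<open>6 \<le> M\<close>.\<close>

locale doubling_configuration = cz_setting s \<Lambda> \<mu> \<alpha> \<kappa> k
  for s \<Lambda> :: real and \<mu> :: "(real^'n) measure" and \<alpha> \<kappa> and k +
  fixes x p :: "real^'n" and r M \<tau> A R :: real and j :: nat
  assumes r: "0 < r" and null: "emeasure \<mu> (ball x r) = 0"
    and px: "dist p x \<le> 2 * r" and M: "6 \<le> M"
    and small: "measure \<mu> (ball x (M * r)) \<le> \<tau> * r powr s"
    and A: "A = 4 ^ (CARD('n) + 1)" and s_lt: "s < real CARD('n)"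
    and R: "R = r / 4 ^ Suc j"
    and pos: "0 < measure \<mu> (ball p (r / 4 ^ j))"
    and doubling: "measure \<mu> (ball p (r / 4 ^ j)) \<le> A * measure \<mu> (ball p R)"
    and decay: "\<And>i. i \<le> j \<Longrightarrow> A ^ i * measure \<mu> (ball p (r / 4 ^ i)) \<le> measure \<mu> (ball p r)"
begin

lemma R_pos: "0 < R" using r R by simp

lemma R_le: "4 * R = r / 4 ^ j" "4 * R \<le> r"
proof -
  show eq: "4 * R = r / 4 ^ j" using R by simp
  have "r / 4 ^ j \<le> r / 1" using r by (intro divide_left_mono) auto
  then show "4 * R \<le> r" using eq by simp
qed

lemma A_ge: "1 \<le> A" "4 powr s / A \<le> 1 / 4"
proof -
  show "1 \<le> A" unfolding A by (rule one_le_power) simp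
  have "4 powr s \<le> 4 powr (real CARD('n))" using s_lt by (intro powr_mono) auto
  also have "\<dots> = 4 ^ CARD('n)" by (simp add: powr_realpow)
  finally show "4 powr s / A \<le> 1 / 4" by (simp add: A)
qed

lemma tau_nonneg: "0 \<le> \<tau>"
proof -
  have "0 \<le> \<tau> * r powr s" using small measure_nonneg order_trans by blast
  then show ?thesis using r by (simp add: zero_le_mult_iff)
qed

lemma ball_p_r: "ball p r \<subseteq> ball x (M * r)"
proof
  fix y assume "y \<in> ball p r"
  then have "dist x y < 3 * r" using px dist_triangle[of x y p] by (simp add: dist_commute)
  also have "3 * r \<le> M * r" using M r by (intro mult_right_mono) auto
  finally show "y \<in> ball x (M * r)" by simp
qed

text \<open>Each scale gains \<open>A\<close> in mass while the power \<open>s\<close> of the radius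
  drops only by \<open>4 powr s\<close>; the quotient is at most \<open>1 / 4\<close>. Thus the
  density decreases geometrically, starting from \<open>ball p r\<close>, which is contained in
  \<open>ball x (M * r)\<close>.\<close>

lemma measure_scale:
  assumes "i \<le> j"
  shows "measure \<mu> (ball p (r / 4 ^ i)) \<le> \<tau> * (r / 4 ^ i) powr s * (1 / 4) ^ i"
proof -
  have "A ^ i * measure \<mu> (ball p (r / 4 ^ i)) \<le> \<tau> * r powr s"
    using decay[OF assms] measure_ball_mono[OF ball_p_r] small by linarith
  then have "measure \<mu> (ball p (r / 4 ^ i)) \<le> \<tau> * r powr s / A ^ i"
    using A_ge by (simp add: field_simps)
  also have "\<dots> = \<tau> * (r / 4 ^ i) powr s * (4 powr s / A) ^ i"
    using r by (simp add: powr_divide power_divide powr_realpow[symmetric] powr_powr mult.commute)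
  also have "\<dots> \<le> \<tau> * (r / 4 ^ i) powr s * (1 / 4) ^ i"
    using A_ge tau_nonneg by (intro mult_left_mono power_mono) auto
  finally show ?thesis .
qed

abbreviation Q where "Q \<equiv> ball p (4 * R)"
abbreviation W where "W \<equiv> ball x (M * r)"

lemma measure_Q: "measure \<mu> Q \<le> \<tau> * (4 * R) powr s"
proof -
  have "measure \<mu> Q \<le> \<tau> * (4 * R) powr s * (1 / 4) ^ j"
    using measure_scale[of j] R_le(1) by simp
  also have "\<dots> \<le> \<tau> * (4 * R) powr s * 1"
    using tau_nonneg by (intro mult_left_mono power_le_one) auto
  finally show ?thesis by simp
qed

definition mass where "mass = (\<integral>y. bump p R y \<partial>\<mu>)"

definition g where "g y = bump p R y / mass"

lemma bump_integrable: "integrable \<mu> (bump p R)"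
proof -
  have "integrable \<mu> (\<lambda>y. complex_of_real (bump p R y))"
    by (intro Lip0_integrable Lip0_of_real bump_Lip0 R_pos)
  then show ?thesis using integrable_Re by fastforce
qed

lemma mass: "measure \<mu> (ball p R) \<le> mass" "0 < mass"
proof -
  have "integral\<^sup>L \<mu> (indicator (ball p R) :: _ \<Rightarrow> real) \<le> integral\<^sup>L \<mu> (bump p R)"
  proof (rule integral_mono[OF _ bump_integrable])
    show "integrable \<mu> (indicator (ball p R) :: _ \<Rightarrow> real)"
      using emeasure_ball_finite[of p R] by (simp add: sets_mu less_top)
    show "indicator (ball p R) y \<le> bump p R y" for y
      using bump_eq_1[OF R_pos, of y p] bump_bounds[of p R y] by (auto simp: indicator_def dist_commute)
  qed
  then show le: "measure \<mu> (ball p R) \<le> mass"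
    by (simp add: mass_def)
  \<comment> \<open>Doubling transfers positivity to the inner ball, on which the bump is
    \<open>1\<close>.\<close>
  have "0 < A * measure \<mu> (ball p R)" using pos doubling by linarith
  then show "0 < mass" using le A_ge by (simp add: zero_less_mult_iff)
qed

lemma g_normalizer: "normalizer \<mu> g"
  unfolding normalizer_def g_def
proof (intro conjI allI)
  show "(\<lambda>y. bump p R y / mass) \<in> Lip0"
    by (rule Lip0_bounded_linear[OF bounded_linear_divide bump_Lip0[OF R_pos]])
  show "(\<integral>y. bump p R y / mass \<partial>\<mu>) = 1" using mass(2) by (simp add: mass_def)
  show "0 \<le> bump p R y / mass" for y
    using mass(2) bump_bounds[of p R y] by simp
qed

lemma g_nonneg: "0 \<le> g y" using g_normalizer by (simp add: normalizer_def)

lemma g_integral: "(\<integral>y. cmod (of_real (g y)) \<partial>\<mu>) = 1"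
  using g_normalizer g_nonneg by (simp add: normalizer_def)

lemma g_eq_0: "2 * R \<le> dist y p \<Longrightarrow> g y = 0"
  by (simp add: g_def bump_eq_0[OF R_pos])

text \<open>Below distance \<open>\<theta> * R\<close> only niceness helps and gives the term with
  \<open>\<Lambda> * \<theta>\<close>. Beyond it the integrand is at most
  \<open>8 * R * (\<theta> * R) powr (- s)\<close>, as \<open>Q\<close> has diameter at most
  \<open>8 * R\<close>, and the small density of \<open>Q\<close> gives the term with
  \<open>\<tau>\<close>.\<close>

lemma near_Q:
  assumes u: "u \<in> Q" and th: "0 < \<theta>"
  shows "(\<integral>\<^sup>+v\<in>Q. ennreal (norm (u - v) powr (1 - s)) \<partial>\<mu>)
    \<le> ennreal ((2 powr (s + 1) * \<Lambda> * \<theta> + 8 * \<theta> powr (- s) * 4 powr s * \<tau>) * R)"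
proof -
  have Rt: "0 < \<theta> * R" using th R_pos by simp
  have [measurable]: "ball u (\<theta> * R) \<in> sets \<mu>" "Q \<in> sets \<mu>" by (simp_all add: sets_mu)
  have "(\<integral>\<^sup>+v\<in>Q. ennreal (norm (u - v) powr (1 - s)) \<partial>\<mu>)
    \<le> (\<integral>\<^sup>+v. ennreal (norm (u - v) powr (1 - s)) * indicator (ball u (\<theta> * R)) v
        + ennreal (8 * R * (\<theta> * R) powr (- s)) * indicator Q v \<partial>\<mu>)"
  proof (intro nn_integral_mono)
    fix v
    show "ennreal (norm (u - v) powr (1 - s)) * indicator Q v
      \<le> ennreal (norm (u - v) powr (1 - s)) * indicator (ball u (\<theta> * R)) v
        + ennreal (8 * R * (\<theta> * R) powr (- s)) * indicator Q v"
    proof (cases "v \<in> Q \<and> v \<notin> ball u (\<theta> * R)")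
      case True
      then have uv: "\<theta> * R \<le> norm (u - v)" by (simp add: dist_norm)
      have uv8: "norm (u - v) \<le> 8 * R"
        using True u dist_triangle[of u v p] by (simp add: dist_norm norm_minus_commute)
      have "norm (u - v) powr (1 - s) = norm (u - v) * norm (u - v) powr (- s)"
        using uv Rt by (simp add: powr_diff powr_minus divide_inverse)
      also have "\<dots> \<le> 8 * R * (\<theta> * R) powr (- s)"
        using uv uv8 Rt s_pos R_pos by (intro mult_mono powr_mono2') auto
      finally show ?thesis using True by (auto intro!: ennreal_leI)
    qed (auto simp: indicator_def)
  qed
  also have "\<dots> = (\<integral>\<^sup>+v\<in>ball u (\<theta> * R). ennreal (norm (u - v) powr (1 - s)) \<partial>\<mu>)
        + ennreal (8 * R * (\<theta> * R) powr (- s)) * emeasure \<mu> Q"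
    by (subst nn_integral_add) (auto simp: nn_integral_cmult_indicator)
  also have "\<dots> \<le> ennreal (2 powr (s + 1) * \<Lambda> * (\<theta> * R)) + ennreal (8 * R * (\<theta> * R) powr (- s)) * ennreal (\<tau> * (4 * R) powr s)"
    using measure_Q by (intro add_mono nn_integral_kernel_near Rt mult_left_mono) (auto simp: emeasure_ball_eq ennreal_leI)
  also have "\<dots> = ennreal (2 powr (s + 1) * \<Lambda> * (\<theta> * R) + 8 * R * (\<theta> * R) powr (- s) * (\<tau> * (4 * R) powr s))"
  proof -
    have "ennreal a + ennreal b * ennreal c = ennreal (a + b * c)" if "0 \<le> a" "0 \<le> b" "0 \<le> c" for a b c
      using that by (simp add: ennreal_mult ennreal_plus)
    then show ?thesis using Rt R_pos tau_nonneg Lambda_pos by simp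
  qed
  also have "2 powr (s + 1) * \<Lambda> * (\<theta> * R) + 8 * R * (\<theta> * R) powr (- s) * (\<tau> * (4 * R) powr s)
      = (2 powr (s + 1) * \<Lambda> * \<theta> + 8 * \<theta> powr (- s) * 4 powr s * \<tau>) * R"
    using R_pos th by (simp add: powr_mult powr_minus field_simps)
  finally show ?thesis .
qed

text \<open>As \<psi> = 1 on \<open>Q\<close>, the antisymmetrized integrand is half the difference
  of two values of \<open>g\<close>, whose Lipschitz constant is at most
  \<open>1 / (R * mass)\<close>. The double integral produces \<open>R\<close> times the mass of
  \<open>Q\<close>, so \<open>R\<close> cancels and a ratio of masses remains.\<close>

lemma local_part:
  assumes th: "0 < \<theta>" and \<psi>: "\<And>y. y \<in> Q \<Longrightarrow> \<psi> y = 1"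
  shows "cmod (\<integral>w. indicator (Q \<times> Q) w *\<^sub>R (case w of (u, v) \<Rightarrow>
       k (u - v) * H_form (\<lambda>y. of_real (g y)) \<psi> u v) \<partial>(\<mu> \<Otimes>\<^sub>M \<mu>))
    \<le> A / 2 * (2 powr (s + 1) * \<Lambda> * \<theta> + 8 * \<theta> powr (- s) * 4 powr s * \<tau>)"
proof -
  define \<sigma> where "\<sigma> = 2 powr (s + 1) * \<Lambda> * \<theta> + 8 * \<theta> powr (- s) * 4 powr s * \<tau>"
  have \<sigma>: "0 \<le> \<sigma>" using th Lambda_pos tau_nonneg by (simp add: \<sigma>_def)
  define c where "c = 1 / (2 * R * mass)"
  have c: "0 < c" using R_pos mass by (simp add: c_def)
  have Fle: "cmod (k (u - v) * H_form (\<lambda>y. of_real (g y)) \<psi> u v) \<le> c * norm (u - v) powr (1 - s)"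
    if "u \<in> Q" "v \<in> Q" for u v
  proof (cases "u = v")
    case False
    have "H_form (\<lambda>y. of_real (g y)) \<psi> u v = of_real ((g v - g u) / 2)"
      using \<psi> that by (simp add: H_form_def)
    also have "cmod \<dots> = \<bar>bump p R v - bump p R u\<bar> / mass / 2"
      using mass(2) unfolding norm_of_real by (simp add: g_def diff_divide_distrib[symmetric])
    also have "\<dots> \<le> dist v u / R / mass / 2"
      using bump_diff_le[OF R_pos] mass(2) by (intro divide_right_mono) auto
    finally have H: "cmod (H_form (\<lambda>y. of_real (g y)) \<psi> u v) \<le> c * norm (u - v)"
      by (simp add: c_def dist_norm norm_minus_commute mult_ac)
    have "cmod (k (u - v) * H_form (\<lambda>y. of_real (g y)) \<psi> u v) \<le> norm (u - v) powr (- s) * (c * norm (u - v))"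
      unfolding norm_mult using k_bound[of "u - v"] H False by (intro mult_mono) auto
    also have "\<dots> = c * norm (u - v) powr (1 - s)"
      using False by (simp add: powr_diff powr_minus divide_inverse)
    finally show ?thesis .
  qed simp
  have "(\<integral>\<^sup>+w. ennreal (norm (indicator (Q \<times> Q) w *\<^sub>R (case w of (u, v) \<Rightarrow>
       k (u - v) * H_form (\<lambda>y. of_real (g y)) \<psi> u v))) \<partial>(\<mu> \<Otimes>\<^sub>M \<mu>))
    \<le> (\<integral>\<^sup>+w. ennreal c * (ennreal (norm (fst w - snd w) powr (1 - s)) * indicator (Q \<times> Q) w) \<partial>(\<mu> \<Otimes>\<^sub>M \<mu>))"
  proof (intro nn_integral_mono)
    fix w :: "(real^'n) \<times> (real^'n)"
    obtain u v where w: "w = (u, v)" by (cases w)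
    show "ennreal (norm (indicator (Q \<times> Q) w *\<^sub>R (case w of (u, v) \<Rightarrow>
       k (u - v) * H_form (\<lambda>y. of_real (g y)) \<psi> u v)))
      \<le> ennreal c * (ennreal (norm (fst w - snd w) powr (1 - s)) * indicator (Q \<times> Q) w)"
      using Fle[of u v] c w
      by (cases "u \<in> Q \<and> v \<in> Q") (auto simp: ennreal_mult[symmetric] intro!: ennreal_leI)
  qed
  also have "\<dots> = ennreal c * (\<integral>\<^sup>+w\<in>Q \<times> Q. ennreal (norm (fst w - snd w) powr (1 - s)) \<partial>(\<mu> \<Otimes>\<^sub>M \<mu>))"
  proof -
    have [measurable]: "Q \<in> sets \<mu>" by (simp add: sets_mu)
    show ?thesis by (intro nn_integral_cmult) measurable
  qed
  also have "\<dots> \<le> ennreal c * (ennreal (\<sigma> * R) * emeasure \<mu> Q)"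
    unfolding \<sigma>_def by (intro mult_left_mono double_integral_near near_Q th) auto
  also have "\<dots> = ennreal (c * (\<sigma> * R * measure \<mu> Q))"
    using c \<sigma> R_pos by (simp add: emeasure_ball_eq ennreal_mult)
  also have "c * (\<sigma> * R * measure \<mu> Q) = \<sigma> / 2 * (measure \<mu> Q / mass)"
    using R_pos by (simp add: c_def)
  \<comment> \<open>Doubling compares the mass of \<open>Q\<close> with the unknown, possibly tiny,
    mass of the bump.\<close>
  also have "\<dots> \<le> \<sigma> / 2 * A"
  proof -
    have "measure \<mu> Q \<le> A * measure \<mu> (ball p R)" using doubling R_le(1) by simp
    also have "\<dots> \<le> A * mass" using mass A_ge by (intro mult_left_mono) auto
    finally have "measure \<mu> Q / mass \<le> A" using mass(2) by (simp add: field_simps)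
    then show ?thesis using \<sigma> by (intro mult_left_mono) auto
  qed
  finally show ?thesis
    using \<sigma> A_ge unfolding \<sigma>_def[symmetric]
    by (intro norm_integral_le_nn) (auto simp: mult_ac ennreal_leI elim: order_trans)
qed

text \<open>On \<open>W\<close> the kernel is at most \<open>r powr (- s)\<close> almost everywhere,
  because \<open>ball x r\<close> is null; the mass of \<open>W\<close> is at most
  \<open>\<tau> * r powr s\<close>.\<close>

lemma k_part:
  assumes "\<And>y. 0 \<le> \<psi> y" "\<And>y. \<psi> y \<le> 1"
  shows "cmod (\<integral>y. indicator W y *\<^sub>R (k (y - x) * of_real (\<psi> y)) \<partial>\<mu>) \<le> \<tau>"
proof (rule norm_integral_le_nn)
  have "AE y in \<mu>. y \<notin> ball x r"
    using null by (intro AE_not_in) (auto simp: null_sets_def sets_mu)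
  then have "(\<integral>\<^sup>+y. ennreal (cmod (indicator W y *\<^sub>R (k (y - x) * of_real (\<psi> y)))) \<partial>\<mu>)
     \<le> (\<integral>\<^sup>+y. ennreal (r powr (- s)) * indicator W y \<partial>\<mu>)"
  proof (intro nn_integral_mono_AE, eventually_elim)
    case (elim y)
    then have y: "r \<le> norm (y - x)" by (simp add: dist_norm norm_minus_commute)
    have "cmod (k (y - x)) \<le> norm (y - x) powr (- s)" using y r by (intro k_bound) auto
    also have "\<dots> \<le> r powr (- s)" using y r s_pos by (intro powr_mono2') auto
    finally have "cmod (k (y - x)) * \<bar>\<psi> y\<bar> \<le> r powr (- s) * 1"
      using assms[of y] by (intro mult_mono) auto
    then show ?case by (cases "y \<in> W") (auto simp: norm_mult intro!: ennreal_leI)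
  qed
  also have "\<dots> = ennreal (r powr (- s) * measure \<mu> W)"
    by (subst nn_integral_cmult_indicator) (auto simp: sets_mu emeasure_ball_eq ennreal_mult)
  also have "\<dots> \<le> ennreal (r powr (- s) * (\<tau> * r powr s))"
    using small by (intro ennreal_leI mult_left_mono) auto
  also have "r powr (- s) * (\<tau> * r powr s) = \<tau>" using r by (simp add: powr_minus)
  finally show "(\<integral>\<^sup>+y. ennreal (cmod (indicator W y *\<^sub>R (k (y - x) * of_real (\<psi> y)))) \<partial>\<mu>) \<le> ennreal \<tau>" .
qed (rule tau_nonneg)

text \<open>The support of \<open>g\<close> has radius at most \<open>2 * R\<close> around
  \<open>p\<close> and \<open>u\<close> is at distance at least \<open>4 * R\<close>, so at least
  half the distance to \<open>p\<close> remains.\<close>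

lemma T_fun_g_le:
  assumes "u \<notin> Q"
  shows "cmod (T_fun k \<mu> (\<lambda>y. of_real (g y)) u) \<le> 2 powr s * norm (u - p) powr (- s)"
proof -
  have u: "4 * R \<le> norm (u - p)" using assms by (simp add: dist_norm norm_minus_commute)
  have "cmod (T_fun k \<mu> (\<lambda>y. of_real (g y)) u) \<le> (norm (u - p) / 2) powr (- s) * (\<integral>y. cmod (of_real (g y)) \<partial>\<mu>)"
  proof (rule T_fun_integrable(2)[OF normalizer_Lip0(1)[OF g_normalizer]])
    show "0 < norm (u - p) / 2" using u R_pos by linarith
    fix v assume "complex_of_real (g v) \<noteq> 0"
    then have "dist v p < 2 * R" using g_eq_0[of v] by force
    then show "norm (u - p) / 2 \<le> dist u v"
      using u dist_triangle[of u p v] by (simp add: dist_norm)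
  qed
  also have "\<dots> = 2 powr s * norm (u - p) powr (- s)"
    unfolding g_integral by (simp add: powr_divide powr_minus field_simps)
  finally show ?thesis .
qed

text \<open>Shells between \<open>Q\<close> and \<open>ball p r\<close> contribute
  \<open>4 powr s * \<tau>\<close> times a geometric series of ratio \<open>1 / 4\<close>, whose sum
  is \<open>4 / 3\<close>. The rest of \<open>W\<close> is at distance at least \<open>r\<close>
  from \<open>p\<close> and accounts for the summand \<open>1\<close>.\<close>

lemma middle_part:
  assumes "\<And>y. 0 \<le> \<psi> y" "\<And>y. \<psi> y \<le> 1"
  shows "cmod (\<integral>u. indicator W u *\<^sub>R (indicator (- Q) u *\<^sub>R (of_real (\<psi> u) * T_fun k \<mu> (\<lambda>y. of_real (g y)) u)) \<partial>\<mu>)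
     \<le> 2 powr s * (4 powr s * 4 / 3 + 1) * \<tau>"
proof (rule norm_integral_le_nn)
  have [measurable]: "Q \<in> sets \<mu>" "W \<in> sets \<mu>" "ball p r \<in> sets \<mu>" by (simp_all add: sets_mu)
  have shell: "(\<integral>\<^sup>+u\<in>ball p r - Q. ennreal (norm (u - p) powr (- s)) \<partial>\<mu>) \<le> ennreal (4 powr s * \<tau> / (1 - 1/4))"
  \<comment> \<open>The weight is \<open>0\<close> from index \<open>j\<close> on: no point outside
    \<open>Q\<close> lies in these smaller shells, and \<open>measure_scale\<close> ends at
    \<open>j\<close>.\<close>
  proof (rule nn_integral_le_geometric[where \<rho> = "\<lambda>i. r / 4 ^ i" and x = p
        and c = "\<lambda>i. if i < j then (r / 4 ^ Suc i) powr (- s) else 0"])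
    fix u assume "u \<in> ball p r - Q"
    then have "r / 4 ^ j \<le> dist u p" "dist u p < r" using R_le(1) by (auto simp: dist_commute)
    then obtain i where i: "i < j" "r / 4 ^ Suc i \<le> dist u p" "dist u p < r / 4 ^ i"
      using quaternary_scale by blast
    have "norm (u - p) powr (- s) \<le> (r / 4 ^ Suc i) powr (- s)"
      using i r s_pos by (intro powr_mono2') (auto simp: dist_norm)
    then show "\<exists>i. u \<in> ball p (r / 4 ^ i) \<and> ennreal (norm (u - p) powr (- s))
        \<le> ennreal (if i < j then (r / 4 ^ Suc i) powr (- s) else 0)"
      using i by (intro exI[of _ i]) (auto simp: dist_commute intro!: ennreal_leI)
  next
    fix i
    show "ennreal (if i < j then (r / 4 ^ Suc i) powr (- s) else 0) * emeasure \<mu> (ball p (r / 4 ^ i))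
        \<le> ennreal (4 powr s * \<tau> * (1/4) ^ i)"
    proof (cases "i < j")
      case True
      define a where "a = r / 4 ^ i"
      have a: "0 < a" "r / 4 ^ Suc i = a / 4" using r by (simp_all add: a_def)
      have "(a / 4) powr (- s) * measure \<mu> (ball p a) \<le> (a / 4) powr (- s) * (\<tau> * a powr s * (1/4) ^ i)"
        using measure_scale[of i] True by (intro mult_left_mono) (auto simp: a_def)
      also have "\<dots> = 4 powr s * \<tau> * (1/4) ^ i"
        using a(1) by (simp add: powr_divide powr_minus field_simps)
      finally have "ennreal ((a / 4) powr (- s)) * emeasure \<mu> (ball p a) \<le> ennreal (4 powr s * \<tau> * (1/4) ^ i)"
        by (simp add: emeasure_ball_eq ennreal_mult[symmetric] ennreal_leI)
      then show ?thesis using True unfolding a(2) a_def[symmetric] by simp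
    qed simp
  qed (use tau_nonneg in auto)
  have "(\<integral>\<^sup>+u. ennreal (cmod (indicator W u *\<^sub>R (indicator (- Q) u *\<^sub>R (of_real (\<psi> u) * T_fun k \<mu> (\<lambda>y. of_real (g y)) u)))) \<partial>\<mu>)
    \<le> (\<integral>\<^sup>+u. ennreal (2 powr s) * (ennreal (norm (u - p) powr (- s)) * indicator (ball p r - Q) u
          + ennreal (r powr (- s)) * indicator W u) \<partial>\<mu>)"
  proof (intro nn_integral_mono)
    fix u
    show "ennreal (cmod (indicator W u *\<^sub>R (indicator (- Q) u *\<^sub>R (of_real (\<psi> u) * T_fun k \<mu> (\<lambda>y. of_real (g y)) u))))
      \<le> ennreal (2 powr s) * (ennreal (norm (u - p) powr (- s)) * indicator (ball p r - Q) u
          + ennreal (r powr (- s)) * indicator W u)"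
    proof (cases "u \<in> W \<and> u \<notin> Q")
      case True
      have "cmod (of_real (\<psi> u) * T_fun k \<mu> (\<lambda>y. of_real (g y)) u) \<le> 1 * (2 powr s * norm (u - p) powr (- s))"
        unfolding norm_mult using T_fun_g_le[of u] True assms[of u] by (intro mult_mono) auto
      then have 1: "ennreal (cmod (indicator W u *\<^sub>R (indicator (- Q) u *\<^sub>R (of_real (\<psi> u) * T_fun k \<mu> (\<lambda>y. of_real (g y)) u))))
          \<le> ennreal (2 powr s) * ennreal (norm (u - p) powr (- s))"
        using True by (simp add: ennreal_mult[symmetric] ennreal_leI)
      have 2: "ennreal (norm (u - p) powr (- s)) \<le> ennreal (norm (u - p) powr (- s)) * indicator (ball p r - Q) u
          + ennreal (r powr (- s)) * indicator W u"
      proof (cases "u \<in> ball p r")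
        case False
        then have "norm (u - p) powr (- s) \<le> r powr (- s)"
          using r s_pos by (intro powr_mono2') (auto simp: dist_norm norm_minus_commute)
        then show ?thesis using True False by (auto intro!: ennreal_leI)
      qed (use True in auto)
      show ?thesis by (rule order_trans[OF 1 mult_left_mono[OF 2]]) simp
    qed auto
  qed
  also have "\<dots> = ennreal (2 powr s) * ((\<integral>\<^sup>+u\<in>ball p r - Q. ennreal (norm (u - p) powr (- s)) \<partial>\<mu>)
      + ennreal (r powr (- s)) * emeasure \<mu> W)"
    by (subst nn_integral_cmult) (auto simp: nn_integral_add nn_integral_cmult_indicator)
  also have "\<dots> \<le> ennreal (2 powr s) * (ennreal (4 powr s * \<tau> / (1 - 1/4)) + ennreal \<tau>)"
  proof (intro mult_left_mono add_mono shell)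
    have "r powr (- s) * measure \<mu> W \<le> r powr (- s) * (\<tau> * r powr s)"
      using small by (intro mult_left_mono) auto
    also have "\<dots> = \<tau>" using r by (simp add: powr_minus)
    finally show "ennreal (r powr (- s)) * emeasure \<mu> W \<le> ennreal \<tau>"
      by (simp add: emeasure_ball_eq ennreal_mult[symmetric] ennreal_leI)
  qed auto
  also have "\<dots> = ennreal (2 powr s * (4 powr s * 4 / 3 + 1) * \<tau>)"
    using tau_nonneg by (simp add: ennreal_mult[symmetric] ennreal_plus[symmetric] algebra_simps del: ennreal_plus)
  finally show "(\<integral>\<^sup>+u. ennreal (cmod (indicator W u *\<^sub>R (indicator (- Q) u *\<^sub>R (of_real (\<psi> u) * T_fun k \<mu> (\<lambda>y. of_real (g y)) u)))) \<partial>\<mu>)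
    \<le> ennreal (2 powr s * (4 powr s * 4 / 3 + 1) * \<tau>)" .
qed (use tau_nonneg in auto)

text \<open>Freezing the kernel at \<open>x\<close> costs \<open>(3 * r) powr \<alpha>\<close> and
  the tail integral gives \<open>(M * r) powr (- \<alpha>)\<close>; \<open>r\<close> cancels and
  only \<open>M\<close> is left.\<close>

lemma far_part:
  assumes "\<And>y. 0 \<le> \<psi> y" "\<And>y. \<psi> y \<le> 1"
  shows "cmod (\<integral>u. indicator (- W) u *\<^sub>R (of_real (\<psi> u) * (k (u - x) - T_fun k \<mu> (\<lambda>y. of_real (g y)) u)) \<partial>\<mu>)
     \<le> kernel_const s \<alpha> \<kappa> * 3 powr \<alpha> * (\<Lambda> * 2 powr s / (1 - 2 powr (- \<alpha>))) * M powr (- \<alpha>)"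
proof (rule norm_integral_le_nn)
  have [measurable]: "W \<in> sets \<mu>" by (simp_all add: sets_mu)
  define c where "c = kernel_const s \<alpha> \<kappa> * (3 * r) powr \<alpha>"
  have c: "0 \<le> c" using kernel_const_nonneg by (simp add: c_def)
  have Mr: "0 < M * r" using M r by simp
  have "(\<integral>\<^sup>+u. ennreal (cmod (indicator (- W) u *\<^sub>R (of_real (\<psi> u) * (k (u - x) - T_fun k \<mu> (\<lambda>y. of_real (g y)) u)))) \<partial>\<mu>)
    \<le> (\<integral>\<^sup>+u. ennreal c * (ennreal (norm (u - x) powr (- s - \<alpha>)) * indicator (- W) u) \<partial>\<mu>)"
  proof (intro nn_integral_mono)
    fix u
    show "ennreal (cmod (indicator (- W) u *\<^sub>R (of_real (\<psi> u) * (k (u - x) - T_fun k \<mu> (\<lambda>y. of_real (g y)) u))))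
      \<le> ennreal c * (ennreal (norm (u - x) powr (- s - \<alpha>)) * indicator (- W) u)"
    proof (cases "u \<in> W")
      case False
      have Mr6: "6 * r \<le> M * r" using M r by (intro mult_right_mono) auto
      have "cmod (T_fun k \<mu> (\<lambda>y. of_real (g y)) u - k (u - x) * (\<integral>y. of_real (g y) \<partial>\<mu>))
          \<le> kernel_const s \<alpha> \<kappa> * (3 * r) powr \<alpha> * norm (u - x) powr (- s - \<alpha>) * (\<integral>y. cmod (of_real (g y)) \<partial>\<mu>)"
      proof (rule T_fun_approx[OF normalizer_Lip0(1)[OF g_normalizer]])
        fix y assume "complex_of_real (g y) \<noteq> 0"
        then have "dist y p < 2 * R" using g_eq_0[of y] by force
        then show "dist y x \<le> 3 * r"
          using px R_le(2) r dist_triangle[of y x p] by linarith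
      next
        show "2 * (3 * r) \<le> dist u x" using False Mr6 by (simp add: dist_commute)
      qed (use r in auto)
      then have "cmod (k (u - x) - T_fun k \<mu> (\<lambda>y. of_real (g y)) u) \<le> c * norm (u - x) powr (- s - \<alpha>)"
        using normalizer_Lip0(2)[OF g_normalizer] g_integral by (simp add: c_def norm_minus_commute)
      then have "cmod (of_real (\<psi> u) * (k (u - x) - T_fun k \<mu> (\<lambda>y. of_real (g y)) u)) \<le> 1 * (c * norm (u - x) powr (- s - \<alpha>))"
        unfolding norm_mult using assms[of u] by (intro mult_mono) auto
      then show ?thesis using False c by (simp add: ennreal_mult[symmetric] ennreal_leI)
    qed simp
  qed
  also have "\<dots> = ennreal c * (\<integral>\<^sup>+u\<in>- W. ennreal (norm (u - x) powr (- s - \<alpha>)) \<partial>\<mu>)"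
    by (intro nn_integral_cmult) measurable
  also have "\<dots> \<le> ennreal c * ennreal (\<Lambda> * 2 powr s * (M * r) powr (- \<alpha>) / (1 - 2 powr (- \<alpha>)))"
    by (intro mult_left_mono nn_integral_tail Mr alpha_pos) auto
  also have "\<dots> = ennreal (c * (\<Lambda> * 2 powr s * (M * r) powr (- \<alpha>) / (1 - 2 powr (- \<alpha>))))"
  proof (rule ennreal_mult[symmetric, OF c])
    have "2 powr (- \<alpha>) < 1" using alpha_pos by (simp add: powr_less_one)
    then show "0 \<le> \<Lambda> * 2 powr s * (M * r) powr (- \<alpha>) / (1 - 2 powr (- \<alpha>))"
      using Lambda_pos by (intro divide_nonneg_nonneg mult_nonneg_nonneg) auto
  qed
  also have "c * (\<Lambda> * 2 powr s * (M * r) powr (- \<alpha>) / (1 - 2 powr (- \<alpha>)))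
     = kernel_const s \<alpha> \<kappa> * 3 powr \<alpha> * (\<Lambda> * 2 powr s / (1 - 2 powr (- \<alpha>))) * M powr (- \<alpha>)"
    using r M by (simp add: c_def powr_mult powr_minus)
  finally show "(\<integral>\<^sup>+u. ennreal (cmod (indicator (- W) u *\<^sub>R (of_real (\<psi> u) * (k (u - x) - T_fun k \<mu> (\<lambda>y. of_real (g y)) u)))) \<partial>\<mu>)
    \<le> ennreal (kernel_const s \<alpha> \<kappa> * 3 powr \<alpha> * (\<Lambda> * 2 powr s / (1 - 2 powr (- \<alpha>))) * M powr (- \<alpha>))" .
  have "2 powr (- \<alpha>) < 1" using alpha_pos by (simp add: powr_less_one)
  then show "0 \<le> kernel_const s \<alpha> \<kappa> * 3 powr \<alpha> * (\<Lambda> * 2 powr s / (1 - 2 powr (- \<alpha>))) * M powr (- \<alpha>)"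
    using kernel_const_nonneg Lambda_pos by (intro mult_nonneg_nonneg divide_nonneg_nonneg) auto
qed

text \<open>The kernel term and the outer part of the form are paired only outside \<open>W\<close>,
  where their difference decays. Inside \<open>W\<close> each is small by itself.\<close>

lemma pot_approx_le:
  assumes \<psi>: "\<psi> \<in> Lip0" "\<And>y. 0 \<le> \<psi> y" "\<And>y. \<psi> y \<le> 1" "\<And>y. y \<in> Q \<Longrightarrow> \<psi> y = 1" and th: "0 < \<theta>"
  shows "cmod (pot_approx k \<mu> x (\<lambda>y. of_real (g y)) \<psi>) \<le> \<tau>
     + A / 2 * (2 powr (s + 1) * \<Lambda> * \<theta> + 8 * \<theta> powr (- s) * 4 powr s * \<tau>)
     + 2 powr s * (4 powr s * 4 / 3 + 1) * \<tau>
     + kernel_const s \<alpha> \<kappa> * 3 powr \<alpha> * (\<Lambda> * 2 powr s / (1 - 2 powr (- \<alpha>))) * M powr (- \<alpha>)"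
proof -
  define G where "G = (\<lambda>y. complex_of_real (g y))"
  define h where "h = (\<lambda>y. complex_of_real (\<psi> y))"
  have G: "G \<in> Lip0" unfolding G_def by (rule normalizer_Lip0(1)[OF g_normalizer])
  have h: "h \<in> Lip0" unfolding h_def by (rule Lip0_of_real[OF \<psi>(1)])
  have Q: "Q \<in> sets borel" by simp
  have W: "W \<in> sets \<mu>" "- W \<in> sets \<mu>" by (simp_all add: sets_mu)
  have R2: "0 < 2 * R" using R_pos by simp
  have sep: "2 * R \<le> dist u v" if "u \<notin> Q" "G v \<noteq> 0" for u v
  proof -
    have "dist v p < 2 * R" using that(2) g_eq_0[of v] by (force simp: G_def)
    then show ?thesis using that(1) dist_triangle[of u p v] by (simp add: dist_commute)
  qed
  define I2 where "I2 = (\<integral>w. indicator (Q \<times> Q) w *\<^sub>R (case w of (u, v) \<Rightarrow> k (u - v) * H_form G h u v) \<partial>(\<mu> \<Otimes>\<^sub>M \<mu>))"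
  define S where "S u = indicator (- Q) u *\<^sub>R (h u * T_fun k \<mu> G u)" for u
  define J where "J = (\<lambda>u. k (u - x) * h u)"
  have split: "T_form k \<mu> G h = I2 + integral\<^sup>L \<mu> S"
    unfolding I2_def S_def by (rule T_form_split(2)[OF G h Q R2 sep])
  have S: "integrable \<mu> S"
    unfolding S_def by (rule T_form_split(1)[OF G h Q R2 sep])
  have J: "integrable \<mu> J" unfolding J_def by (rule kernel_cutoff_integrable[OF r null h])
  have iW: "integrable \<mu> (\<lambda>u. indicator W u *\<^sub>R S u)" "integrable \<mu> (\<lambda>u. indicator (- W) u *\<^sub>R S u)"
    "integrable \<mu> (\<lambda>u. indicator W u *\<^sub>R J u)" "integrable \<mu> (\<lambda>u. indicator (- W) u *\<^sub>R J u)"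
    by (intro integrable_mult_indicator W S J)+
  have splitW: "integral\<^sup>L \<mu> f = (\<integral>u. indicator W u *\<^sub>R f u \<partial>\<mu>) + (\<integral>u. indicator (- W) u *\<^sub>R f u \<partial>\<mu>)"
    if "integrable \<mu> (\<lambda>u. indicator W u *\<^sub>R f u)" "integrable \<mu> (\<lambda>u. indicator (- W) u *\<^sub>R f u)"
    for f :: "real^'n \<Rightarrow> complex"
  proof -
    have "f = (\<lambda>u. indicator W u *\<^sub>R f u + indicator (- W) u *\<^sub>R f u)"
      by (auto simp: fun_eq_iff indicator_def)
    then show ?thesis using Bochner_Integration.integral_add[OF that] by simp
  qed
  \<comment> \<open>Outside \<open>W\<close> the indicator of the complement of \<open>Q\<close> in
    \<open>S\<close> is therefore \<open>1\<close>.\<close>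
  have "Q \<subseteq> W" using ball_p_r R_le(2) subset_ball[of "4 * R" r p] by auto
  then have "(\<lambda>u. indicator (- W) u *\<^sub>R J u - indicator (- W) u *\<^sub>R S u)
      = (\<lambda>u. indicator (- W) u *\<^sub>R (h u * (k (u - x) - T_fun k \<mu> G u)))"
    by (auto simp: fun_eq_iff indicator_def S_def J_def algebra_simps)
  then have I4: "(\<integral>u. indicator (- W) u *\<^sub>R J u \<partial>\<mu>) - (\<integral>u. indicator (- W) u *\<^sub>R S u \<partial>\<mu>)
     = (\<integral>u. indicator (- W) u *\<^sub>R (h u * (k (u - x) - T_fun k \<mu> G u)) \<partial>\<mu>)"
    using Bochner_Integration.integral_diff[OF iW(4) iW(2)] by simp
  have "pot_approx k \<mu> x G \<psi> = integral\<^sup>L \<mu> J - T_form k \<mu> G h"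
    by (simp add: pot_approx_def J_def h_def)
  also have "\<dots> = (\<integral>u. indicator W u *\<^sub>R J u \<partial>\<mu>) - I2 - (\<integral>u. indicator W u *\<^sub>R S u \<partial>\<mu>)
     + (\<integral>u. indicator (- W) u *\<^sub>R (h u * (k (u - x) - T_fun k \<mu> G u)) \<partial>\<mu>)"
    unfolding split splitW[OF iW(1,2)] splitW[OF iW(3,4)] I4[symmetric] by simp
  finally have "cmod (pot_approx k \<mu> x G \<psi>) \<le> cmod (\<integral>u. indicator W u *\<^sub>R J u \<partial>\<mu>) + cmod I2 + cmod (\<integral>u. indicator W u *\<^sub>R S u \<partial>\<mu>)
     + cmod (\<integral>u. indicator (- W) u *\<^sub>R (h u * (k (u - x) - T_fun k \<mu> G u)) \<partial>\<mu>)"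
    by (simp only:) (intro order_trans[OF norm_triangle_ineq] order_trans[OF norm_triangle_ineq4] add_mono order_refl)
  also have "\<dots> \<le> \<tau>
     + A / 2 * (2 powr (s + 1) * \<Lambda> * \<theta> + 8 * \<theta> powr (- s) * 4 powr s * \<tau>)
     + 2 powr s * (4 powr s * 4 / 3 + 1) * \<tau>
     + kernel_const s \<alpha> \<kappa> * 3 powr \<alpha> * (\<Lambda> * 2 powr s / (1 - 2 powr (- \<alpha>))) * M powr (- \<alpha>)"
  proof (rule add_mono[OF add_mono[OF add_mono]])
    have hQ: "h y = 1" if "y \<in> Q" for y using \<psi>(4)[OF that] by (simp only: h_def of_real_1)
    show "cmod I2 \<le> A / 2 * (2 powr (s + 1) * \<Lambda> * \<theta> + 8 * \<theta> powr (- s) * 4 powr s * \<tau>)"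
      using local_part[OF th hQ] by (simp only: I2_def G_def)
    show "cmod (\<integral>u. indicator W u *\<^sub>R J u \<partial>\<mu>) \<le> \<tau>"
      using k_part[OF \<psi>(2,3)] by (simp only: J_def h_def)
    show "cmod (\<integral>u. indicator W u *\<^sub>R S u \<partial>\<mu>) \<le> 2 powr s * (4 powr s * 4 / 3 + 1) * \<tau>"
      using middle_part[OF \<psi>(2,3)] by (simp only: S_def G_def h_def)
    show "cmod (\<integral>u. indicator (- W) u *\<^sub>R (h u * (k (u - x) - T_fun k \<mu> G u)) \<partial>\<mu>)
        \<le> kernel_const s \<alpha> \<kappa> * 3 powr \<alpha> * (\<Lambda> * 2 powr s / (1 - 2 powr (- \<alpha>))) * M powr (- \<alpha>)"
      using far_part[OF \<psi>(2,3)] by (simp only: G_def h_def)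
  qed
  finally show ?thesis by (simp only: G_def)
qed

end

section \<open>Vector-valued kernels\<close>

lemma cz_kernel_holder:
  assumes K: "cz_kernel d' s \<alpha> K"
  shows "cnorm d' (\<lambda>i. weighted_kernel s \<alpha> K x i - weighted_kernel s \<alpha> K y i)
    \<le> kernel_seminorm d' s \<alpha> K * dist x y powr \<alpha>"
proof (cases "x = y")
  case False
  have "cnorm d' (\<lambda>i. weighted_kernel s \<alpha> K x i - weighted_kernel s \<alpha> K y i) / dist x y powr \<alpha>
      \<le> kernel_seminorm d' s \<alpha> K"
    unfolding kernel_seminorm_def
    using K False by (intro cSup_upper) (auto simp: cz_kernel_def kernel_holder_quotients_def)
  then show ?thesis using False by (simp add: field_simps)
qed (simp add: cnorm_def L2_set_def)

lemma kernel_seminorm_nonneg: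
  fixes K :: "nat \<Rightarrow> real^'n \<Rightarrow> complex"
  assumes K: "cz_kernel d' s \<alpha> K"
  shows "0 \<le> kernel_seminorm d' s \<alpha> K"
proof -
  obtain x :: "real^'n" where "x \<noteq> 0" using nonzero_Basis by (metis SOME_Basis)
  have "0 \<le> cnorm d' (\<lambda>i. weighted_kernel s \<alpha> K x i - weighted_kernel s \<alpha> K 0 i)"
    by (simp add: cnorm_def)
  also note cz_kernel_holder[OF K, of x 0]
  finally show ?thesis using \<open>x \<noteq> 0\<close> by (simp add: zero_le_mult_iff)
qed

text \<open>Cauchy-Schwarz. The pairing is bilinear to keep forms linear in the kernel; conjugation
  enters only in the choice of \<open>a\<close> in \<open>cnorm_dual\<close>.\<close>

lemma cmod_sum_mult_le_cnorm:
  assumes "cnorm d' a \<le> 1"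
  shows "cmod (\<Sum>i<d'. a i * v i) \<le> cnorm d' v"
proof -
  have "cmod (\<Sum>i<d'. a i * v i) \<le> (\<Sum>i<d'. \<bar>cmod (a i)\<bar> * \<bar>cmod (v i)\<bar>)"
    by (rule order_trans[OF norm_sum]) (simp add: norm_mult)
  also have "\<dots> \<le> cnorm d' a * cnorm d' v"
    unfolding cnorm_def by (rule L2_set_mult_ineq)
  also have "\<dots> \<le> 1 * cnorm d' v"
    using assms by (intro mult_right_mono) (auto simp: cnorm_def)
  finally show ?thesis by simp
qed

text \<open>Size bound and seminorm survive the pairing without loss, which keeps the final
  constants free of \<open>d'\<close>; bounding the coordinates one by one would cost a power of
  \<open>d'\<close>.\<close>

lemma cz_setting_combination:
  fixes \<mu> :: "(real^'n) measure"
  assumes nice: "nice_measure s \<Lambda> \<mu>" and K: "cz_kernel d' s \<alpha> K"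
    and \<alpha>: "0 < \<alpha>" "\<alpha> \<le> 1" and a: "cnorm d' a \<le> 1"
  shows "cz_setting s \<Lambda> \<mu> \<alpha> (kernel_seminorm d' s \<alpha> K) (\<lambda>x. \<Sum>i<d'. a i * K i x)"
proof -
  interpret nice_measure s \<Lambda> \<mu> by (rule nice)
  show ?thesis
  proof
    show "0 \<le> kernel_seminorm d' s \<alpha> K" by (rule kernel_seminorm_nonneg[OF K])
    fix x y :: "real^'n"
    show "cmod (\<Sum>i<d'. a i * K i x) \<le> norm x powr (- s)" if "x \<noteq> 0"
      using cmod_sum_mult_le_cnorm[OF a, of "\<lambda>i. K i x"] K that by (fastforce simp: cz_kernel_def)
    show "(\<Sum>i<d'. a i * K i (- x)) = - (\<Sum>i<d'. a i * K i x)" if "x \<noteq> 0"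
      using K that by (simp add: cz_kernel_def sum_negf)
    have "(norm x powr (s + \<alpha>)) *\<^sub>R (\<Sum>i<d'. a i * K i x) - (norm y powr (s + \<alpha>)) *\<^sub>R (\<Sum>i<d'. a i * K i y)
        = (\<Sum>i<d'. a i * (weighted_kernel s \<alpha> K x i - weighted_kernel s \<alpha> K y i))"
      by (simp add: weighted_kernel_def scaleR_sum_right right_diff_distrib sum_subtractf)
    also have "cmod \<dots> \<le> cnorm d' (\<lambda>i. weighted_kernel s \<alpha> K x i - weighted_kernel s \<alpha> K y i)"
      by (rule cmod_sum_mult_le_cnorm[OF a])
    also have "\<dots> \<le> kernel_seminorm d' s \<alpha> K * dist x y powr \<alpha>"
      by (rule cz_kernel_holder[OF K])
    finally show "cmod ((norm x powr (s + \<alpha>)) *\<^sub>R (\<Sum>i<d'. a i * K i x) - (norm y powr (s + \<alpha>)) *\<^sub>R (\<Sum>i<d'. a i * K i y))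
        \<le> kernel_seminorm d' s \<alpha> K * dist x y powr \<alpha>" .
  qed (use \<alpha> in auto)
qed

lemma cz_setting_component:
  assumes nice: "nice_measure s \<Lambda> \<mu>" and K: "cz_kernel d' s \<alpha> K"
    and \<alpha>: "0 < \<alpha>" "\<alpha> \<le> 1" and l: "l < d'"
  shows "cz_setting s \<Lambda> \<mu> \<alpha> (kernel_seminorm d' s \<alpha> K) (K l)"
proof -
  define a :: "nat \<Rightarrow> complex" where "a i = (if i = l then 1 else 0)" for i
  have "(\<Sum>i<d'. (cmod (a i))\<^sup>2) = (\<Sum>i<d'. if i = l then 1 else 0)"
    by (intro sum.cong) (auto simp: a_def)
  then have "cnorm d' a \<le> 1" using l by (simp add: cnorm_def L2_set_def)
  then have "cz_setting s \<Lambda> \<mu> \<alpha> (kernel_seminorm d' s \<alpha> K) (\<lambda>x. \<Sum>i<d'. a i * K i x)"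
    by (rule cz_setting_combination[OF nice K \<alpha>])
  moreover have "(\<lambda>x. \<Sum>i<d'. a i * K i x) = K l"
  proof
    fix x
    have "(\<Sum>i<d'. a i * K i x) = (\<Sum>i<d'. if i = l then K i x else 0)"
      by (intro sum.cong) (auto simp: a_def)
    then show "(\<Sum>i<d'. a i * K i x) = K l x" using l by simp
  qed
  ultimately show ?thesis by simp
qed

text \<open>Linearity in the kernel is proved at a fixed cutoff, where all integrals converge
  absolutely, and passes to the potentials through the limit.\<close>

lemma pot_approx_combination:
  assumes nice: "nice_measure s \<Lambda> \<mu>" and K: "cz_kernel d' s \<alpha> K"
    and \<alpha>: "0 < \<alpha>" "\<alpha> \<le> 1" and r: "0 < r" "emeasure \<mu> (ball x r) = 0"
    and f: "f \<in> Lip0" and \<psi>: "\<psi> \<in> Lip0"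
  shows "pot_approx (\<lambda>x. \<Sum>i<d'. a i * K i x) \<mu> x f \<psi> = (\<Sum>i<d'. a i * pot_approx (K i) \<mu> x f \<psi>)"
proof -
  define h where "h = (\<lambda>y. complex_of_real (\<psi> y))"
  have h: "h \<in> Lip0" unfolding h_def by (rule Lip0_of_real[OF \<psi>])
  have 1: "integrable \<mu> (\<lambda>y. a i * (K i (y - x) * h y))"
    and 2: "integrable (\<mu> \<Otimes>\<^sub>M \<mu>) (\<lambda>w. a i * (K i (fst w - snd w) * H_form f h (fst w) (snd w)))" if "i < d'" for i
  proof -
    interpret cz_setting s \<Lambda> \<mu> \<alpha> "kernel_seminorm d' s \<alpha> K" "K i"
      by (rule cz_setting_component[OF nice K \<alpha> that])
    show "integrable \<mu> (\<lambda>y. a i * (K i (y - x) * h y))"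
      by (intro integrable_mult_right kernel_cutoff_integrable[OF r h])
    show "integrable (\<mu> \<Otimes>\<^sub>M \<mu>) (\<lambda>w. a i * (K i (fst w - snd w) * H_form f h (fst w) (snd w)))"
      using T_form_integrable[OF f h] by (intro integrable_mult_right) (simp add: split_beta')
  qed
  have "(\<integral>y. (\<Sum>i<d'. a i * K i (y - x)) * h y \<partial>\<mu>) = (\<integral>y. (\<Sum>i<d'. a i * (K i (y - x) * h y)) \<partial>\<mu>)"
    by (simp add: sum_distrib_right mult.assoc)
  also have "\<dots> = (\<Sum>i<d'. a i * (\<integral>y. K i (y - x) * h y \<partial>\<mu>))"
    by (subst Bochner_Integration.integral_sum) (use 1 in auto)
  finally have A: "(\<integral>y. (\<Sum>i<d'. a i * K i (y - x)) * h y \<partial>\<mu>) = (\<Sum>i<d'. a i * (\<integral>y. K i (y - x) * h y \<partial>\<mu>))" .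
  have "T_form (\<lambda>x. \<Sum>i<d'. a i * K i x) \<mu> f h
     = (\<integral>w. (\<Sum>i<d'. a i * (K i (fst w - snd w) * H_form f h (fst w) (snd w))) \<partial>(\<mu> \<Otimes>\<^sub>M \<mu>))"
    unfolding T_form_def by (simp add: sum_distrib_right mult.assoc split_beta')
  also have "\<dots> = (\<Sum>i<d'. a i * T_form (K i) \<mu> f h)"
    by (subst Bochner_Integration.integral_sum) (use 2 in \<open>auto simp: T_form_def split_beta'\<close>)
  finally have B: "T_form (\<lambda>x. \<Sum>i<d'. a i * K i x) \<mu> f h = (\<Sum>i<d'. a i * T_form (K i) \<mu> f h)" .
  show ?thesis
    using A B unfolding pot_approx_def h_def by (simp add: right_diff_distrib sum_subtractf)
qed

lemma cnorm_dual:
  assumes "cnorm d' v > 0"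
  obtains a where "cnorm d' a \<le> 1" "(\<Sum>i<d'. a i * v i) = of_real (cnorm d' v)"
proof
  define c where "c = cnorm d' v"
  define a where "a i = cnj (v i) / of_real c" for i
  have c: "0 < c" using assms by (simp add: c_def)
  have c2: "c\<^sup>2 = (\<Sum>i<d'. (cmod (v i))\<^sup>2)"
    by (simp add: c_def cnorm_def L2_set_def sum_nonneg)
  have "(\<Sum>i<d'. (cmod (a i))\<^sup>2) = (\<Sum>i<d'. (cmod (v i))\<^sup>2) / c\<^sup>2"
    using c by (simp add: a_def norm_divide power_divide sum_divide_distrib)
  also have "\<dots> = 1" using c unfolding c2[symmetric] by simp
  finally show "cnorm d' (\<lambda>i. cnj (v i) / of_real (cnorm d' v)) \<le> 1"
    by (simp add: cnorm_def L2_set_def a_def c_def)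
  have "(\<Sum>i<d'. a i * v i) = (\<Sum>i<d'. of_real ((cmod (v i))\<^sup>2)) / of_real c"
  proof -
    have "cnj z * z = of_real ((cmod z)\<^sup>2)" for z
      by (simp only: complex_norm_square mult.commute)
    then show ?thesis unfolding a_def by (simp only: times_divide_eq_left sum_divide_distrib)
  qed
  also have "\<dots> = of_real (c\<^sup>2 / c)" using c2 by simp
  also have "c\<^sup>2 / c = c" using c by (simp add: power2_eq_square)
  finally show "(\<Sum>i<d'. cnj (v i) / of_real (cnorm d' v) * v i) = of_real (cnorm d' v)"
    by (simp add: a_def c_def)
qed

text \<open>Contrapositive form of the theorem with explicit constants: small mass of
  \<open>ball x (M * r)\<close> bounds the norm of the potential.\<close>

lemma potential_cnorm_le:
  fixes \<mu> :: "(real^'n) measure" and M \<tau> \<theta> :: real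
  assumes nice: "nice_measure s \<Lambda> \<mu>" and K: "cz_kernel d' s \<alpha> K"
    and \<alpha>: "0 < \<alpha>" "\<alpha> \<le> 1" and s_lt: "s < real CARD('n)"
    and refl: "reflectionless d' s \<alpha> K \<mu>" and \<eta>: "normalizer \<mu> \<eta>"
    and rp: "0 < r" and r: "infdist x (measure_support \<mu>) = r"
    and M: "6 \<le> M" and th: "0 < \<theta>"
    and small: "measure \<mu> (ball x (M * r)) \<le> \<tau> * r powr s"
  shows "cnorm d' (\<lambda>i. potential (K i) \<mu> \<eta> (\<lambda>_. 1) x) \<le> \<tau>
     + 4 ^ (CARD('n) + 1) / 2 * (2 powr (s + 1) * \<Lambda> * \<theta> + 8 * \<theta> powr (- s) * 4 powr s * \<tau>)
     + 2 powr s * (4 powr s * 4 / 3 + 1) * \<tau>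
     + kernel_const s \<alpha> (kernel_seminorm d' s \<alpha> K) * 3 powr \<alpha> * (\<Lambda> * 2 powr s / (1 - 2 powr (- \<alpha>))) * M powr (- \<alpha>)"
    (is "?P \<le> ?b")
proof (cases "0 < ?P")
  case True
  interpret nice_measure s \<Lambda> \<mu> by (rule nice)
  \<comment> \<open>The distance to the empty set is \<open>0\<close> by convention, which
    \<open>0 < r\<close> excludes.\<close>
  have "measure_support \<mu> \<noteq> {}"
    using rp r by (auto simp: infdist_def)
  then obtain x0 where x0: "x0 \<in> measure_support \<mu>" "infdist x (measure_support \<mu>) = dist x x0"
    using infdist_attains_inf[OF closed_measure_support] by blast
  have "ball x r \<subseteq> - measure_support \<mu>"
    using r infdist_le[of _ "measure_support \<mu>" x] by force
  then have null: "emeasure \<mu> (ball x r) = 0"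
    using emeasure_mono[of "ball x r" "- measure_support \<mu>" \<mu>] emeasure_Compl_support closed_measure_support
    by (simp add: sets_mu borel_comp)
  obtain p j where p: "p \<in> ball x0 r" and pj: "0 < measure \<mu> (ball p (r / 4 ^ j))"
    "measure \<mu> (ball p (r / 4 ^ j)) \<le> 4 ^ (CARD('n) + 1) * measure \<mu> (ball p (r / 4 ^ Suc j))"
    "\<And>i. i \<le> j \<Longrightarrow> (4 ^ (CARD('n) + 1)) ^ i * measure \<mu> (ball p (r / 4 ^ i)) \<le> measure \<mu> (ball p r)"
    using exists_doubling_scale[OF x0(1) rp] by blast
  have px: "dist p x \<le> 2 * r"
    using p x0(2) r dist_triangle[of p x x0] by (simp add: dist_commute)
  \<comment> \<open>The vector depends on the limit only, not on the cutoff, so one scalar kernel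
    serves the whole sequence.\<close>
  obtain a where a: "cnorm d' a \<le> 1"
    "(\<Sum>i<d'. a i * potential (K i) \<mu> \<eta> (\<lambda>_. 1) x) = of_real ?P"
    using cnorm_dual[OF True] by blast
  define k where "k = (\<lambda>x. \<Sum>i<d'. a i * K i x)"
  interpret cz_setting s \<Lambda> \<mu> \<alpha> "kernel_seminorm d' s \<alpha> K" k
    unfolding k_def by (rule cz_setting_combination[OF nice K \<alpha> a(1)])
  interpret D: doubling_configuration s \<Lambda> \<mu> \<alpha> "kernel_seminorm d' s \<alpha> K" k x p r M \<tau>
      "4 ^ (CARD('n) + 1)" "r / 4 ^ Suc j" j
    using rp null px M small s_lt pj by unfold_locales auto
  define \<psi> where "\<psi> j = bump (0::real^'n) (real j + 1)" for j
  have \<psi>: "cutoff_sequence \<psi>" unfolding \<psi>_def by (rule cutoff_sequence_bump)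
  have lim: "(\<lambda>j. pot_approx (K i) \<mu> x (\<lambda>y. of_real (D.g y)) (\<psi> j)) \<longlonglongrightarrow> potential (K i) \<mu> \<eta> (\<lambda>_. 1) x"
    if "i < d'" for i
    using refl that
    by (intro cz_setting.potential_limit_change_normalizer[OF cz_setting_component[OF nice K \<alpha> that] rp null \<eta> \<psi> D.g_normalizer])
      (auto simp: reflectionless_def)
  have "(\<lambda>j. \<Sum>i<d'. a i * pot_approx (K i) \<mu> x (\<lambda>y. of_real (D.g y)) (\<psi> j)) \<longlonglongrightarrow>
      (\<Sum>i<d'. a i * potential (K i) \<mu> \<eta> (\<lambda>_. 1) x)"
    by (intro tendsto_sum tendsto_mult_left lim) auto
  moreover have "(\<Sum>i<d'. a i * pot_approx (K i) \<mu> x (\<lambda>y. of_real (D.g y)) (\<psi> j))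
      = pot_approx k \<mu> x (\<lambda>y. of_real (D.g y)) (\<psi> j)" for j
    unfolding k_def using \<psi>
    by (intro pot_approx_combination[OF nice K \<alpha> rp null normalizer_Lip0(1)[OF D.g_normalizer], symmetric])
      (auto simp: cutoff_sequence_def)
  ultimately have lim: "(\<lambda>j. cmod (pot_approx k \<mu> x (\<lambda>y. of_real (D.g y)) (\<psi> j))) \<longlonglongrightarrow> cmod (of_real ?P)"
    unfolding a(2) by (intro tendsto_norm) simp
  obtain N where N: "D.Q \<subseteq> ball 0 N"
    using bounded_subset_ballD[OF bounded_ball] by blast
  obtain n :: nat where n: "N \<le> real n" using real_arch_simple by blast
  \<comment> \<open>The estimate needs the cutoff to be \<open>1\<close> on \<open>Q\<close>, hence
    only late indices.\<close>
  have "cmod (pot_approx k \<mu> x (\<lambda>y. of_real (D.g y)) (\<psi> j)) \<le> ?b" if "n \<le> j" for j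
  proof (rule D.pot_approx_le[OF _ _ _ _ th])
    show "\<psi> j y = 1" if "y \<in> D.Q" for y
    proof -
      have "y \<in> ball 0 (real j)" using that N n \<open>n \<le> j\<close> by force
      then show ?thesis using \<psi> by (auto simp: cutoff_sequence_def)
    qed
  qed (use \<psi> in \<open>auto simp: cutoff_sequence_def\<close>)
  then have "cmod (of_real ?P) \<le> ?b" by (intro LIMSEQ_le_const2[OF lim]) blast
  then show ?thesis using True by simp
next
  \<comment> \<open>The dual vector divides by the norm, so norm zero is treated apart; here it
    suffices that the bound is nonnegative.\<close>
  case False
  have "2 powr (- \<alpha>) < 1" using \<alpha> by (simp add: powr_less_one)
  moreover have "0 \<le> \<tau> * r powr s" using small measure_nonneg order_trans by blast
  then have "0 \<le> \<tau>" using rp by (simp add: zero_le_mult_iff)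
  moreover have "0 < \<Lambda>" "0 < s" using nice by (auto simp: nice_measure_def)
  ultimately have "0 \<le> ?b"
    using kernel_seminorm_nonneg[OF K] \<alpha> th
    by (intro add_nonneg_nonneg mult_nonneg_nonneg divide_nonneg_nonneg) (auto simp: kernel_const_def)
  then show ?thesis using False by linarith
qed

section \<open>Choice of the constants\<close>

theorem corollary6p5:
  fixes s \<alpha> \<kappa> \<Lambda> \<epsilon> :: real
  assumes "CARD('n::finite) \<ge> 2"
    and "0 < s" and "s < real CARD('n)"
    and "0 < \<alpha>" and "\<alpha> \<le> 1"
    and "0 < \<Lambda>"
    and "0 < \<epsilon>" and "\<epsilon> < 1/2"
  shows "\<exists>M'>0. \<exists>\<tau>'>0.
    \<forall>(d'::nat) (K :: nat \<Rightarrow> real^'n \<Rightarrow> complex) (\<mu> :: (real^'n) measure)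
     (\<eta> :: real^'n \<Rightarrow> real) (x :: real^'n) (r :: real).
      d' \<ge> 1 \<longrightarrow> cz_kernel d' s \<alpha> K \<longrightarrow> kernel_seminorm d' s \<alpha> K = \<kappa> \<longrightarrow>
      locally_finite_borel \<mu> \<longrightarrow> nontrivial_measure \<mu> \<longrightarrow> nice s \<Lambda> \<mu> \<longrightarrow>
      reflectionless d' s \<alpha> K \<mu> \<longrightarrow>
      normalizer \<mu> \<eta> \<longrightarrow>
      potential_defined s \<mu> x \<longrightarrow>
      cnorm d' (\<lambda>i. potential (K i) \<mu> \<eta> (\<lambda>_. 1) x) > \<epsilon> \<longrightarrow>
      infdist x (measure_support \<mu>) = r \<longrightarrow>
      emeasure \<mu> (ball x (M' * r)) \<ge> ennreal (\<tau>' * r powr s)"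
proof -
  note s = assms(2,3) and \<alpha> = assms(4,5) and \<Lambda> = assms(6) and \<epsilon> = assms(7)
  \<comment> \<open>The absolute value makes \<open>L\<close> nonnegative although
    \<open>\<kappa>\<close> is an arbitrary real here; it becomes a seminorm only once a kernel is
    given.\<close>
  define L where "L = \<bar>kernel_const s \<alpha> \<kappa> * 3 powr \<alpha> * (\<Lambda> * 2 powr s / (1 - 2 powr (- \<alpha>)))\<bar>"
  \<comment> \<open>Makes the far part at most \<open>\<epsilon> / 4\<close>; \<open>L + 1\<close>
    is positive also when \<open>L\<close> is \<open>0\<close>.\<close>
  define M where "M = max 6 ((4 * (L + 1) / \<epsilon>) powr (1 / \<alpha>))"
  define A :: real where "A = 4 ^ (CARD('n) + 1)"
  \<comment> \<open>Makes the niceness term of the local part equal to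
    \<open>\<epsilon> / 4\<close>.\<close>
  define \<theta> where "\<theta> = \<epsilon> / (2 * A * 2 powr (s + 1) * \<Lambda>)"
  \<comment> \<open>The total coefficient of \<open>\<tau>\<close> in the bound. It contains a
    negative power of \<open>\<theta>\<close>, so \<open>\<tau>\<close> can be fixed only
    now.\<close>
  define c where "c = 1 + A / 2 * (8 * \<theta> powr (- s) * 4 powr s) + 2 powr s * (4 powr s * 4 / 3 + 1)"
  define \<tau> where "\<tau> = \<epsilon> / (4 * c)"
  have L: "0 \<le> L" by (simp add: L_def)
  have A: "0 < A" by (simp add: A_def)
  have M: "6 \<le> M" by (simp add: M_def)
  have \<theta>: "0 < \<theta>" using A \<Lambda> \<epsilon> by (simp add: \<theta>_def)
  have c: "0 < c" unfolding c_def using A by (intro add_pos_nonneg mult_nonneg_nonneg) auto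
  have \<tau>: "0 < \<tau>" using c \<epsilon> by (simp add: \<tau>_def)
  have "M powr (- \<alpha>) \<le> ((4 * (L + 1) / \<epsilon>) powr (1 / \<alpha>)) powr (- \<alpha>)"
    using L \<epsilon> \<alpha> by (intro powr_mono2') (auto simp: M_def)
  also have "\<dots> = \<epsilon> / (4 * (L + 1))"
    using L \<epsilon> \<alpha> by (simp add: powr_powr powr_minus)
  finally have "L * M powr (- \<alpha>) \<le> L * (\<epsilon> / (4 * (L + 1)))"
    using L by (intro mult_left_mono)
  also have "\<dots> \<le> \<epsilon> / 4" using L \<epsilon> by (simp add: field_simps)
  finally have b1: "L * M powr (- \<alpha>) \<le> \<epsilon> / 4" .
  have b2: "A / 2 * (2 powr (s + 1) * \<Lambda> * \<theta>) = \<epsilon> / 4"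
    using A \<Lambda> by (simp add: \<theta>_def)
  have b3: "c * \<tau> = \<epsilon> / 4" using c by (simp add: \<tau>_def)
  have "ennreal (\<tau> * r powr s) \<le> emeasure \<mu> (ball x (M * r))"
    if K: "cz_kernel d' s \<alpha> K" and \<kappa>: "kernel_seminorm d' s \<alpha> K = \<kappa>"
      and lf: "locally_finite_borel \<mu>" and ni: "nice s \<Lambda> \<mu>"
      and refl: "reflectionless d' s \<alpha> K \<mu>" and \<eta>: "normalizer \<mu> \<eta>"
      and big: "cnorm d' (\<lambda>i. potential (K i) \<mu> \<eta> (\<lambda>_. 1) x) > \<epsilon>"
      and r: "infdist x (measure_support \<mu>) = r"
    for d' :: nat and K :: "nat \<Rightarrow> real^'n \<Rightarrow> complex" and \<mu> \<eta> and x :: "real^'n" and r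
  proof (rule ccontr)
    assume neg: "\<not> ennreal (\<tau> * r powr s) \<le> emeasure \<mu> (ball x (M * r))"
    interpret nice_measure s \<Lambda> \<mu>
      using s \<Lambda> lf ni by unfold_locales (auto simp: locally_finite_borel_def)
    \<comment> \<open>At \<open>r = 0\<close> the claim is trivial, because \<open>0 powr s\<close>
      is \<open>0\<close>.\<close>
    have "r \<noteq> 0" using neg by auto
    then have rp: "0 < r" using r infdist_nonneg[of x "measure_support \<mu>"] by simp
    have small: "measure \<mu> (ball x (M * r)) \<le> \<tau> * r powr s"
      using neg \<tau> by (simp add: emeasure_ball_eq not_le ennreal_less_iff)
    have "cnorm d' (\<lambda>i. potential (K i) \<mu> \<eta> (\<lambda>_. 1) x) \<le> \<tau>
     + A / 2 * (2 powr (s + 1) * \<Lambda> * \<theta> + 8 * \<theta> powr (- s) * 4 powr s * \<tau>)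
     + 2 powr s * (4 powr s * 4 / 3 + 1) * \<tau>
     + kernel_const s \<alpha> \<kappa> * 3 powr \<alpha> * (\<Lambda> * 2 powr s / (1 - 2 powr (- \<alpha>))) * M powr (- \<alpha>)"
      unfolding A_def \<kappa>[symmetric]
      by (rule potential_cnorm_le[OF nice_measure_axioms K \<alpha> s(2) refl \<eta> rp r M \<theta> small])
    also have "\<dots> \<le> c * \<tau> + A / 2 * (2 powr (s + 1) * \<Lambda> * \<theta>) + L * M powr (- \<alpha>)"
    proof -
      have "kernel_const s \<alpha> \<kappa> * 3 powr \<alpha> * (\<Lambda> * 2 powr s / (1 - 2 powr (- \<alpha>))) * M powr (- \<alpha>) \<le> L * M powr (- \<alpha>)"
        unfolding L_def by (rule mult_right_mono[OF abs_ge_self]) simp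
      then show ?thesis by (simp add: c_def algebra_simps)
    qed
    \<comment> \<open>Three quarters of \<open>\<epsilon>\<close> are spent.\<close>
    also have "\<dots> \<le> \<epsilon>" using b1 b2 b3 \<epsilon> by linarith
    finally show False using big by simp
  qed
  moreover have "0 < M" using M by simp
  ultimately show ?thesis using \<tau> by blast
qed

end
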